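(* Let $\gamma$ be the positive real number such that the system $$\dot x=y,\qquad \dot y=\beta y-\alpha x^2+\alpha^2x-xy,\qquad \alpha<0,$$ has a limit cycle if and only if $\gamma<\beta/\alpha<1$. Then $$\gamma\in\left(\frac{1127949288}{1304673517},\ \frac{1223980221}{1415750330}\right)\simeq(0.864545247,\ 0.8645452486).$$
   Context: Existence of $\gamma$. It is known (Han) that there is a positive constant $\gamma$ such that, for all real $\alpha<0$ and $\beta$, the system $\dot x=y$, $\dot y=\beta y-\alpha x^2+\alpha^2x-xy$ has a limit cycle if and only if $\gamma<\beta/\alpha<1$. The decimal interval in the claim is only an approximation of the exact rational endpoints. *)

theory Defs
  imports "HOL-Analysis.Analysis"
begin

definition solves_ode :: "(real \<times> real \<Rightarrow> real \<times> real) \<Rightarrow> (real \<Rightarrow> real \<times> real) \<Rightarrow> bool" where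
  "solves_ode F z \<longleftrightarrow> (\<forall>t. (z has_vector_derivative F (z t)) (at t))"

text \<open>Periodic orbits are non-constant, so equilibria are excluded; the period need not be minimal.\<close>

definition periodic_orbit :: "(real \<times> real \<Rightarrow> real \<times> real) \<Rightarrow> (real \<times> real) set \<Rightarrow> bool" where
  "periodic_orbit F C \<longleftrightarrow>
     (\<exists>z T. solves_ode F z \<and> T > 0 \<and> (\<forall>t. z (t + T) = z t) \<and> \<not> z constant_on UNIV \<and> C = range z)"

text \<open>A limit cycle is a periodic orbit that is isolated among the periodic orbits:
  some neighbourhood of it contains no other periodic orbit.\<close>

definition limit_cycle :: "(real \<times> real \<Rightarrow> real \<times> real) \<Rightarrow> (real \<times> real) set \<Rightarrow> bool" where
  "limit_cycle F C \<longleftrightarrow>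
     periodic_orbit F C \<and>
     (\<exists>U. open U \<and> C \<subseteq> U \<and> (\<forall>C'. periodic_orbit F C' \<and> C' \<subseteq> U \<longrightarrow> C' = C))"

definition BT_field :: "real \<Rightarrow> real \<Rightarrow> real \<times> real \<Rightarrow> real \<times> real" where
  "BT_field \<alpha> \<beta> = (\<lambda>(x, y). (y, \<beta> * y - \<alpha> * x\<^sup>2 + \<alpha>\<^sup>2 * x - x * y))"

end

theory Submission
  imports Defs
begin

text \<open>
  For \<open>\<alpha> = -1\<close>, \<open>\<beta> = -c\<close> and \<open>w = x + 1\<close>, \<open>v = y\<close> the system is the Lienard system
  \<open>w' = v\<close>, \<open>v' = -g w - f w * v\<close> with \<open>g w = w (1 - w)\<close>, \<open>f w = w - d\<close>, \<open>d = 1 - c\<close>, which has a saddle at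
  \<open>w = 1\<close> and a focus at \<open>w = 0\<close>; this single value of \<open>\<alpha>\<close> determines \<open>\<gamma>\<close>. An explicit polynomial loop
  \<open>\<Lambda>\<close> through the saddle, very close to the homoclinic orbit at \<open>c = \<gamma>\<close>, is crossed outwards by the flow for
  \<open>c = 0.8645452471\<close> and inwards for \<open>c = 0.8645452485\<close>.

  A Dulac--Cherkas function \<open>\<Psi> = v^2 + b w * v + a w\<close> has \<open>\<Psi>' + f \<Psi> / 2 = h w > 0\<close> along the flow, so
  \<open>1 / \<Psi>^2\<close> is a Dulac function with divergence \<open>-2 h / \<Psi>^3\<close>. By the divergence theorem no periodic orbit
  lies in \<open>\<Psi> < 0\<close>, and no periodic orbit in \<open>\<Psi> > 0\<close> lies inside another one or inside an outward loop. Hence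
  there is no periodic orbit for the smaller \<open>c\<close>, so \<open>\<gamma>\<close> is at least that value. For the larger \<open>c\<close> the return map of
  the annulus between \<open>\<Psi> = 0\<close> and the loop is monotone and therefore has a fixed point; by the same
  uniqueness argument this periodic orbit is isolated, so \<open>\<gamma>\<close> is smaller than that value.
\<close>

section \<open>Existence and uniqueness for Lipschitz differential equations\<close>

text \<open>Origin of \<Psi>: for a monic quadratic in \<open>v\<close>, requiring \<Psi>' + f
  \<Psi> / 2 to be free of \<open>v\<close> forces b' = 3/2 f and a' = 2 g + f b / 2, and then h = f
  a / 2 - g b. The field has divergence -f, so division by \<Psi>^2 gives exactly the divergence -2
  (\<Psi>' + f \<Psi> / 2) / \<Psi>^3. The obstacle is that the two parameters differ by only
  1.4e-9. The defect of the loop vanishes at the saddle and at the leftmost point, so a strict sign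
  can be certified only after the factor (1 - w) t is divided out. What remains is decreasing in
  \<open>d\<close>, which lets a single loop serve both parameters. Planar topology is replaced by
  calculus in one variable: a periodic orbit is cut at v = 0 into two graphs over \<open>w\<close>,
  the lower one treated after reflection. Order of orbits, trapping and the divergence theorem
  become statements about functions of \<open>w\<close>, and the terms created by cutting along the
  axis cancel between the halves. Nested half-orbits do not cross, so the return map preserves
  order, and a fixed point theorem for monotone maps takes the place of Poincare-Bendixson.\<close>

lemma ode_unique_forward:
  fixes x y :: "real \<Rightarrow> 'a::real_inner"
  assumes ab: "a \<le> b" and cont: "continuous_on {a..b} x" "continuous_on {a..b} y"
    and dx: "\<And>t. a < t \<Longrightarrow> t < b \<Longrightarrow> (x has_vector_derivative x' t) (at t)"
    and dy: "\<And>t. a < t \<Longrightarrow> t < b \<Longrightarrow> (y has_vector_derivative y' t) (at t)"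
    and lip: "\<And>t. a < t \<Longrightarrow> t < b \<Longrightarrow> norm (x' t - y' t) \<le> L * norm (x t - y t)"
    and eq: "x a = y a"
  shows "x b = y b"
proof -
  \<comment> \<open>The factor \<open>exp (-2 * L * t)\<close> absorbs the Gronwall growth: the
    squared distance has derivative at most \<open>2 * L\<close> times itself, so \<open>n\<close>
    does not increase.\<close>
  define n where "n t = exp (-2 * L * t) * ((x t - y t) \<bullet> (x t - y t))" for t
  have "n b \<le> n a"
  proof (cases "a = b")
    case False
    show ?thesis
    proof (rule DERIV_nonpos_imp_decreasing_open[where f = n])
      show "a \<le> b" by fact
      show "continuous_on {a..b} n" unfolding n_def by (intro continuous_intros cont)
      fix t assume t: "a < t" "t < b"
      let ?d = "x t - y t"
      let ?D = "exp (-2 * L * t) * (2 * (?d \<bullet> (x' t - y' t))) - 2 * L * exp (-2 * L * t) * (?d \<bullet> ?d)"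
      have "((\<lambda>t. x t - y t) has_vector_derivative (x' t - y' t)) (at t)"
        by (intro has_vector_derivative_diff dx dy t)
      then have 1: "((\<lambda>t. (x t - y t) \<bullet> (x t - y t)) has_real_derivative 2 * (?d \<bullet> (x' t - y' t))) (at t)"
        unfolding has_real_derivative_iff_has_vector_derivative
        using bounded_bilinear.has_vector_derivative[OF bounded_bilinear_inner] by (fastforce simp: inner_commute)
      have "(n has_real_derivative ?D) (at t)"
        unfolding n_def by (auto intro!: derivative_eq_intros 1)
      moreover have "?d \<bullet> (x' t - y' t) \<le> norm ?d * norm (x' t - y' t)"
        by (rule norm_cauchy_schwarz)
      moreover have "\<dots> \<le> norm ?d * (L * norm ?d)"
        by (rule mult_left_mono[OF lip[OF t]]) simp
      moreover have "\<dots> = L * (?d \<bullet> ?d)" by (simp add: dot_square_norm power2_eq_square)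
      ultimately have "?d \<bullet> (x' t - y' t) \<le> L * (?d \<bullet> ?d)" by linarith
      then have "exp (-2 * L * t) * (2 * (?d \<bullet> (x' t - y' t)) - 2 * (L * (?d \<bullet> ?d))) \<le> 0"
        by (intro mult_nonneg_nonpos) auto
      then have "?D \<le> 0" by (simp add: right_diff_distrib mult.assoc mult.left_commute[of _ L])
      with \<open>(n has_real_derivative ?D) (at t)\<close> show "\<exists>y. DERIV n t :> y \<and> y \<le> 0" by blast
    qed
  qed auto
  moreover have "n a = 0" by (simp add: n_def eq)
  ultimately have "(x b - y b) \<bullet> (x b - y b) \<le> 0"
    by (simp add: n_def mult_le_0_iff)
  then show ?thesis by (metis inner_gt_zero_iff linorder_not_less right_minus_eq)
qed

lemma ode_unique:
  fixes x y :: "real \<Rightarrow> 'a::real_inner"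
  assumes dx: "\<And>t. (x has_vector_derivative x' t) (at t)"
    and dy: "\<And>t. (y has_vector_derivative y' t) (at t)"
    and lip: "\<And>t. norm (x' t - y' t) \<le> L * norm (x t - y t)"
    and eq: "x t0 = y t0"
  shows "x t = y t"
proof (cases "t0 \<le> t")
  case True
  have "continuous_on {t0..t} x" "continuous_on {t0..t} y"
    using dx dy by (blast intro: has_vector_derivative_continuous continuous_at_imp_continuous_on)+
  then show ?thesis using ode_unique_forward[OF True _ _ dx dy lip eq] by blast
next
  case False
  have r: "((\<lambda>s. x (- s)) has_vector_derivative - x' (- s)) (at s)"
          "((\<lambda>s. y (- s)) has_vector_derivative - y' (- s)) (at s)" for s
    using vector_diff_chain_at[of uminus "-1" s x "x' (-s)"] vector_diff_chain_at[of uminus "-1" s y "y' (-s)"] dx dy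
      has_vector_derivative_minus[OF has_vector_derivative_id, of "at s"]
    by (auto simp: o_def)
  have "continuous_on {-t0..-t} (\<lambda>s. x (- s))" "continuous_on {-t0..-t} (\<lambda>s. y (- s))"
    using r by (blast intro: has_vector_derivative_continuous continuous_at_imp_continuous_on)+
  then have "x (- (- t)) = y (- (- t))"
    by (rule ode_unique_forward[of "-t0" "-t", rotated 1, OF _ _ r, where L=L])
       (use False lip eq in \<open>auto simp: norm_minus_commute\<close>)
  then show ?thesis by simp
qed

text \<open>A Picard fixed point for \<open>y = z / E\<close>. The weight
  \<open>E t = exp (2 * L * t)\<close> gives the integral operator the contraction factor 1/2 on the
  whole half-line at once, so no local solutions have to be glued. The bound \<open>B\<close> keeps
  the image of the operator bounded.\<close>

lemma ode_exists:
  fixes H :: "'a::euclidean_space \<Rightarrow> 'a"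
  assumes L: "L > 0" and lip: "\<And>x y. norm (H x - H y) \<le> L * norm (x - y)"
    and bnd: "\<And>x. norm (H x) \<le> B"
  obtains z where "z 0 = x0" "\<And>t. t \<ge> 0 \<Longrightarrow> (z has_vector_derivative H (z t)) (at t within {0..})"
proof -
  define E where "E t = exp (2 * L * t)" for t :: real
  define h where "h y s = H (E s *\<^sub>R y s)" for y :: "real \<Rightarrow> 'a" and s
  \<comment> \<open>For negative times \<open>max 0 t\<close> freezes the value at 0, which makes
    \<open>G y\<close> a function on all of \<open>real\<close>.\<close>
  define G where "G y t = (1 / E (max 0 t)) *\<^sub>R (x0 + integral {0..max 0 t} (h y))" for y t
  have contH: "continuous_on UNIV H"
  proof (rule continuous_onI)
    fix x e assume e: "(0::real) < e"
    have "dist (H y) (H x) \<le> e" if "dist y x < e / L" for y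
      using lip[of y x] that L by (simp add: dist_norm field_simps) 
    then show "\<exists>d>0. \<forall>x'\<in>UNIV. dist x' x < d \<longrightarrow> dist (H x') (H x) \<le> e"
      using e L by (intro exI[of _ "e / L"]) auto
  qed
  have B: "B \<ge> 0" using bnd[of 0] norm_ge_zero order_trans by blast
  have conth: "continuous_on S (h y)" if "continuous_on UNIV y" for y S
    unfolding h_def E_def
    by (rule continuous_on_compose2[OF contH])
       (auto intro!: continuous_intros continuous_on_subset[OF that])
  have inth: "h y integrable_on {a..b}" if "continuous_on UNIV y" for y a b
    by (rule integrable_continuous_real[OF conth[OF that]])
  have contI: "continuous_on UNIV (\<lambda>t. integral {0..max 0 t} (h y))" if y: "continuous_on UNIV y" for y
  proof -
    have "continuous_on {..b} (\<lambda>t. integral {0..max 0 t} (h y))" for b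
    proof (rule continuous_on_compose2[where f = "max 0" and t = "{0..max 0 b}"])
      show "continuous_on {0..max 0 b} (\<lambda>t. integral {0..t} (h y))"
        by (rule indefinite_integral_continuous_1[OF inth[OF y]])
    qed (auto intro!: continuous_intros)
    then have "continuous_on {..<b} (\<lambda>t. integral {0..max 0 t} (h y))" for b
      by (rule continuous_on_subset[where s = "{..b}"]) auto
    then have "isCont (\<lambda>t. integral {0..max 0 t} (h y)) t" for t
      by (rule continuous_on_interior[of "{..<t+1}"]) (simp add: interior_open)
    then show ?thesis by (simp add: continuous_at_imp_continuous_on)
  qed
  have Epos: "E t > 0" for t by (simp add: E_def)
  have G: "G y \<in> bcontfun" if y: "continuous_on UNIV y" for y
  proof (rule bcontfun_normI)
    show "continuous_on UNIV (G y)" unfolding G_def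
      using contI[OF y] by (intro continuous_intros) (auto simp: E_def intro!: continuous_intros)
    fix t :: real
    let ?s = "max 0 t"
    have "norm (integral {0..?s} (h y)) \<le> B * (?s - 0)"
      by (rule integral_bound) (use conth[OF y] in \<open>auto simp: h_def bnd\<close>)
    then have "norm (integral {0..?s} (h y)) \<le> B * ?s" by (simp only: diff_zero)
    moreover have e: "s \<le> E s / (2 * L)" for s
    proof -
      have "2 * L * s \<le> exp (2 * L * s)" using exp_ge_add_one_self[of "2 * L * s"] by linarith
      then show ?thesis using L by (simp add: E_def pos_le_divide_eq mult.commute mult.left_commute)
    qed
    moreover have "B * ?s \<le> B * (E ?s / (2 * L))" by (rule mult_left_mono[OF e B])
    moreover have "1 \<le> E ?s" using L by (simp add: E_def)
    then have "norm x0 \<le> norm x0 * E ?s" by (simp add: mult_ge1_I mult_le_cancel_left1)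
    ultimately have "norm (x0 + integral {0..?s} (h y)) \<le> norm x0 * E ?s + B * (E ?s / (2 * L))"
      using norm_triangle_ineq[of x0 "integral {0..?s} (h y)"] by linarith
    then show "norm (G y t) \<le> norm x0 + B / (2 * L)"
    proof -
      assume a: "norm (x0 + integral {0..?s} (h y)) \<le> norm x0 * E ?s + B * (E ?s / (2 * L))"
      have "norm (G y t) = norm (x0 + integral {0..?s} (h y)) / E ?s"
        using Epos[of ?s] unfolding G_def by simp
      also have "\<dots> \<le> (norm x0 * E ?s + B * (E ?s / (2 * L))) / E ?s"
        using a Epos[of ?s] by (intro divide_right_mono) auto
      also have "\<dots> = norm x0 + B / (2 * L)" using Epos[of ?s] L by (simp add: field_simps)
      finally show ?thesis .
    qed
  qed
  define T where "T y = Bcontfun (G (apply_bcontfun y))" for y :: "real \<Rightarrow>\<^sub>C 'a"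
  have Tapp: "apply_bcontfun (T y) = G (apply_bcontfun y)" for y
    unfolding T_def by (rule Bcontfun_inverse) (rule G, simp)
  have contr: "dist (T y1) (T y2) \<le> (1/2) * dist y1 y2" for y1 y2
  proof (rule dist_bound)
    fix t :: real
    let ?s = "max 0 t" and ?D = "dist y1 y2"
    have c: "continuous_on UNIV (apply_bcontfun y)" for y :: "real \<Rightarrow>\<^sub>C 'a" by simp
    have eq: "integral {0..?s} (h y1) - integral {0..?s} (h y2) = integral {0..?s} (\<lambda>s. h y1 s - h y2 s)"
      by (rule integral_diff[symmetric]) (intro inth c)+
    have le1: "norm (integral {0..?s} (\<lambda>s. h y1 s - h y2 s)) \<le> integral {0..?s} (\<lambda>s. L * (E s * ?D))"
    proof (rule integral_norm_bound_integral)
      show "(\<lambda>s. h y1 s - h y2 s) integrable_on {0..?s}" by (intro integrable_diff inth c)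
      show "(\<lambda>s. L * (E s * ?D)) integrable_on {0..?s}"
        unfolding E_def by (intro integrable_continuous_real continuous_intros)
      fix s
      have "norm (h y1 s - h y2 s) \<le> L * norm (E s *\<^sub>R y1 s - E s *\<^sub>R y2 s)" unfolding h_def by (rule lip)
      also have "norm (E s *\<^sub>R y1 s - E s *\<^sub>R y2 s) = E s * dist (y1 s) (y2 s)"
        using Epos[of s] by (simp add: dist_norm flip: scaleR_diff_right)
      also have "L * (E s * dist (y1 s) (y2 s)) \<le> L * (E s * ?D)"
        using L Epos[of s] dist_bounded by (intro mult_left_mono) (auto intro: less_imp_le)
      finally show "norm (h y1 s - h y2 s) \<le> L * (E s * ?D)" .
    qed
    have "((\<lambda>s. L * (E s * ?D)) has_integral (E ?s * ?D / 2 - E 0 * ?D / 2)) {0..?s}"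
      by (rule fundamental_theorem_of_calculus)
         (use L in \<open>auto simp: E_def simp flip: has_real_derivative_iff_has_vector_derivative intro!: derivative_eq_intros\<close>)
    then have "integral {0..?s} (\<lambda>s. L * (E s * ?D)) = E ?s * ?D / 2 - E 0 * ?D / 2" by (rule integral_unique)
    moreover have "E 0 * ?D / 2 \<ge> 0" using Epos[of 0] by simp
    ultimately have "integral {0..?s} (\<lambda>s. L * (E s * ?D)) \<le> E ?s * ?D / 2" by linarith
    with le1 have *: "norm (integral {0..?s} (h y1) - integral {0..?s} (h y2)) \<le> E ?s * ?D / 2"
      unfolding eq by (rule order_trans)
    have "T y1 t - T y2 t = (1 / E ?s) *\<^sub>R (integral {0..?s} (h y1) - integral {0..?s} (h y2))"
      unfolding Tapp G_def by (simp add: scaleR_diff_right scaleR_add_right)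
    then have "dist (T y1 t) (T y2 t) = (1 / E ?s) * norm (integral {0..?s} (h y1) - integral {0..?s} (h y2))"
      using Epos[of ?s] by (simp only: dist_norm norm_scaleR) simp
    also have "\<dots> \<le> (1 / E ?s) * (E ?s * ?D / 2)"
      by (rule mult_left_mono[OF *]) (use Epos[of ?s] in auto)
    finally show "dist (T y1 t) (T y2 t) \<le> (1/2) * ?D" using Epos[of ?s] by simp
  qed
  have "\<exists>!y. T y = y"
    by (rule banach_fix_type[of "1/2"]) (simp_all add: contr del: times_divide_eq_left)
  then obtain y where y: "T y = y" by blast
  have yG: "apply_bcontfun y = G (apply_bcontfun y)" using Tapp[of y] y by simp
  define z where "z t = E t *\<^sub>R y t" for t
  have z: "z t = x0 + integral {0..t} (\<lambda>s. H (z s))" if "t \<ge> 0" for t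
  proof -
    have "z t = E t *\<^sub>R G y t" unfolding z_def by (subst yG) simp
    also have "\<dots> = x0 + integral {0..t} (h y)" using that Epos[of t] by (simp add: G_def)
    also have "h y = (\<lambda>s. H (z s))" by (simp add: h_def z_def fun_eq_iff)
    finally show ?thesis .
  qed
  have cHz: "continuous_on S (\<lambda>s. H (z s))" for S
    using conth[of y S] by (simp add: h_def z_def)
  show ?thesis
  proof
    show "z 0 = x0" using z[of 0] by simp
    fix t :: real assume t: "t \<ge> 0"
    have "((\<lambda>u. integral {0..u} (\<lambda>s. H (z s))) has_vector_derivative H (z t)) (at t within {0..t+1})"
      by (rule integral_has_vector_derivative[OF cHz]) (use t in auto)
    then have "((\<lambda>u. x0 + integral {0..u} (\<lambda>s. H (z s))) has_vector_derivative H (z t)) (at t within {0..t+1})"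
      by (auto intro!: derivative_eq_intros)
    then have "(z has_vector_derivative H (z t)) (at t within {0..t+1})"
      by (rule has_vector_derivative_transform[rotated 2]) (use t z in auto)
    moreover have "at t within {0..t+1} = at t within {0..}"
      by (rule at_within_nhd[where S = "{..<t+1}"]) (use t in auto)
    ultimately show "(z has_vector_derivative H (z t)) (at t within {0..})" by simp
  qed
qed

section \<open>Half-orbits of Lienard systems\<close>

text \<open>The part \<open>v > 0\<close> of an orbit as a graph \<open>v = \<phi> w\<close>. The part \<open>v < 0\<close> is the half arc of the system
  reflected by \<open>(w, v) \<mapsto> (-w, -v)\<close>, which has damping \<open>f (-w)\<close> and restoring force \<open>-g (-w)\<close>.\<close>

definition half_arc :: "(real \<Rightarrow> real) \<Rightarrow> (real \<Rightarrow> real) \<Rightarrow> real \<Rightarrow> real \<Rightarrow> (real \<Rightarrow> real) \<Rightarrow> bool" where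
  "half_arc f g l r \<phi> \<longleftrightarrow> l < 0 \<and> 0 < r \<and> (\<forall>w\<in>{l..<0}. g w < 0) \<and> (\<forall>w\<in>{0<..r}. g w > 0) \<and>
     continuous_on {l..r} \<phi> \<and> \<phi> l = 0 \<and> \<phi> r = 0 \<and>
     (\<forall>w\<in>{l<..<r}. \<phi> w > 0 \<and> (\<phi> has_real_derivative - g w / \<phi> w - f w) (at w))"

lemma half_arcD:
  assumes "half_arc f g l r \<phi>"
  shows "l < 0" "0 < r" "\<And>w. l \<le> w \<Longrightarrow> w < 0 \<Longrightarrow> g w < 0" "\<And>w. 0 < w \<Longrightarrow> w \<le> r \<Longrightarrow> g w > 0"
    "continuous_on {l..r} \<phi>" "\<phi> l = 0" "\<phi> r = 0"
    "\<And>w. l < w \<Longrightarrow> w < r \<Longrightarrow> \<phi> w > 0"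
    "\<And>w. l < w \<Longrightarrow> w < r \<Longrightarrow> (\<phi> has_real_derivative - g w / \<phi> w - f w) (at w)"
    "\<And>w. l \<le> w \<Longrightarrow> w \<le> r \<Longrightarrow> \<phi> w \<ge> 0"
  using assms unfolding half_arc_def by (auto simp: order_le_less)

text \<open>With \<open>K\<close> bounding \<open>\<bar>k\<bar>\<close> on the compact interval,
  \<open>D * exp (K * w)\<close> is nondecreasing: a gap can shrink at most exponentially and never
  closes. This matters where \<open>k\<close> is negative.\<close>

lemma linear_growth_pos:
  fixes D k :: "real \<Rightarrow> real"
  assumes mn: "m \<le> n" and cD: "continuous_on {m..n} D" and ck: "continuous_on {m..n} k"
    and der: "\<And>w. m < w \<Longrightarrow> w < n \<Longrightarrow> \<exists>D'. (D has_real_derivative D') (at w) \<and> D' \<ge> k w * D w \<and> D w \<ge> 0"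
    and pos: "D m > 0"
  shows "D n > 0"
proof -
  have "compact (k ` {m..n})" by (rule compact_continuous_image[OF ck]) simp
  then have "bounded (k ` {m..n})" by (rule compact_imp_bounded)
  then obtain K where "\<forall>x\<in>k ` {m..n}. norm x \<le> K" unfolding bounded_iff by blast
  then have K: "\<And>w. w \<in> {m..n} \<Longrightarrow> \<bar>k w\<bar> \<le> K" by simp
  let ?E = "\<lambda>w. D w * exp (K * w)"
  have "?E m \<le> ?E n"
  proof (rule DERIV_nonneg_imp_increasing_open[where f = ?E])
    fix w assume w: "m < w" "w < n"
    from der[OF this] obtain D' where D': "(D has_real_derivative D') (at w)" "D' \<ge> k w * D w" "D w \<ge> 0" by blast
    have "(?E has_real_derivative (D' + K * D w) * exp (K * w)) (at w)"
      by (auto intro!: derivative_eq_intros D'(1) simp: algebra_simps)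
    moreover have "0 \<le> (K + k w) * D w" using K[of w] w D'(3) by (intro mult_nonneg_nonneg) auto
    with D'(2) have "D' + K * D w \<ge> 0" by (simp add: algebra_simps)
    ultimately show "\<exists>y. (?E has_real_derivative y) (at w) \<and> 0 \<le> y"
      by (meson exp_ge_zero mult_nonneg_nonneg)
  qed (use mn in \<open>auto intro!: continuous_intros cD\<close>)
  moreover have "?E m > 0" using pos by simp
  ultimately show ?thesis by (metis exp_gt_zero less_le_trans zero_less_mult_pos2)
qed

text \<open>Two half arcs satisfy \<open>(\<phi>2 - \<phi>1)' = g * (\<phi>2 - \<phi>1) / (\<phi>1 * \<phi>2)\<close>: the damping cancels.\<close>

lemma half_arc_less:
  assumes cg: "continuous_on UNIV g"
    and 1: "half_arc f g l1 r1 \<phi>1" and 2: "half_arc f g l2 r2 \<phi>2" and l: "l2 < l1"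
  shows "r1 < r2" "\<And>w. l1 \<le> w \<Longrightarrow> w \<le> r1 \<Longrightarrow> \<phi>1 w < \<phi>2 w"
proof -
  note d1 = half_arcD[OF 1] and d2 = half_arcD[OF 2]
  let ?D = "\<lambda>w. \<phi>2 w - \<phi>1 w"
  have cD: "continuous_on {x..y} ?D" if "l1 \<le> x" "y \<le> r1" "y \<le> r2" for x y
    using that l by (intro continuous_intros continuous_on_subset[OF d1(5)] continuous_on_subset[OF d2(5)]) auto
  have dD: "(?D has_real_derivative g w / (\<phi>1 w * \<phi>2 w) * ?D w) (at w)" if "l1 < w" "w < r1" "w < r2" for w
  proof -
    have p: "\<phi>1 w > 0" "\<phi>2 w > 0" using d1(8)[of w] d2(8)[of w] that l by auto
    have "(?D has_real_derivative (- g w / \<phi>2 w - f w) - (- g w / \<phi>1 w - f w)) (at w)"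
      using that l by (intro derivative_intros d1(9) d2(9)) auto
    moreover have "(- g w / \<phi>2 w - f w) - (- g w / \<phi>1 w - f w) = g w / (\<phi>1 w * \<phi>2 w) * ?D w"
      using p by (simp add: field_simps)
    ultimately show ?thesis by simp
  qed
  have A: "?D w > 0" if w: "l1 \<le> w" "w < r1" "w < r2" for w
  proof (rule ccontr)
    assume "\<not> ?D w > 0"
    define S where "S = {l1..w} \<inter> ?D -` {..0}"
    have "w \<in> S" using \<open>\<not> ?D w > 0\<close> w by (auto simp: S_def)
    have "closed S" unfolding S_def
      by (rule continuous_closed_preimage[OF cD]) (use w in auto)
    moreover have bS: "bdd_below S" by (auto simp: S_def bdd_below_def)
    ultimately have "Inf S \<in> S" using \<open>w \<in> S\<close> by (intro closed_contains_Inf) auto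
    define x where "x = Inf S"
    have x: "l1 \<le> x" "x \<le> w" "?D x \<le> 0" using \<open>Inf S \<in> S\<close> by (auto simp: S_def x_def)
    have below: "?D y > 0" if "l1 \<le> y" "y < x" for y
    proof (rule ccontr)
      assume "\<not> ?D y > 0"
      then have "y \<in> S" using that x by (auto simp: S_def)
      then have "x \<le> y" unfolding x_def by (rule cInf_lower[OF _ bS])
      then show False using that by simp
    qed
    have "?D l1 > 0" using d1(6) d2(8)[of l1] d2(2) d1(1) l by auto
    then have "l1 < x" using x by (cases "x = l1") auto
    \<comment> \<open>The comparison starts strictly to the right of \<open>l1\<close>, because
      \<open>\<phi>1 l1 = 0\<close> makes the coefficient \<open>g / (\<phi>1 * \<phi>2)\<close>
      singular there.\<close>
    define m where "m = (l1 + x) / 2"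
    have m: "l1 < m" "m < x" using \<open>l1 < x\<close> by (auto simp: m_def field_simps)
    have "?D x > 0"
    proof (rule linear_growth_pos[where D = ?D and m = m and k = "\<lambda>w. g w / (\<phi>1 w * \<phi>2 w)"])
      show "continuous_on {m..x} (\<lambda>w. g w / (\<phi>1 w * \<phi>2 w))"
      proof (intro continuous_intros continuous_on_subset[OF cg] continuous_on_subset[OF d1(5)] continuous_on_subset[OF d2(5)] ballI)
        fix y assume "y \<in> {m..x}"
        then have "\<phi>1 y > 0" "\<phi>2 y > 0" using d1(8)[of y] d2(8)[of y] m x w l by auto
        then show "\<phi>1 y * \<phi>2 y \<noteq> 0" by simp
      qed (use m x w l in auto)
      show "continuous_on {m..x} ?D" using m x w by (intro cD) auto
      fix y assume "m < y" "y < x"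
      then show "\<exists>D'. (?D has_real_derivative D') (at y) \<and> g y / (\<phi>1 y * \<phi>2 y) * ?D y \<le> D' \<and> 0 \<le> ?D y"
        using dD[of y] below[of y] m x w by (intro exI[of _ "g y / (\<phi>1 y * \<phi>2 y) * ?D y"]) auto
    qed (use m below in auto)
    then show False using x by simp
  qed
  show r: "r1 < r2"
  proof (rule ccontr)
    assume n: "\<not> r1 < r2"
    \<comment> \<open>For \<open>w > 0\<close> the coefficient is positive, so the gap grows up to
      \<open>r2\<close>. But \<open>\<phi>2\<close> vanishes at \<open>r2\<close> while
      \<open>\<phi>1 \<ge> 0\<close>, so the gap cannot be positive there.\<close>
    have "?D (r2 / 2) \<le> ?D r2"
    proof (rule DERIV_nonneg_imp_increasing_open[where f = ?D])
      fix w assume w: "r2 / 2 < w" "w < r2"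
      then have "?D w > 0" "g w > 0" "\<phi>1 w > 0" "\<phi>2 w > 0"
        using A[of w] d2(4)[of w] d1(8)[of w] d2(8)[of w] n d1(1) d2(1,2) by auto
      then show "\<exists>y. (?D has_real_derivative y) (at w) \<and> 0 \<le> y"
        using w n d1(1) d2(2) dD[of w] by (intro exI[of _ "g w / (\<phi>1 w * \<phi>2 w) * ?D w"]) auto
    qed (use n d1(1) d2(2) in \<open>auto intro!: cD\<close>)
    moreover have "?D (r2 / 2) > 0" using n d1(1) d2(2) by (intro A) auto
    moreover have "\<phi>1 r2 \<ge> 0" using n d1(1) d2(2) by (intro d1(10)) auto
    ultimately show False using d2(7) by simp
  qed
  fix w assume w: "l1 \<le> w" "w \<le> r1"
  show "\<phi>1 w < \<phi>2 w"
  proof (cases "w = r1")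
    case True
    then show ?thesis using d1(7) d2(8)[of r1] r w l d1(1,2) by auto
  next
    case False
    then show ?thesis using A[of w] w r by auto
  qed
qed

text \<open>While \<open>v > 0\<close>, \<open>w\<close> is strictly increasing, so time can be
  eliminated: \<phi> is \<open>v\<close> composed with the inverse of \<open>w\<close>, and its
  slope is the quotient of the two time derivatives. One-sided derivatives at the ends suffice, so
  arcs of solutions that begin at time 0 are covered.\<close>

lemma half_arc_of_trajectory:
  assumes s: "s1 < s2"
    and dw: "\<And>t. s1 \<le> t \<Longrightarrow> t \<le> s2 \<Longrightarrow> (w has_real_derivative v t) (at t within {s1..s2})"
    and dv: "\<And>t. s1 \<le> t \<Longrightarrow> t \<le> s2 \<Longrightarrow> (v has_real_derivative - g (w t) - f (w t) * v t) (at t within {s1..s2})"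
    and v0: "v s1 = 0" "v s2 = 0" and vpos: "\<And>t. s1 < t \<Longrightarrow> t < s2 \<Longrightarrow> v t > 0"
    and ws: "w s1 < 0" "0 < w s2"
    and gneg: "\<And>x. w s1 \<le> x \<Longrightarrow> x < 0 \<Longrightarrow> g x < 0" and gpos: "\<And>x. 0 < x \<Longrightarrow> x \<le> w s2 \<Longrightarrow> g x > 0"
  obtains \<phi> where "half_arc f g (w s1) (w s2) \<phi>" "\<And>t. s1 \<le> t \<Longrightarrow> t \<le> s2 \<Longrightarrow> \<phi> (w t) = v t"
    "\<And>x. w s1 \<le> x \<Longrightarrow> x \<le> w s2 \<Longrightarrow> \<exists>t\<in>{s1..s2}. w t = x"
proof -
  have cw: "continuous_on {s1..s2} w" and cv: "continuous_on {s1..s2} v"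
    using dw dv by (auto intro!: DERIV_continuous_on)
  have dw': "(w has_real_derivative v t) (at t)"
    and dv': "(v has_real_derivative - g (w t) - f (w t) * v t) (at t)" if "s1 < t" "t < s2" for t
    using dw[of t] dv[of t] at_within_Icc_at[of s1 t s2] that by auto
  have mono: "w t < w t'" if "s1 \<le> t" "t < t'" "t' \<le> s2" for t t'
  proof (rule DERIV_pos_imp_increasing_open[OF that(2)])
    fix x assume "t < x" "x < t'"
    then show "\<exists>y. (w has_real_derivative y) (at x) \<and> 0 < y"
      using dw'[of x] vpos[of x] that by (intro exI[of _ "v x"]) auto
  qed (rule continuous_on_subset[OF cw], use that in auto)
  then have inj: "inj_on w {s1..s2}" 
    unfolding inj_on_def by (metis atLeastAtMost_iff linorder_neqE_linordered_idom order_less_irrefl)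
  have im: "w ` {s1..s2} = {w s1..w s2}"
  proof (rule antisym)
    show "w ` {s1..s2} \<subseteq> {w s1..w s2}"
    proof safe
      fix t assume t: "t \<in> {s1..s2}"
      have "w s1 \<le> w t" using mono[of s1 t] t by (cases "t = s1") auto
      moreover have "w t \<le> w s2" using mono[of t s2] t by (cases "t = s2") auto
      ultimately show "w t \<in> {w s1..w s2}" by simp
    qed
    show "{w s1..w s2} \<subseteq> w ` {s1..s2}"
    proof
      fix y assume "y \<in> {w s1..w s2}"
      then obtain x where "s1 \<le> x" "x \<le> s2" "w x = y" using IVT'[of w s1 y s2] s cw by auto
      then show "y \<in> w ` {s1..s2}" by auto
    qed
  qed
  define \<tau> where "\<tau> = the_inv_into {s1..s2} w"
  have \<tau>w: "\<tau> (w t) = t" if "s1 \<le> t" "t \<le> s2" for t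
    using the_inv_into_f_f[OF inj, of t] that by (simp add: \<tau>_def)
  have w\<tau>: "w (\<tau> x) = x" and \<tau>mem: "s1 \<le> \<tau> x" "\<tau> x \<le> s2" if "w s1 \<le> x" "x \<le> w s2" for x
  proof -
    have "x \<in> w ` {s1..s2}" using that im by simp
    then obtain t where t: "s1 \<le> t" "t \<le> s2" "x = w t" by auto
    then show "w (\<tau> x) = x" "s1 \<le> \<tau> x" "\<tau> x \<le> s2" using \<tau>w[of t] by auto
  qed
  have c\<tau>: "continuous_on {w s1..w s2} \<tau>"
    using continuous_on_inv[OF cw, of \<tau>] im \<tau>w by auto
  define \<phi> where "\<phi> = (\<lambda>x. v (\<tau> x))"
  show ?thesis
  proof
    show "\<phi> (w t) = v t" if "s1 \<le> t" "t \<le> s2" for t using \<tau>w[OF that] by (simp add: \<phi>_def)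
    show "\<exists>t\<in>{s1..s2}. w t = x" if "w s1 \<le> x" "x \<le> w s2" for x
      using w\<tau>[OF that] \<tau>mem[OF that] by auto
    show "half_arc f g (w s1) (w s2) \<phi>"
      unfolding half_arc_def
    proof (intro conjI ballI)
      show "continuous_on {w s1..w s2} \<phi>" unfolding \<phi>_def
        by (rule continuous_on_compose2[OF cv c\<tau>]) (use \<tau>mem in auto)
      show "\<phi> (w s1) = 0" "\<phi> (w s2) = 0" using \<tau>w[of s1] \<tau>w[of s2] s v0 by (auto simp: \<phi>_def)
      fix x assume x: "x \<in> {w s1<..<w s2}"
      let ?t = "\<tau> x"
      have wt: "w ?t = x" using w\<tau>[of x] x by auto
      have t: "s1 < ?t" "?t < s2"
        using \<tau>mem[of x] wt x by (auto simp: order_le_less)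
      show p: "\<phi> x > 0" using vpos[OF t] by (simp add: \<phi>_def)
      have "(\<tau> has_real_derivative inverse (v ?t)) (at x)"
      proof (rule DERIV_inverse_function)
        show "DERIV w (\<tau> x) :> v ?t" by (rule dw'[OF t])
        show "v ?t \<noteq> 0" using vpos[OF t] by simp
        show "w s1 < x" "x < w s2" using x by auto
        show "isCont \<tau> x" using c\<tau> x by (auto intro!: continuous_on_interior)
      qed (use w\<tau> in auto)
      then have "(\<phi> has_real_derivative (- g (w ?t) - f (w ?t) * v ?t) * inverse (v ?t)) (at x)"
        unfolding \<phi>_def by (rule DERIV_chain2[where f = v and g = \<tau>, OF dv'[OF t]])
      moreover have "(- g (w ?t) - f (w ?t) * v ?t) * inverse (v ?t) = - g x / \<phi> x - f x"
        using p wt by (simp add: \<phi>_def field_simps)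
      ultimately show "(\<phi> has_real_derivative - g x / \<phi> x - f x) (at x)" by simp
    qed (use ws gneg gpos in auto)
  qed
qed

section \<open>Returning below an inward barrier\<close>

lemma linear_lower_bound:
  fixes y :: "real \<Rightarrow> real"
  assumes "\<And>t. t0 \<le> t \<Longrightarrow> \<exists>y'. (y has_real_derivative y') (at t) \<and> y' \<ge> k" "t0 \<le> t"
  shows "y t \<ge> y t0 + k * (t - t0)"
proof -
  have "(\<lambda>t. y t - k * t) t0 \<le> (\<lambda>t. y t - k * t) t"
  proof (rule DERIV_nonneg_imp_nondecreasing[OF assms(2)])
    fix x assume "t0 \<le> x" "x \<le> t"
    then obtain y' where "(y has_real_derivative y') (at x)" "y' \<ge> k" using assms(1) by blast
    then show "\<exists>D. ((\<lambda>t. y t - k * t) has_real_derivative D) (at x) \<and> 0 \<le> D"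
      by (intro exI[of _ "y' - k"]) (auto intro!: derivative_eq_intros)
  qed
  then show ?thesis by (simp add: algebra_simps)
qed

lemma continuous_le_on_Ioo:
  fixes y :: "real \<Rightarrow> real"
  assumes "continuous_on {s..t} y" "\<And>x. x \<in> {s<..<t} \<Longrightarrow> y x \<le> k" "s < t" "x \<in> {s..t}"
  shows "y x \<le> k"
  using continuous_ge_on_Ioo[of s t "\<lambda>x. - y x" "- k" x] assms by (auto intro: continuous_on_minus)

text \<open>The barrier joins two points of the axis, one of which may be the saddle; therefore the
  signs of \<open>g\<close> are prescribed on open intervals only. \<open>d\<close> is the width of
  a strip left of the focus with negative damping: in it \<open>v\<close> increases, so an orbit in
  the upper half-plane is driven past \<open>w = 0\<close> and is not absorbed there.\<close>

locale barrier_in =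
  fixes f g F \<Lambda> :: "real \<Rightarrow> real" and L R d M :: real
  assumes LR: "L < 0" "0 < R" and d: "0 < d"
    and box: "- M < L" "R < M" "\<And>w. L \<le> w \<Longrightarrow> w \<le> R \<Longrightarrow> \<Lambda> w < M"
    and dF: "\<And>w. (F has_real_derivative f w) (at w)" and cg: "continuous_on UNIV g"
    and gneg: "\<And>w. L < w \<Longrightarrow> w < 0 \<Longrightarrow> g w < 0" and gpos: "\<And>w. 0 < w \<Longrightarrow> w < R \<Longrightarrow> g w > 0" and g0: "g 0 = 0"
    and fneg: "\<And>w. - d < w \<Longrightarrow> w \<le> 0 \<Longrightarrow> f w < 0"
    and c\<Lambda>: "continuous_on {L..R} \<Lambda>" and \<Lambda>L: "\<Lambda> L = 0" and \<Lambda>R: "\<Lambda> R = 0"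
    and \<Lambda>pos: "\<And>w. L < w \<Longrightarrow> w < R \<Longrightarrow> \<Lambda> w > 0"
    and d\<Lambda>: "\<And>w. L < w \<Longrightarrow> w < R \<Longrightarrow> \<exists>\<Lambda>'. (\<Lambda> has_real_derivative \<Lambda>') (at w) \<and> \<Lambda> w * \<Lambda>' + g w + f w * \<Lambda> w > 0"
begin

text \<open>The orbit cannot run into the corner \<open>w = R\<close> because the gap \<open>\<delta> = \<Lambda> w - v\<close> to the barrier satisfies
  \<open>\<delta>' > g * \<delta> / \<Lambda>\<close> and so grows for \<open>w > 0\<close>. It cannot stay in \<open>v > 0\<close> forever because
  \<open>(v + F w)' = -g w\<close>. The equations are only required in a box: they will be those of a truncated field.\<close>

lemma half_return:
  fixes w v :: "real \<Rightarrow> real"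
  assumes cw: "continuous_on {0..} w" and cv: "continuous_on {0..} v"
    and wpos: "\<And>t. t > 0 \<Longrightarrow> v t > 0 \<Longrightarrow> \<exists>w'. (w has_real_derivative w') (at t) \<and> w' > 0"
    and dw: "\<And>t. t > 0 \<Longrightarrow> \<bar>w t\<bar> \<le> M \<Longrightarrow> \<bar>v t\<bar> \<le> M \<Longrightarrow> (w has_real_derivative v t) (at t)"
    and dv: "\<And>t. t > 0 \<Longrightarrow> \<bar>w t\<bar> \<le> M \<Longrightarrow> \<bar>v t\<bar> \<le> M \<Longrightarrow> (v has_real_derivative - g (w t) - f (w t) * v t) (at t)"
    and dv0: "(v has_real_derivative - g (w 0)) (at 0 within {0..})"
    and w0: "L \<le> w 0" "w 0 < 0" "g (w 0) < 0" and v0: "v 0 = 0"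
  obtains T where "T > 0" "v T = 0" "0 < w T" "w T < R" 
    "\<forall>t. 0 < t \<and> t < T \<longrightarrow> v t > 0" "\<forall>t. 0 \<le> t \<and> t \<le> T \<longrightarrow> w 0 \<le> w t \<and> w t \<le> w T \<and> v t \<le> \<Lambda> (w t)"
proof -
  define P where "P \<tau> \<longleftrightarrow> \<tau> > 0 \<and> (\<forall>t. 0 < t \<and> t < \<tau> \<longrightarrow> v t > 0)" for \<tau>
  have "\<exists>\<tau>>0. \<forall>t. 0 < t \<and> t < \<tau> \<longrightarrow> v t > 0"
    using has_real_derivative_pos_inc_right[OF dv0] w0(3) v0 by auto
  then obtain \<tau>0 where \<tau>0: "P \<tau>0" unfolding P_def by blast
  have mono: "w s < w t" if "P \<tau>" "0 \<le> s" "s < t" "t \<le> \<tau>" for \<tau> s t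
    by (rule DERIV_pos_imp_increasing_open[OF that(3)])
       (use that wpos in \<open>auto simp: P_def intro: continuous_on_subset[OF cw]\<close>)
  have w_lt: "w 0 < w t" if "P \<tau>" "0 < t" "t \<le> \<tau>" for \<tau> t using mono[OF that(1), of 0 t] that by auto
  let ?\<delta> = "\<lambda>t. \<Lambda> (w t) - v t"
  have d\<delta>: "\<exists>D. (?\<delta> has_real_derivative D) (at t) \<and> D > g (w t) * ?\<delta> t / \<Lambda> (w t)"
    if H: "t > 0" "L < w t" "w t < R" "0 < v t" "\<bar>v t\<bar> \<le> M" "\<bar>w t\<bar> \<le> M" for t
  proof -
    obtain \<Lambda>' where \<Lambda>': "(\<Lambda> has_real_derivative \<Lambda>') (at (w t))" "\<Lambda> (w t) * \<Lambda>' + g (w t) + f (w t) * \<Lambda> (w t) > 0"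
      using d\<Lambda>[OF H(2,3)] by blast
    have p: "\<Lambda> (w t) > 0" using \<Lambda>pos that by simp
    let ?D = "\<Lambda>' * v t - (- g (w t) - f (w t) * v t)"
    have "(?\<delta> has_real_derivative ?D) (at t)"
      using that by (intro derivative_intros DERIV_chain2[where f = \<Lambda> and g = w, OF \<Lambda>'(1)] dw dv) auto
    moreover have "?D - g (w t) * ?\<delta> t / \<Lambda> (w t) = (v t / \<Lambda> (w t)) * (\<Lambda> (w t) * \<Lambda>' + g (w t) + f (w t) * \<Lambda> (w t))"
      using p by (simp add: field_simps)
    moreover have "(v t / \<Lambda> (w t)) * (\<Lambda> (w t) * \<Lambda>' + g (w t) + f (w t) * \<Lambda> (w t)) > 0"
      using p that \<Lambda>'(2) by simp
    ultimately show ?thesis by (intro exI[of _ ?D]) auto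
  qed
  have below1: "?\<delta> t \<ge> 0" if P: "P \<tau>" and t: "0 \<le> t" "t < \<tau>" and wR: "w t < R" for \<tau> t
  proof (rule ccontr)
    assume neg: "\<not> ?\<delta> t \<ge> 0"
    have wle: "w s \<le> w t" if "0 \<le> s" "s \<le> t" for s using mono[OF P, of s t] that t by (cases "s = t") auto
    have wge: "L \<le> w s" if "0 \<le> s" "s \<le> t" for s using w_lt[OF P, of s] that t w0 by (cases "s = 0") auto
    have wle': "L \<le> w s \<and> w s \<le> R" if "0 \<le> s" "s \<le> t" for s using wle[of s] wge[of s] wR that by auto
    have c\<delta>: "continuous_on {0..t} ?\<delta>"
      by (intro continuous_intros continuous_on_compose2[OF c\<Lambda>] continuous_on_subset[OF cw] continuous_on_subset[OF cv])
         (use wle' in auto)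
    define S where "S = {0..t} \<inter> ?\<delta> -` {0..}"
    have "closed S" unfolding S_def by (rule continuous_closed_preimage[OF c\<delta>]) auto
    moreover have "0 \<in> S" using t v0 \<Lambda>L \<Lambda>pos[of "w 0"] w0 LR by (auto simp: S_def order_le_less)
    moreover have bS: "bdd_above S" by (auto simp: S_def bdd_above_def)
    ultimately have "Sup S \<in> S" by (intro closed_contains_Sup) auto
    define s where "s = Sup S"
    have s: "0 \<le> s" "s \<le> t" "?\<delta> s \<ge> 0" using \<open>Sup S \<in> S\<close> by (auto simp: S_def s_def)
    then have "s < t" using neg by (cases "s = t") auto
    have above: "?\<delta> x < 0" if "s < x" "x \<le> t" for x
    proof (rule ccontr)
      assume "\<not> ?\<delta> x < 0"
      then have "x \<in> S" using that s by (auto simp: S_def)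
      then have "x \<le> s" unfolding s_def by (rule cSup_upper[OF _ bS])
      then show False using that by simp
    qed
    have "?\<delta> s = 0"
    proof (rule ccontr)
      assume "?\<delta> s \<noteq> 0"
      then have "?\<delta> s > 0" using s by simp
      then obtain x where "s \<le> x" "x \<le> t" "?\<delta> x = 0" 
        using IVT2'[of ?\<delta> t 0 s] above[of t] \<open>s < t\<close> continuous_on_subset[OF c\<delta>, of "{s..t}"] s by force
      then show False using above[of x] \<open>?\<delta> s \<noteq> 0\<close> by (cases "x = s") auto
    qed
    have wM: "\<bar>w s\<bar> < M" using wle[of s] wge[of s] s wR box by auto
    show False
    proof (cases "s = 0")
      case False
      then have s0: "s > 0" using s by simp
      have ws: "L < w s" "w s < R" using w_lt[OF P, of s] s s0 t w0 wle[of s] wR by auto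
      have vs: "v s = \<Lambda> (w s)" "v s > 0" using \<open>?\<delta> s = 0\<close> \<Lambda>pos[OF ws] by auto
      obtain D where D: "(?\<delta> has_real_derivative D) (at s)" "D > g (w s) * ?\<delta> s / \<Lambda> (w s)"
        using d\<delta>[of s] s0 ws vs wM box(3)[of "w s"] by auto
      then have "D > 0" using \<open>?\<delta> s = 0\<close> by simp
      from has_real_derivative_pos_inc_right[OF D(1) this] obtain e where e: "e > 0" "\<And>h. 0 < h \<Longrightarrow> h < e \<Longrightarrow> ?\<delta> s < ?\<delta> (s + h)"
        by auto
      define h where "h = min (e / 2) (t - s)"
      have "0 < h" "h < e" "s + h \<le> t" using e \<open>s < t\<close> by (auto simp: h_def min_def)
      then show False using e(2)[of h] above[of "s + h"] \<open>?\<delta> s = 0\<close> by auto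
    next
      case True
      \<comment> \<open>This is the start in the corner \<open>w 0 = L\<close>, where \<Lambda> need
        not have a slope and no transversal crossing is available. Shortly after time 0 still
        \<open>w < 0\<close>; where the gap is negative, \<open>g\<close> times the gap is positive
        and so the gap increases, contradicting its drop below the initial value 0.\<close>
      have "((\<lambda>x. w x) \<longlongrightarrow> w 0) (at 0 within {0..})" "((\<lambda>x. v x) \<longlongrightarrow> v 0) (at 0 within {0..})"
        using cw cv by (auto simp: continuous_on_def)
      then have "\<forall>\<^sub>F x in at 0 within {0..}. w x < 0" "\<forall>\<^sub>F x in at 0 within {0..}. v x < M"
        using w0 v0 box LR by (auto intro: order_tendstoD)
      then have "\<forall>\<^sub>F x in at 0 within {0..}. w x < 0 \<and> v x < M" by (rule eventually_conj)
      then obtain e where e: "e > 0" "\<And>x. x > 0 \<Longrightarrow> x < e \<Longrightarrow> w x < 0 \<and> v x < M"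
        unfolding eventually_at by (auto simp: dist_real_def)
      define h where "h = min (e / 2) t"
      have h: "0 < h" "h < e" "h \<le> t" using e \<open>s < t\<close> True by (auto simp: h_def min_def)
      have "?\<delta> 0 < ?\<delta> h"
      proof (rule DERIV_pos_imp_increasing_open[where f = ?\<delta>, OF h(1)])
        fix x assume x: "0 < x" "x < h"
        have wx: "L < w x" "w x < 0" "v x < M" "v x > 0" using w_lt[OF P, of x] x h t w0 e(2)[of x] P by (auto simp: P_def)
        then obtain D where D: "(?\<delta> has_real_derivative D) (at x)" "D > g (w x) * ?\<delta> x / \<Lambda> (w x)"
          using d\<delta>[of x] x box LR by auto
        have "g (w x) * ?\<delta> x > 0" using gneg[of "w x"] wx above[of x] x h True by (intro mult_neg_neg) auto
        then have "D > 0" using D(2) \<Lambda>pos[of "w x"] wx LR 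
          by (meson divide_pos_pos less_trans)
        with D(1) show "\<exists>y. (?\<delta> has_real_derivative y) (at x) \<and> 0 < y" by blast
      next
        show "continuous_on {0..h} ?\<delta>" by (rule continuous_on_subset[OF c\<delta>]) (use h in auto)
      qed
      then show False using above[of h] h True \<open>?\<delta> s = 0\<close> by auto
    qed
  qed
  have lt_R: "w t < R" if P: "P \<tau>" and t: "0 \<le> t" "t < \<tau>" for \<tau> t
  proof (rule ccontr)
    assume "\<not> w t < R"
    then obtain s where s: "0 \<le> s" "s \<le> t" "w s = R"
      using IVT'[of w 0 R t] t w0 LR continuous_on_subset[OF cw, of "{0..t}"] by auto
    then have s0: "0 < s" using w0 LR by (cases "s = 0") auto
    have ws: "w x < R" "L \<le> w x" if H: "0 \<le> x" "x < s" for x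
    proof -
      show "w x < R" using mono[OF P H] s t by linarith
      show "L \<le> w x" using w_lt[OF P, of x] w0(1) H s t by (cases "x = 0") auto
    qed
    have ws': "L \<le> w x \<and> w x \<le> R" if "0 \<le> x" "x \<le> s" for x
      using ws[of x] that s LR by (cases "x = s") auto
    have c\<delta>: "continuous_on {0..s} ?\<delta>"
      by (intro continuous_intros continuous_on_compose2[OF c\<Lambda>] continuous_on_subset[OF cw] continuous_on_subset[OF cv])
        (use ws' in auto)
    have "?\<delta> s \<ge> 0"
    proof (rule continuous_ge_on_Ioo[OF c\<delta> _ s0])
      fix x assume "x \<in> {0<..<s}"
      then show "0 \<le> ?\<delta> x" using below1[OF P, of x] ws(1)[of x] s t by simp
    qed (use s0 in simp)
    moreover have "v s > 0" using P s0 s t by (auto simp: P_def)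
    ultimately show False using s \<Lambda>R by auto
  qed
  have all: "L < w t" "w 0 < w t" "w t < R" "0 < v t" "?\<delta> t \<ge> 0" "\<bar>w t\<bar> \<le> M" "\<bar>v t\<bar> \<le> M" if P: "P \<tau>" and t: "0 < t" "t < \<tau>" for \<tau> t
  proof -
    show 1: "L < w t" "w 0 < w t" "w t < R" "0 < v t" "?\<delta> t \<ge> 0" 
      using w_lt[OF P, of t] lt_R[OF P, of t] below1[OF P, of t] t w0 P by (auto simp: P_def)
    then show "\<bar>w t\<bar> \<le> M" "\<bar>v t\<bar> \<le> M" using box(1,2) box(3)[of "w t"] by auto
  qed
  have c\<delta>: "continuous_on {0..\<tau>} ?\<delta>" if P: "P \<tau>" and "w \<tau> \<le> R" for \<tau>
  proof -
    have "L \<le> w x \<and> w x \<le> R" if "0 \<le> x" "x \<le> \<tau>" for x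
      using all[OF P, of x] w0 LR that \<open>w \<tau> \<le> R\<close> w_lt[OF P, of x] by (cases "x = 0"; cases "x = \<tau>") auto
    then show ?thesis
      by (intro continuous_intros continuous_on_compose2[OF c\<Lambda>] continuous_on_subset[OF cw] continuous_on_subset[OF cv]) auto
  qed
  have d\<delta>pos: "\<exists>D. (?\<delta> has_real_derivative D) (at t) \<and> D > 0" if P: "P \<tau>" and t: "0 < t" "t < \<tau>" and "w t > 0" for \<tau> t
  proof -
    note a = all[OF P t]
    obtain D where D: "(?\<delta> has_real_derivative D) (at t)" "D > g (w t) * ?\<delta> t / \<Lambda> (w t)"
      using d\<delta>[of t] a t by auto
    have "g (w t) * ?\<delta> t / \<Lambda> (w t) \<ge> 0"
      using gpos[of "w t"] a \<open>w t > 0\<close> \<Lambda>pos[of "w t"] by (intro divide_nonneg_pos mult_nonneg_nonneg) auto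
    then show ?thesis using D by (intro exI[of _ D]) auto
  qed
  have dvpos: "\<exists>D. (v has_real_derivative D) (at t) \<and> D > 0" if P: "P \<tau>" and t: "0 < t" "t < \<tau>" and "- d < w t" "w t < 0" for \<tau> t
  proof -
    note a = all[OF P t]
    have "f (w t) * v t < 0" using fneg[of "w t"] that a by (intro mult_neg_pos) auto
    then have "- g (w t) - f (w t) * v t > 0" using gneg[of "w t"] that a by auto
    then show ?thesis using dv[of t] a t by auto
  qed
  obtain K where K: "\<And>x. L \<le> x \<Longrightarrow> x \<le> R \<Longrightarrow> \<bar>F x\<bar> \<le> K"
  proof -
    have "compact (F ` {L..R})" by (intro compact_continuous_image DERIV_continuous_on) (auto intro: has_field_derivative_at_within dF)
    then obtain K where "\<forall>x\<in>F ` {L..R}. norm x \<le> K" using compact_imp_bounded bounded_iff by metis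
    then show ?thesis by (intro that[of K]) auto
  qed
  let ?X = "\<lambda>t. v t + F (w t)"
  have dX: "(?X has_real_derivative - g (w t)) (at t)" if P: "P \<tau>" and t: "0 < t" "t < \<tau>" for \<tau> t
    using dv[of t] dw[of t] all[OF P t] t by (auto intro!: derivative_eq_intros DERIV_chain2[where f = F and g = w, OF dF])
  have X_bound: "\<bar>?X t\<bar> \<le> M + K" if P: "P \<tau>" and t: "0 < t" "t < \<tau>" for \<tau> t
    using K[of "w t"] all[OF P t] by auto
  have ex: "\<exists>t>0. v t \<le> 0"
  proof (rule ccontr)
    assume "\<not> ?thesis"
    then have P: "P \<tau>" if "\<tau> > 0" for \<tau> using that by (auto simp: P_def not_le)
    note a = all[OF P, of "t + 1" t for t]
    show False
    proof (cases "\<exists>t>0. w t > 0")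
      case True
      then obtain t0 where t0: "t0 > 0" "w t0 > 0" by blast
      have wt: "w t \<ge> w t0" if "t \<ge> t0" for t
        using mono[OF P, of "t + 1" t0 t] t0 that by (cases "t = t0") auto
      have c: "continuous_on {x..t} ?\<delta>" if "0 \<le> x" "0 < t" for x t
        by (rule continuous_on_subset[OF c\<delta>[OF P, of t]]) (use a(3)[of t] that in auto)
      have dpos: "\<exists>D. (?\<delta> has_real_derivative D) (at x) \<and> D > 0" if "t0 \<le> x" for x
        using wt[of x] t0 that by (intro d\<delta>pos[OF P, of "x + 1"]) auto
      have inc: "?\<delta> t0 < ?\<delta> t" if "t0 < t" for t
        by (rule DERIV_pos_imp_increasing_open[where f = ?\<delta>, OF that]) (use t0 dpos that in \<open>auto intro: c\<close>)
      define \<delta>0 where "\<delta>0 = ?\<delta> (t0 + 1)"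
      have "\<delta>0 > 0" using inc[of "t0 + 1"] a[of t0] t0 by (auto simp: \<delta>0_def)
      \<comment> \<open>The gap has grown beyond \<open>\<delta>0\<close>, so \<Lambda> is at least
        \<open>\<delta>0\<close> along the orbit from now on. This compact set excludes the corner
        \<open>R\<close>, where \<Lambda> vanishes, and so \<open>g\<close> has a positive minimum
        on it.\<close>
      define C where "C = {w t0..R} \<inter> \<Lambda> -` {\<delta>0..}"
      have wC: "w t \<in> C" if "t \<ge> t0 + 1" for t
      proof -
        have "?\<delta> (t0 + 1) \<le> ?\<delta> t"
          using inc[of "t0 + 1"] dpos that t0
          by (cases "t = t0 + 1") (auto intro!: less_imp_le DERIV_pos_imp_increasing_open[where f = ?\<delta>] c)
        then show ?thesis using wt[of t] a[of t] that t0 by (auto simp: C_def \<delta>0_def)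
      qed
      have "closed C" unfolding C_def
        by (rule continuous_closed_preimage[OF continuous_on_subset[OF c\<Lambda>]]) (use a[of t0] t0 in auto)
      then have "compact C" using compact_Int_closed[of "{w t0..R}" C] by (simp add: C_def Int_assoc[symmetric])
      then obtain x0 where x0: "x0 \<in> C" "\<And>x. x \<in> C \<Longrightarrow> g x0 \<le> g x"
        using continuous_attains_inf[of C g] wC[of "t0 + 1"] continuous_on_subset[OF cg, of C] by auto
      have "x0 \<noteq> R" using x0(1) \<Lambda>R \<open>\<delta>0 > 0\<close> by (auto simp: C_def)
      then have g0: "g x0 > 0" using x0(1) t0 by (intro gpos) (auto simp: C_def)
      \<comment> \<open>By this time a decrease of \<open>v + F w\<close> at rate at least
        \<open>g x0\<close> amounts to \<open>2 * (M + K) + 1\<close>, more than the bound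
        \<open>M + K\<close> on its modulus permits.\<close>
      define t1 where "t1 = t0 + 1 + (2 * (M + K) + 1) / g x0"
      have MK: "M + K \<ge> 0" using X_bound[OF P, of "t0 + 1" t0] t0 by auto
      have t1: "t1 \<ge> t0 + 1" using g0 MK by (auto simp: t1_def)
      have "- ?X t1 \<ge> - ?X (t0 + 1) + g x0 * (t1 - (t0 + 1))"
      proof (rule linear_lower_bound[where y = "\<lambda>t. - ?X t", OF _ t1])
        fix t assume "t0 + 1 \<le> t"
        then show "\<exists>y'. ((\<lambda>t. - ?X t) has_real_derivative y') (at t) \<and> g x0 \<le> y'"
          using dX[OF P, of "t + 1" t] t0 x0(2)[OF wC, of t] by (intro exI[of _ "g (w t)"]) (auto dest: DERIV_minus)
      qed
      moreover have "g x0 * (t1 - (t0 + 1)) = 2 * (M + K) + 1" using g0 by (simp add: t1_def)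
      ultimately show False using X_bound[OF P, of "t1 + 1" t1] X_bound[OF P, of "t0 + 2" "t0 + 1"] t0 t1 by auto
    next
      case False
      have wneg: "w t < 0" if "t > 0" for t
        using mono[OF P, of "t + 2" t "t + 1"] False[simplified, rule_format, of "t + 1"] that by (auto simp: not_less)
      show False
      proof (cases "\<exists>t>0. w t > - d")
        case True
        then obtain t0 where t0: "t0 > 0" "w t0 > - d" by blast
        have wt: "w t \<ge> w t0" if "t \<ge> t0" for t
          using mono[OF P, of "t + 1" t0 t] t0 that by (cases "t = t0") auto
        have vt: "v t \<ge> v t0" if "t \<ge> t0" for t
        proof (rule DERIV_nonneg_imp_nondecreasing[OF that])
          fix x assume "t0 \<le> x"
          then show "\<exists>y. (v has_real_derivative y) (at x) \<and> 0 \<le> y"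
            using dvpos[OF P, of "x + 1" x] t0 wt[of x] wneg[of x] by (auto intro: less_imp_le)
        qed
        define t1 where "t1 = t0 + (- w t0) / v t0"
        have v0: "v t0 > 0" using a[of t0] t0 by simp
        have t1: "t1 \<ge> t0" using wneg[of t0] v0 t0 by (auto simp: t1_def intro: divide_nonpos_pos)
        have "w t1 \<ge> w t0 + v t0 * (t1 - t0)"
        proof (rule linear_lower_bound[OF _ t1])
          fix t assume "t0 \<le> t"
          then show "\<exists>y'. (w has_real_derivative y') (at t) \<and> v t0 \<le> y'"
            using dw[of t] a[of t] t0 vt[of t] by (intro exI[of _ "v t"]) auto
        qed
        also have "w t0 + v t0 * (t1 - t0) = 0" using v0 by (simp add: t1_def)
        finally show False using wneg[of t1] t1 t0 by simp
      next
        case False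
        have nd: "w t \<le> - d" if "t > 0" for t using False that by (meson not_less)
        \<comment> \<open>Here the orbit stays away from the focus, so \<open>g\<close> has a
          negative maximum on its range and \<open>v + F w\<close> would increase without
          bound.\<close>
        define C where "C = {w 1..- d}"
        have wC: "w t \<in> C" if "t \<ge> 1" for t
          using mono[OF P, of "t + 1" 1 t] nd[of t] that by (cases "t = 1") (auto simp: C_def)
        have "compact C" by (simp add: C_def)
        then obtain x0 where x0: "x0 \<in> C" "\<And>x. x \<in> C \<Longrightarrow> g x \<le> g x0"
          using continuous_attains_sup[of C g] wC[of 1] continuous_on_subset[OF cg, of C] by auto
        then have g0: "g x0 < 0" using a[of 1] d by (intro gneg) (auto simp: C_def)
        define t1 where "t1 = 1 + (2 * (M + K) + 1) / (- g x0)"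
        have MK: "M + K \<ge> 0" using X_bound[OF P, of 2 1] by auto
        have t1: "t1 \<ge> 1" using g0 MK by (auto simp: t1_def divide_nonneg_neg divide_nonpos_neg)
        have "?X t1 \<ge> ?X 1 + (- g x0) * (t1 - 1)"
        proof (rule linear_lower_bound[where y = ?X, OF _ t1])
          fix t :: real assume "1 \<le> t"
          then show "\<exists>y'. (?X has_real_derivative y') (at t) \<and> - g x0 \<le> y'"
            using dX[OF P, of "t + 1" t] x0(2)[OF wC, of t] by (intro exI[of _ "- g (w t)"]) auto
        qed
        moreover have "(- g x0) * (t1 - 1) = 2 * (M + K) + 1" using g0 by (simp add: t1_def)
        ultimately show False using X_bound[OF P, of "t1 + 1" t1] X_bound[OF P, of 2 1] t1 by auto
      qed
    qed
  qed
  define N where "N = {\<tau>0..} \<inter> v -` {..0}"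
  have \<tau>0': "\<tau>0 > 0" "\<And>t. 0 < t \<Longrightarrow> t < \<tau>0 \<Longrightarrow> v t > 0" using \<tau>0 by (auto simp: P_def)
  have "closed N" unfolding N_def
    by (rule continuous_closed_preimage[OF continuous_on_subset[OF cv]]) (use \<tau>0' in auto)
  moreover have memN: "t \<in> N" if "t > 0" "v t \<le> 0" for t
    using \<tau>0'(2)[of t] that by (cases "t < \<tau>0") (auto simp: N_def)
  then have "N \<noteq> {}" using ex by blast
  moreover have bN: "bdd_below N" by (auto simp: N_def bdd_below_def)
  ultimately have "Inf N \<in> N" by (intro closed_contains_Inf) auto
  define T where "T = Inf N"
  have T: "T > 0" "v T \<le> 0" using \<open>Inf N \<in> N\<close> \<tau>0' by (auto simp: N_def T_def)
  have vpos: "v t > 0" if "0 < t" "t < T" for t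
  proof (rule ccontr)
    assume n: "\<not> v t > 0"
    then have "t \<in> N" using that by (intro memN) auto
    then have "T \<le> t" unfolding T_def by (rule cInf_lower[OF _ bN])
    then show False using that by simp
  qed
  then have P: "P T" using T by (auto simp: P_def)
  have "v T \<ge> 0"
    by (rule continuous_ge_on_Ioo[of 0 T v]) (use T vpos continuous_on_subset[OF cv] in \<open>auto intro: less_imp_le\<close>)
  then have vT: "v T = 0" using T by simp
  have cwT: "continuous_on {0..T} w" by (rule continuous_on_subset[OF cw]) auto
  have wT_le: "w T \<le> k" if H: "\<And>x. 0 < x \<Longrightarrow> x < T \<Longrightarrow> w x \<le> k" for k
    by (rule continuous_le_on_Ioo[OF cwT]) (use H T in auto)
  have wTR: "w T \<le> R"
    by (rule wT_le, rule less_imp_le, rule lt_R[OF P]) auto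
  have \<delta>T: "?\<delta> T \<ge> 0"
    by (rule continuous_ge_on_Ioo[OF c\<delta>[OF P wTR]]) (use T all[OF P] in auto)
  have wT0: "w 0 < w T" using w_lt[OF P, of T] T by simp
  have "w T > 0"
  proof (rule ccontr)
    assume n: "\<not> w T > 0"
    have wn: "w t < 0" if "0 < t" "t < T" for t using mono[OF P, of t T] that n by auto
    show False
    proof (cases "w T = 0")
      case False
      then have "- g (w T) > 0" using n wT0 w0 gneg[of "w T"] by auto
      moreover have "(v has_real_derivative - g (w T)) (at T)"
        using dv[of T] T vT n wT0 w0 box LR by auto
      ultimately obtain e where e: "e > 0" "\<And>h. 0 < h \<Longrightarrow> h < e \<Longrightarrow> v (T - h) < v T"
        using has_real_derivative_pos_inc_left[of v "- g (w T)" T UNIV] by auto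
      define h where "h = min (e / 2) (T / 2)"
      have "0 < h" "h < e" "h < T" using e T by (auto simp: h_def min_def)
      then show False using e(2)[of h] vpos[of "T - h"] vT by auto
    next
      case True
      \<comment> \<open>Arrival at the equilibrium is excluded by the negative damping: once
        \<open>w\<close> exceeds \<open>- d\<close>, \<open>v\<close> no longer decreases and cannot
        sink to 0.\<close>
      have "\<exists>t1. 0 < t1 \<and> t1 < T \<and> - d < w t1"
      proof (rule ccontr)
        assume "\<not> ?thesis"
        then have "w T \<le> - d"
          by (intro wT_le) (meson not_less)
        then show False using True d by simp
      qed
      then obtain t1 where t1: "0 < t1" "t1 < T" "- d < w t1" by blast
      have "v t1 \<le> v T"
      proof (rule DERIV_nonneg_imp_increasing_open[where f = v])
        fix x assume x: "t1 < x" "x < T"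
        then have "- d < w x" using mono[OF P, of t1 x] t1 by auto
        then show "\<exists>y. (v has_real_derivative y) (at x) \<and> 0 \<le> y"
          using dvpos[OF P, of x] wn[of x] x t1 by (auto intro: less_imp_le)
      qed (use t1 continuous_on_subset[OF cv] in auto)
      then show False using vpos[of t1] t1 vT by simp
    qed
  qed
  have "w T < R"
  proof (rule ccontr)
    assume "\<not> w T < R"
    then have wT: "w T = R" using wTR by simp
    have "\<exists>t1. 0 < t1 \<and> t1 < T \<and> 0 < w t1"
    proof (rule ccontr)
      assume "\<not> ?thesis"
      then have "w T \<le> 0"
        by (intro wT_le) (meson not_less)
      then show False using wT LR by simp
    qed
    then obtain t1 where t1: "0 < t1" "t1 < T" "0 < w t1" by blast
    \<comment> \<open>For \<open>w > 0\<close> the gap strictly grows, so it is positive at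
      \<open>T\<close>; in the corner \<open>w T = R\<close> it would be 0, both \<Lambda> and
      \<open>v\<close> being 0 there.\<close>
    have "?\<delta> t1 < ?\<delta> T"
    proof (rule DERIV_pos_imp_increasing_open[where f = ?\<delta>])
      fix x assume x: "t1 < x" "x < T"
      then have "0 < w x" using mono[OF P, of t1 x] t1 by auto
      then show "\<exists>y. (?\<delta> has_real_derivative y) (at x) \<and> 0 < y"
        using d\<delta>pos[OF P, of x] x t1 by auto
    qed (use t1 continuous_on_subset[OF c\<delta>[OF P wTR]] in auto)
    then show False using all(5)[OF P t1(1,2)] wT \<Lambda>R vT by simp
  qed
  show ?thesis
  proof (rule that[of T])
    have "w 0 \<le> w t \<and> w t \<le> w T \<and> v t \<le> \<Lambda> (w t)" if t: "0 \<le> t" "t \<le> T" for t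
    proof -
    have "w 0 \<le> w t" using w_lt[OF P, of t] t by (cases "t = 0") auto
    moreover have "w t \<le> w T" using mono[OF P, of t T] t by (cases "t = T") auto
    moreover have "v t \<le> \<Lambda> (w t)"
      using \<delta>T all(5)[OF P, of t] below1[OF P, of 0] T w0 LR t by (cases "t = 0"; cases "t = T") auto
    ultimately show ?thesis by simp
    qed
    then show "\<forall>t. 0 \<le> t \<and> t \<le> T \<longrightarrow> w 0 \<le> w t \<and> w t \<le> w T \<and> v t \<le> \<Lambda> (w t)" by blast
    show "\<forall>t. 0 < t \<and> t < T \<longrightarrow> v t > 0" using vpos by blast
  qed (use T vT vpos \<open>w T > 0\<close> \<open>w T < R\<close> in auto)
qed

end

section \<open>The Dulac flux\<close>

text \<open>\<open>db\<close> and \<open>da\<close> annihilate the coefficients of v^2 and v in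
  \<Psi>' + f \<Psi> / 2, and \<open>h_eq\<close> records the constant term that remains. Each of
  \<open>a\<close> and \<open>b\<close> is thus fixed up to an integration constant.\<close>

locale dulac =
  fixes f g a b h :: "real \<Rightarrow> real"
  assumes cf: "continuous_on UNIV f" and cg: "continuous_on UNIV g"
    and da: "\<And>w. (a has_real_derivative 2 * g w + f w * b w / 2) (at w)"
    and db: "\<And>w. (b has_real_derivative 3 / 2 * f w) (at w)"
    and h_eq: "\<And>w. h w = f w * a w / 2 - g w * b w"
begin

definition \<Psi> :: "real \<Rightarrow> real \<Rightarrow> real" where
  "\<Psi> w y = y\<^sup>2 + b w * y + a w"

lemma cont_ab: "continuous_on S a" "continuous_on S b"
  by (rule DERIV_continuous_on, rule has_field_derivative_at_within, rule da)
     (rule DERIV_continuous_on, rule has_field_derivative_at_within, rule db)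

lemma cont_ab_comp: "continuous_on S u \<Longrightarrow> continuous_on S (\<lambda>x. a (u x))" "continuous_on S u \<Longrightarrow> continuous_on S (\<lambda>x. b (u x))"
  using continuous_on_compose2[OF cont_ab(1)[of UNIV]] continuous_on_compose2[OF cont_ab(2)[of UNIV]] by auto

lemma cont_fg_comp: "continuous_on S u \<Longrightarrow> continuous_on S (\<lambda>x. f (u x))" "continuous_on S u \<Longrightarrow> continuous_on S (\<lambda>x. g (u x))"
  using continuous_on_compose2[OF cf] continuous_on_compose2[OF cg] by auto

lemma \<Psi>_deriv:
  assumes "(w has_real_derivative w') (at t within S)" "(y has_real_derivative y') (at t within S)"
  shows "((\<lambda>t. \<Psi> (w t) (y t)) has_real_derivative
     (2 * y t + b (w t)) * y' + (3 / 2 * f (w t) * y t + 2 * g (w t) + f (w t) * b (w t) / 2) * w') (at t within S)"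
  unfolding \<Psi>_def
  by (auto intro!: derivative_eq_intros assms DERIV_chain2[where f = a and g = w, OF da] DERIV_chain2[where f = b and g = w, OF db]
      simp: algebra_simps power2_eq_square)

lemma cont_\<Psi>: "continuous_on S u \<Longrightarrow> continuous_on S v \<Longrightarrow> continuous_on S (\<lambda>x. \<Psi> (u x) (v x))"
  unfolding \<Psi>_def by (intro continuous_intros cont_ab_comp)

text \<open>\<open>flux p q w\<close> is the flux of the field \<open>(v, -g w - f w * v) / \<Psi>^2\<close> through the vertical segment from \<open>p w\<close> to
  \<open>q w\<close>; parametrising the segment by \<open>[0, 1]\<close> avoids variable limits of integration.\<close>

definition flux :: "(real \<Rightarrow> real) \<Rightarrow> (real \<Rightarrow> real) \<Rightarrow> real \<Rightarrow> real" where
  "flux p q w = integral {0..1} (\<lambda>s. (p w + s * (q w - p w)) * (q w - p w) / (\<Psi> w (p w + s * (q w - p w)))\<^sup>2)"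

lemma flux_continuous:
  assumes cp: "continuous_on {x..y} p" and cq: "continuous_on {x..y} q"
    and nz: "\<And>w v. x \<le> w \<Longrightarrow> w \<le> y \<Longrightarrow> p w \<le> v \<Longrightarrow> v \<le> q w \<Longrightarrow> \<Psi> w v \<noteq> 0"
    and le: "\<And>w. x \<le> w \<Longrightarrow> w \<le> y \<Longrightarrow> p w \<le> q w"
  shows "continuous_on {x..y} (flux p q)"
proof -
  have "continuous_on (cbox x y \<times> cbox 0 1)
     (\<lambda>z. (p (fst z) + snd z * (q (fst z) - p (fst z))) * (q (fst z) - p (fst z)) / (\<Psi> (fst z) (p (fst z) + snd z * (q (fst z) - p (fst z))))\<^sup>2)"
  proof (intro continuous_intros cont_\<Psi> continuous_on_compose2[OF cp] continuous_on_compose2[OF cq] ballI)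
    fix z :: "real \<times> real" assume z: "z \<in> cbox x y \<times> cbox 0 1"
    let ?w = "fst z" and ?s = "snd z"
    have w: "x \<le> ?w" "?w \<le> y" "0 \<le> ?s" "?s \<le> 1" using z by (auto simp: mem_Times_iff)
    have "?s * (q ?w - p ?w) \<le> 1 * (q ?w - p ?w)" using w le by (intro mult_right_mono) auto
    moreover have "0 \<le> ?s * (q ?w - p ?w)" using w le by auto
    ultimately have "\<Psi> ?w (p ?w + ?s * (q ?w - p ?w)) \<noteq> 0" using w by (intro nz) auto
    then show "(\<Psi> ?w (p ?w + ?s * (q ?w - p ?w)))\<^sup>2 \<noteq> 0" by simp
  qed auto
  then have "continuous_on (cbox x y \<times> cbox 0 1)
     (\<lambda>(w, s). (p w + s * (q w - p w)) * (q w - p w) / (\<Psi> w (p w + s * (q w - p w)))\<^sup>2)"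
    by (simp add: case_prod_beta)
  from integral_continuous_on_param[OF this] show ?thesis unfolding flux_def by simp
qed

text \<open>The flux density of the scaled field across the graph of \<open>p\<close>, counted
  downwards: it is 0 when the graph is an orbit and negative where the flow crosses it
  upwards.\<close>

definition boundary :: "(real \<Rightarrow> real) \<Rightarrow> (real \<Rightarrow> real) \<Rightarrow> real \<Rightarrow> real" where
  "boundary p p' w = (p w * p' w + g w + f w * p w) / (\<Psi> w (p w))\<^sup>2"

text \<open>The divergence theorem on an infinitesimal vertical strip: the last term is the
  divergence \<open>-2 * h / \<Psi>^3\<close> integrated over the segment. In differentiated form
  the planar theorem reduces to Leibniz' rule and one integration over \<open>s\<close>.\<close>

lemma flux_deriv:
  assumes dp: "\<And>w. x < w \<Longrightarrow> w < y \<Longrightarrow> (p has_real_derivative p' w) (at w)"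
    and dq: "\<And>w. x < w \<Longrightarrow> w < y \<Longrightarrow> (q has_real_derivative q' w) (at w)"
    and cp': "continuous_on {x<..<y} p'" and cq': "continuous_on {x<..<y} q'"
    and nz: "\<And>w v. x < w \<Longrightarrow> w < y \<Longrightarrow> p w \<le> v \<Longrightarrow> v \<le> q w \<Longrightarrow> \<Psi> w v \<noteq> 0"
    and le: "\<And>w. x < w \<Longrightarrow> w < y \<Longrightarrow> p w \<le> q w"
    and w: "x < w" "w < y"
  shows "(flux p q has_real_derivative
      boundary q q' w - boundary p p' w - 2 * h w * (q w - p w) * integral {0..1} (\<lambda>s. 1 / (\<Psi> w (p w + s * (q w - p w))) ^ 3)) (at w)"
proof -
  let ?V = "\<lambda>w s. p w + s * (q w - p w)" and ?V' = "\<lambda>w s. p' w + s * (q' w - p' w)" and ?\<Delta> = "\<lambda>w. q w - p w"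
  let ?P = "\<lambda>w s. \<Psi> w (?V w s)"
  let ?Pw = "\<lambda>w s. (2 * ?V w s + b w) * ?V' w s + (3 / 2 * f w * ?V w s + 2 * g w + f w * b w / 2)"
  let ?K' = "\<lambda>w s. ((?V' w s * ?\<Delta> w + ?V w s * (q' w - p' w)) * ?P w s - 2 * (?V w s * ?\<Delta> w) * ?Pw w s) / (?P w s) ^ 3"
  have P0: "?P w s \<noteq> 0" if "x < w" "w < y" "0 \<le> s" "s \<le> 1" for w s
  proof -
    have "s * ?\<Delta> w \<le> 1 * ?\<Delta> w" using that le by (intro mult_right_mono) auto
    moreover have "0 \<le> s * ?\<Delta> w" using that le by auto
    ultimately show ?thesis using that by (intro nz) auto
  qed
  have dV: "((\<lambda>w. ?V w s) has_real_derivative ?V' w s) (at w)" if "x < w" "w < y" for w s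
    using that by (auto intro!: derivative_eq_intros dp dq)
  have dP: "((\<lambda>w. ?P w s) has_real_derivative ?Pw w s) (at w)" if "x < w" "w < y" for w s
    using \<Psi>_deriv[OF DERIV_ident dV[OF that]] by simp
  have dK: "((\<lambda>w. ?V w s * ?\<Delta> w / (?P w s)\<^sup>2) has_real_derivative ?K' w s) (at w)" if H: "x < w" "w < y" "0 \<le> s" "s \<le> 1" for w s
  proof -
    have nz2: "(?P w s)\<^sup>2 \<noteq> 0" using P0[OF H] by simp
    have num: "((\<lambda>w. ?V w s * ?\<Delta> w) has_real_derivative (?V' w s * ?\<Delta> w + ?V w s * (q' w - p' w))) (at w)"
      using H by (auto intro!: derivative_eq_intros dp dq)
    have den: "((\<lambda>w. (?P w s)\<^sup>2) has_real_derivative 2 * ?P w s * ?Pw w s) (at w)"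
      using DERIV_power[OF dP[OF H(1,2)], of s 2] by (simp add: mult_ac)
    have "((\<lambda>w. ?V w s * ?\<Delta> w / (?P w s)\<^sup>2) has_real_derivative
       ((?V' w s * ?\<Delta> w + ?V w s * (q' w - p' w)) * (?P w s)\<^sup>2 - ?V w s * ?\<Delta> w * (2 * ?P w s * ?Pw w s)) / ((?P w s)\<^sup>2 * (?P w s)\<^sup>2)) (at w)"
      by (rule DERIV_divide[OF num den nz2])
    moreover have "(A * Q\<^sup>2 - B * (2 * Q * C)) / (Q\<^sup>2 * Q\<^sup>2) = (A * Q - 2 * B * C) / Q ^ 3" if "Q \<noteq> 0" for A B C Q :: real
      using that by (simp add: power2_eq_square power3_eq_cube field_simps)
    ultimately show ?thesis using P0[OF H] by simp
  qed
  have cpq: "continuous_on {x<..<y} p" "continuous_on {x<..<y} q"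
    by (rule DERIV_continuous_on, rule has_field_derivative_at_within, rule dp; simp)
       (rule DERIV_continuous_on, rule has_field_derivative_at_within, rule dq; simp)
  let ?S = "{x<..<y} \<times> cbox (0::real) 1"
  have cf1: "continuous_on ?S fst" and cs1: "continuous_on ?S snd"
    by (auto intro: continuous_on_fst continuous_on_snd continuous_on_id)
  have c1: "continuous_on ?S (\<lambda>z. p (fst z))" by (rule continuous_on_compose2[OF cpq(1) cf1]) auto
  have c2: "continuous_on ?S (\<lambda>z. q (fst z))" by (rule continuous_on_compose2[OF cpq(2) cf1]) auto
  have c3: "continuous_on ?S (\<lambda>z. p' (fst z))" by (rule continuous_on_compose2[OF cp' cf1]) auto
  have c4: "continuous_on ?S (\<lambda>z. q' (fst z))" by (rule continuous_on_compose2[OF cq' cf1]) auto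
  have cV: "continuous_on ?S (\<lambda>z. ?V (fst z) (snd z))"
    and cV': "continuous_on ?S (\<lambda>z. ?V' (fst z) (snd z))"
    and c\<Delta>: "continuous_on ?S (\<lambda>z. ?\<Delta> (fst z))"
    and c\<Delta>': "continuous_on ?S (\<lambda>z. q' (fst z) - p' (fst z))"
    by (intro continuous_on_add continuous_on_mult continuous_on_diff c1 c2 c3 c4 cs1)+
  have cP: "continuous_on ?S (\<lambda>z. ?P (fst z) (snd z))" by (rule cont_\<Psi>[OF cf1 cV])
  have cPw: "continuous_on ?S (\<lambda>z. ?Pw (fst z) (snd z))"
    by (intro continuous_on_add continuous_on_mult[OF continuous_on_add[OF continuous_on_mult[OF continuous_on_const cV] cont_ab_comp(2)[OF cf1]] cV'])
       (intro continuous_on_divide continuous_on_mult continuous_on_const cV cont_fg_comp[OF cf1] cont_ab_comp[OF cf1]; simp)+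
  have n1: "continuous_on ?S (\<lambda>z. (?V' (fst z) (snd z) * ?\<Delta> (fst z) + ?V (fst z) (snd z) * (q' (fst z) - p' (fst z))) * ?P (fst z) (snd z))"
    by (rule continuous_on_mult[OF _ cP], rule continuous_on_add,
        rule continuous_on_mult[OF cV' c\<Delta>], rule continuous_on_mult[OF cV c\<Delta>'])
  have n2: "continuous_on ?S (\<lambda>z. 2 * (?V (fst z) (snd z) * ?\<Delta> (fst z)) * ?Pw (fst z) (snd z))"
    by (rule continuous_on_mult[OF _ cPw], rule continuous_on_mult[OF continuous_on_const], rule continuous_on_mult[OF cV c\<Delta>])
  have n3: "continuous_on ?S (\<lambda>z. (?P (fst z) (snd z)) ^ 3)"
    by (rule continuous_on_power[OF cP])
  have n4: "\<forall>z\<in>?S. (?P (fst z) (snd z)) ^ 3 \<noteq> 0"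
  proof
    fix z assume "z \<in> ?S"
    then have "?P (fst z) (snd z) \<noteq> 0" by (intro P0) (auto simp: mem_Times_iff)
    then show "(?P (fst z) (snd z)) ^ 3 \<noteq> 0" by (simp only: power_not_zero not_False_eq_True)
  qed
  have "continuous_on ?S (\<lambda>z. ?K' (fst z) (snd z))"
    by (rule continuous_on_divide[OF continuous_on_diff[OF n1 n2] n3 n4])
  then have cK': "continuous_on ?S (\<lambda>(w, s). ?K' w s)"
    unfolding case_prod_beta .
  have cVs: "continuous_on {0..1} (\<lambda>s. ?V w s)" for w by (intro continuous_intros)
  have cPs: "continuous_on {0..1} (\<lambda>s. ?P w s)" for w by (rule cont_\<Psi>[OF continuous_on_const cVs])
  have "((\<lambda>w. integral (cbox 0 1) (\<lambda>s. ?V w s * ?\<Delta> w / (?P w s)\<^sup>2)) has_real_derivative integral (cbox 0 1) (?K' w)) (at w within {x<..<y})"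
  proof (rule leibniz_rule_field_derivative[where U = "{x<..<y}", OF _ _ cK'])
    fix w assume w: "w \<in> {x<..<y}"
    have "\<forall>s\<in>{0..1}. (?P w s)\<^sup>2 \<noteq> 0"
    proof
      fix s :: real assume "s \<in> {0..1}"
      then have "?P w s \<noteq> 0" using w by (intro P0) auto
      then show "(?P w s)\<^sup>2 \<noteq> 0" by (simp only: power_not_zero not_False_eq_True)
    qed
    then have "continuous_on {0..1} (\<lambda>s. ?V w s * ?\<Delta> w / (?P w s)\<^sup>2)"
      by (rule continuous_on_divide[OF continuous_on_mult[OF cVs continuous_on_const] continuous_on_power[OF cPs]])
    then show "(\<lambda>s. ?V w s * ?\<Delta> w / (?P w s)\<^sup>2) integrable_on cbox 0 1"
      unfolding cbox_interval by (rule integrable_continuous_real)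
    fix s :: real assume "s \<in> cbox 0 1"
    then have s: "0 \<le> s" "s \<le> 1" by auto
    show "((\<lambda>w. ?V w s * ?\<Delta> w / (?P w s)\<^sup>2) has_real_derivative ?K' w s) (at w within {x<..<y})"
      by (rule has_field_derivative_at_within, rule dK[OF _ _ s]) (use w in simp_all)
  next
    show "w \<in> {x<..<y}" using w by simp
  qed (rule convex_real_interval)
  then have F: "(flux p q has_real_derivative integral {0..1} (?K' w)) (at w)"
    unfolding flux_def[abs_def] cbox_interval using w by (simp only: at_within_open[of w "{x<..<y}"] open_greaterThanLessThan greaterThanLessThan_iff)
  \<comment> \<open>The boundary density of the intermediate graph with parameter \<open>s\<close>.
    Its \<open>s\<close>-derivative is the integrand from Leibniz' rule plus the divergence term, so
    integration over [0, 1] leaves the densities of the two end graphs.\<close>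
  let ?M = "\<lambda>s. (?V w s * ?V' w s + g w + f w * ?V w s) / (?P w s)\<^sup>2"
  let ?R = "\<lambda>s. 1 / (?P w s) ^ 3"
  let ?M' = "\<lambda>s. ?K' w s + 2 * h w * ?\<Delta> w * ?R s"
  have dM: "(?M has_real_derivative ?M' s) (at s)" if H: "0 \<le> s" "s \<le> 1" for s
  proof -
    have nz2: "(?P w s)\<^sup>2 \<noteq> 0" using P0 w H by simp
    have dVs: "((\<lambda>s. ?V w s) has_real_derivative ?\<Delta> w) (at s)" by (auto intro!: derivative_eq_intros)
    have dPs: "((\<lambda>s. ?P w s) has_real_derivative (2 * ?V w s + b w) * ?\<Delta> w) (at s)"
      using \<Psi>_deriv[OF DERIV_const dVs, of w] by simp
    have num: "((\<lambda>s. ?V w s * ?V' w s + g w + f w * ?V w s) has_real_derivative ?\<Delta> w * ?V' w s + ?V w s * (q' w - p' w) + f w * ?\<Delta> w) (at s)"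
      by (auto intro!: derivative_eq_intros)
    have den: "((\<lambda>s. (?P w s)\<^sup>2) has_real_derivative 2 * ?P w s * ((2 * ?V w s + b w) * ?\<Delta> w)) (at s)"
      using DERIV_power[OF dPs, of 2] by (simp add: mult_ac)
    have "(?M has_real_derivative
       ((?\<Delta> w * ?V' w s + ?V w s * (q' w - p' w) + f w * ?\<Delta> w) * (?P w s)\<^sup>2 -
         (?V w s * ?V' w s + g w + f w * ?V w s) * (2 * ?P w s * ((2 * ?V w s + b w) * ?\<Delta> w))) / ((?P w s)\<^sup>2 * (?P w s)\<^sup>2)) (at s)"
      by (rule DERIV_divide[OF num den nz2])
    moreover have key: "((D * V' + V * D' + fw * D) * Q\<^sup>2 - (V * V' + gw + fw * V) * (2 * Q * ((2 * V + bw) * D))) / (Q\<^sup>2 * Q\<^sup>2)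
       = ((V' * D + V * D') * Q - 2 * (V * D) * ((2 * V + bw) * V' + (3 / 2 * fw * V + 2 * gw + fw * bw / 2))) / Q ^ 3 + 2 * hw * D * (1 / Q ^ 3)"
      if Q: "Q \<noteq> 0" "Q = V\<^sup>2 + bw * V + aw" and hw: "hw = fw * aw / 2 - gw * bw" for D V' V D' fw gw bw aw hw Q :: real
    proof -
      have "(D * V' + V * D' + fw * D) * Q - (V * V' + gw + fw * V) * (2 * ((2 * V + bw) * D))
         = (V' * D + V * D') * Q - 2 * (V * D) * ((2 * V + bw) * V' + (3 / 2 * fw * V + 2 * gw + fw * bw / 2)) + 2 * hw * D"
        unfolding hw Q(2) by (simp add: power2_eq_square algebra_simps)
      then have "((D * V' + V * D' + fw * D) * Q - (V * V' + gw + fw * V) * (2 * ((2 * V + bw) * D))) / Q ^ 3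
         = ((V' * D + V * D') * Q - 2 * (V * D) * ((2 * V + bw) * V' + (3 / 2 * fw * V + 2 * gw + fw * bw / 2)) + 2 * hw * D) / Q ^ 3" by simp
      moreover have key: "((D * V' + V * D' + fw * D) * Q\<^sup>2 - (V * V' + gw + fw * V) * (2 * Q * ((2 * V + bw) * D))) / (Q\<^sup>2 * Q\<^sup>2)
         = ((D * V' + V * D' + fw * D) * Q - (V * V' + gw + fw * V) * (2 * ((2 * V + bw) * D))) / Q ^ 3"
        using Q(1) by (simp add: power2_eq_square power3_eq_cube field_simps)
      ultimately show ?thesis by (simp add: add_divide_distrib)
    qed
    ultimately show ?thesis unfolding key[OF P0[OF w H] \<Psi>_def h_eq] by (simp only:)
  qed
  have cR: "continuous_on {0..1} ?R"
  proof (rule continuous_on_divide[OF continuous_on_const continuous_on_power[OF cPs]], rule ballI)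
    fix s :: real assume "s \<in> {0..1}"
    then have "?P w s \<noteq> 0" using w by (intro P0) auto
    then show "(?P w s) ^ 3 \<noteq> 0" by (simp only: power_not_zero not_False_eq_True)
  qed
  have cK: "continuous_on {0..1} (?K' w)"
  proof -
    have "continuous_on {0..1} (\<lambda>s::real. (w, s))" by (intro continuous_intros)
    moreover have "(\<lambda>s. (w, s)) ` {0..1} \<subseteq> ?S" using w by auto
    ultimately have "continuous_on {0..1} (\<lambda>s. case (w, s) of (w, s) \<Rightarrow> ?K' w s)"
      by (rule continuous_on_compose2[OF cK'])
    then show ?thesis unfolding prod.case .
  qed
  have "(?M' has_integral (?M 1 - ?M 0)) {0..1}"
  proof (rule fundamental_theorem_of_calculus)
    fix s :: real assume "s \<in> {0..1}"
    then have s: "0 \<le> s" "s \<le> 1" by auto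
    show "(?M has_vector_derivative ?M' s) (at s within {0..1})"
      by (rule iffD1[OF has_real_derivative_iff_has_vector_derivative], rule has_field_derivative_at_within, rule dM[OF s])
  qed simp
  then have "?M 1 - ?M 0 = integral {0..1} ?M'" by (rule integral_unique[symmetric])
  also have "\<dots> = integral {0..1} (?K' w) + integral {0..1} (\<lambda>s. 2 * h w * ?\<Delta> w * ?R s)"
    by (rule integral_add[OF integrable_continuous_real[OF cK] integrable_continuous_real[OF continuous_on_mult[OF continuous_on_const cR]]])
  also have "integral {0..1} (\<lambda>s. 2 * h w * ?\<Delta> w * ?R s) = 2 * h w * ?\<Delta> w * integral {0..1} ?R"
    by (rule integral_mult_right)
  finally have "integral {0..1} (?K' w) = ?M 1 - ?M 0 - 2 * h w * ?\<Delta> w * integral {0..1} ?R" by linarith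
  with F show ?thesis by (simp add: boundary_def)
qed

end

text \<open>The weak inequality covers two cases with one notion: a larger orbit, where equality
  holds, and the approximate loop, which the flow crosses outwards. Slopes are required only in the
  open interval, since graphs of orbits become vertical on the axis.\<close>

definition outer_curve :: "(real \<Rightarrow> real) \<Rightarrow> (real \<Rightarrow> real) \<Rightarrow> real \<Rightarrow> real \<Rightarrow> (real \<Rightarrow> real) \<Rightarrow> bool" where
  "outer_curve f g l r q \<longleftrightarrow> continuous_on {l..r} q \<and> q l = 0 \<and> q r = 0 \<and> (\<forall>w\<in>{l<..<r}. q w > 0) \<and>
     (\<exists>q'. continuous_on {l<..<r} q' \<and>
        (\<forall>w\<in>{l<..<r}. (q has_real_derivative q' w) (at w) \<and> q w * q' w + g w + f w * q w \<le> 0))"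

lemma half_arc_outer_curve:
  assumes cf: "continuous_on UNIV f" and cg: "continuous_on UNIV g" and arc: "half_arc f g l r \<phi>"
  shows "outer_curve f g l r \<phi>"
proof -
  note d = half_arcD[OF arc]
  have "continuous_on {l<..<r} (\<lambda>w. - g w / \<phi> w - f w)"
    using d(8) by (intro continuous_intros continuous_on_subset[OF cf] continuous_on_subset[OF cg] continuous_on_subset[OF d(5)]) fastforce+
  moreover have "\<phi> w * (- g w / \<phi> w - f w) + g w + f w * \<phi> w \<le> 0" if "l < w" "w < r" for w
    using d(8)[OF that] by (simp add: field_simps)
  ultimately show ?thesis unfolding outer_curve_def using d(5-9) by auto
qed

lemma integral_inverse_cube_sign:
  fixes P :: "real \<Rightarrow> real"
  assumes c: "continuous_on {0..1} P"
  shows "(\<And>s. 0 \<le> s \<Longrightarrow> s \<le> 1 \<Longrightarrow> P s > 0) \<Longrightarrow> integral {0..1} (\<lambda>s. 1 / P s ^ 3) > 0"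
    and "(\<And>s. 0 \<le> s \<Longrightarrow> s \<le> 1 \<Longrightarrow> P s < 0) \<Longrightarrow> integral {0..1} (\<lambda>s. 1 / P s ^ 3) < 0"
proof -
  have pos: "integral {0..1} (\<lambda>s. 1 / Q s ^ 3) > 0"
    if cQ: "continuous_on {0..1} Q" and Q: "\<And>s. 0 \<le> s \<Longrightarrow> s \<le> 1 \<Longrightarrow> Q s > 0" for Q :: "real \<Rightarrow> real"
  proof -
    have c3: "continuous_on {0..1} (\<lambda>s. 1 / Q s ^ 3)"
      by (intro continuous_intros cQ) (use Q in \<open>force\<close>)
    then obtain s0 where s0: "s0 \<in> {0..1}" "\<And>s. s \<in> {0..1} \<Longrightarrow> 1 / Q s0 ^ 3 \<le> 1 / Q s ^ 3"
      using continuous_attains_inf[of "{0..1::real}" "\<lambda>s. 1 / Q s ^ 3"] by auto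
    have "integral {0..1::real} (\<lambda>s. 1 / Q s0 ^ 3) \<le> integral {0..1} (\<lambda>s. 1 / Q s ^ 3)"
      by (rule integral_le) (use s0 in \<open>auto intro: integrable_continuous_real c3\<close>)
    then have "1 / Q s0 ^ 3 \<le> integral {0..1} (\<lambda>s. 1 / Q s ^ 3)" by simp
    moreover have "1 / Q s0 ^ 3 > 0" using Q s0(1) by simp
    ultimately show ?thesis by linarith
  qed
  show "integral {0..1} (\<lambda>s. 1 / P s ^ 3) > 0" if "\<And>s. 0 \<le> s \<Longrightarrow> s \<le> 1 \<Longrightarrow> P s > 0"
    by (rule pos[OF c that])
  assume n: "\<And>s. 0 \<le> s \<Longrightarrow> s \<le> 1 \<Longrightarrow> P s < 0"
  have "integral {0..1} (\<lambda>s. 1 / (- P s) ^ 3) > 0"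
    by (rule pos) (use n in \<open>auto intro: continuous_on_minus c\<close>)
  moreover have "(\<lambda>s. 1 / (- P s) ^ 3) = (\<lambda>s. - (1 / P s ^ 3))" by (simp add: fun_eq_iff power3_eq_cube)
  ultimately show "integral {0..1} (\<lambda>s. 1 / P s ^ 3) < 0" by simp
qed

section \<open>Monotonicity of the flux and nonexistence of nested orbits\<close>

context dulac
begin

text \<open>Adding a primitive \<open>N\<close> of the lower boundary density cancels that density
  and leaves the upper boundary and the divergence.\<close>

lemma flux_plus_deriv:
  assumes dp: "\<And>w. x < w \<Longrightarrow> w < y \<Longrightarrow> (p has_real_derivative p' w) (at w)"
    and dq: "\<And>w. x < w \<Longrightarrow> w < y \<Longrightarrow> (q has_real_derivative q' w) (at w)"
    and cp': "continuous_on {x<..<y} p'" and cq': "continuous_on {x<..<y} q'"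
    and nz: "\<And>w v. x < w \<Longrightarrow> w < y \<Longrightarrow> p w \<le> v \<Longrightarrow> v \<le> q w \<Longrightarrow> \<Psi> w v \<noteq> 0"
    and lt: "\<And>w. x < w \<Longrightarrow> w < y \<Longrightarrow> p w < q w"
    and w: "x < w" "w < y" and N: "(N has_real_derivative boundary p p' w) (at w)"
  shows "((\<lambda>w. flux p q w + N w) has_real_derivative
      boundary q q' w - 2 * h w * (q w - p w) * integral {0..1} (\<lambda>s. 1 / (\<Psi> w (p w + s * (q w - p w))) ^ 3)) (at w)"
  using DERIV_add[OF flux_deriv[OF dp dq cp' cq' nz less_imp_le[OF lt] w] N] by simp

lemma segment:
  fixes s x y :: real
  assumes "0 \<le> s" "s \<le> 1" "x < y"
  shows "x \<le> x + s * (y - x) \<and> x + s * (y - x) \<le> y"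
proof -
  define k where "k = s * (y - x)"
  have "k \<le> 1 * (y - x)" unfolding k_def by (rule mult_right_mono) (use assms in auto)
  moreover have "0 \<le> k" using assms by (simp add: k_def)
  ultimately show ?thesis unfolding k_def[symmetric] by simp
qed

text \<open>In \<Psi> > 0 the divergence is negative, and an outward crossing of the upper graph
  contributes with the same sign.\<close>

lemma flux_decreasing:
  assumes xy: "x < y" and cp: "continuous_on {x..y} p" and cq: "continuous_on {x..y} q"
    and dp: "\<And>w. x < w \<Longrightarrow> w < y \<Longrightarrow> (p has_real_derivative p' w) (at w)"
    and dq: "\<And>w. x < w \<Longrightarrow> w < y \<Longrightarrow> (q has_real_derivative q' w) (at w)"
    and cp': "continuous_on {x<..<y} p'" and cq': "continuous_on {x<..<y} q'"
    and pos: "\<And>w v. x \<le> w \<Longrightarrow> w \<le> y \<Longrightarrow> p w \<le> v \<Longrightarrow> \<Psi> w v > 0"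
    and le: "\<And>w. x \<le> w \<Longrightarrow> w \<le> y \<Longrightarrow> p w \<le> q w" and lt: "\<And>w. x < w \<Longrightarrow> w < y \<Longrightarrow> p w < q w"
    and h: "\<And>w. x < w \<Longrightarrow> w < y \<Longrightarrow> h w > 0"
    and bq: "\<And>w. x < w \<Longrightarrow> w < y \<Longrightarrow> q w * q' w + g w + f w * q w \<le> 0"
    and cN: "continuous_on {x..y} N" and dN: "\<And>w. x < w \<Longrightarrow> w < y \<Longrightarrow> (N has_real_derivative boundary p p' w) (at w)"
  shows "flux p q y + N y < flux p q x + N x"
proof (rule DERIV_neg_imp_decreasing_open[where f = "\<lambda>w. flux p q w + N w", OF xy])
  show "continuous_on {x..y} (\<lambda>w. flux p q w + N w)"
  proof (rule continuous_on_add[OF flux_continuous[OF cp cq _ le] cN])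
    fix w v assume "x \<le> w" "w \<le> y" "p w \<le> v" "v \<le> q w"
    then show "\<Psi> w v \<noteq> 0" using pos[of w v] by simp
  qed
  fix w assume w: "x < w" "w < y"
  have nz: "\<Psi> u v \<noteq> 0" if "x < u" "u < y" "p u \<le> v" "v \<le> q u" for u v
    using pos[of u v] that by simp
  let ?P = "\<lambda>s. \<Psi> w (p w + s * (q w - p w))"
  let ?I = "integral {0..1} (\<lambda>s. 1 / ?P s ^ 3)"
  have "continuous_on {0..1} ?P" by (intro cont_\<Psi> continuous_intros)
  then have I: "?I > 0"
    by (rule integral_inverse_cube_sign(1)) (use segment[OF _ _ lt[OF w]] pos w in auto)
  have "((\<lambda>w. flux p q w + N w) has_real_derivative boundary q q' w - 2 * h w * (q w - p w) * ?I) (at w)"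
    by (rule flux_plus_deriv[OF dp dq cp' cq' nz lt w dN[OF w]])
  moreover have "boundary q q' w \<le> 0" unfolding boundary_def using bq[OF w] by (simp add: divide_nonpos_nonneg)
  moreover have "2 * h w * (q w - p w) * ?I > 0" using h[OF w] lt[OF w] I by simp
  ultimately show "\<exists>D. ((\<lambda>w. flux p q w + N w) has_real_derivative D) (at w) \<and> D < 0"
    by (intro exI conjI) (assumption, linarith)
qed

text \<open>In \<Psi> < 0 the cube reverses the sign of the divergence; the upper graph is an orbit
  and contributes nothing.\<close>

lemma flux_increasing:
  assumes xy: "x < y" and cp: "continuous_on {x..y} p" and cq: "continuous_on {x..y} q"
    and dp: "\<And>w. x < w \<Longrightarrow> w < y \<Longrightarrow> (p has_real_derivative p' w) (at w)"
    and dq: "\<And>w. x < w \<Longrightarrow> w < y \<Longrightarrow> (q has_real_derivative q' w) (at w)"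
    and cp': "continuous_on {x<..<y} p'" and cq': "continuous_on {x<..<y} q'"
    and neg: "\<And>w v. x \<le> w \<Longrightarrow> w \<le> y \<Longrightarrow> p w \<le> v \<Longrightarrow> v \<le> q w \<Longrightarrow> \<Psi> w v < 0"
    and le: "\<And>w. x \<le> w \<Longrightarrow> w \<le> y \<Longrightarrow> p w \<le> q w" and lt: "\<And>w. x < w \<Longrightarrow> w < y \<Longrightarrow> p w < q w"
    and h: "\<And>w. x < w \<Longrightarrow> w < y \<Longrightarrow> h w > 0"
    and bq: "\<And>w. x < w \<Longrightarrow> w < y \<Longrightarrow> q w * q' w + g w + f w * q w = 0"
    and cN: "continuous_on {x..y} N" and dN: "\<And>w. x < w \<Longrightarrow> w < y \<Longrightarrow> (N has_real_derivative boundary p p' w) (at w)"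
  shows "flux p q x + N x < flux p q y + N y"
proof (rule DERIV_pos_imp_increasing_open[where f = "\<lambda>w. flux p q w + N w", OF xy])
  show "continuous_on {x..y} (\<lambda>w. flux p q w + N w)"
  proof (rule continuous_on_add[OF flux_continuous[OF cp cq _ le] cN])
    fix w v assume "x \<le> w" "w \<le> y" "p w \<le> v" "v \<le> q w"
    then show "\<Psi> w v \<noteq> 0" using neg[of w v] by simp
  qed
  fix w assume w: "x < w" "w < y"
  have nz: "\<Psi> u v \<noteq> 0" if "x < u" "u < y" "p u \<le> v" "v \<le> q u" for u v
    using neg[of u v] that by simp
  let ?P = "\<lambda>s. \<Psi> w (p w + s * (q w - p w))"
  let ?I = "integral {0..1} (\<lambda>s. 1 / ?P s ^ 3)"
  have "continuous_on {0..1} ?P" by (intro cont_\<Psi> continuous_intros)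
  then have I: "?I < 0"
    by (rule integral_inverse_cube_sign(2)) (use segment[OF _ _ lt[OF w]] neg w in auto)
  have "((\<lambda>w. flux p q w + N w) has_real_derivative boundary q q' w - 2 * h w * (q w - p w) * ?I) (at w)"
    by (rule flux_plus_deriv[OF dp dq cp' cq' nz lt w dN[OF w]])
  moreover have "boundary q q' w = 0" unfolding boundary_def using bq[OF w] by simp
  moreover have "2 * h w * (q w - p w) * ?I < 0" using h[OF w] lt[OF w] I by (intro mult_pos_neg) auto
  ultimately show "\<exists>D. ((\<lambda>w. flux p q w + N w) has_real_derivative D) (at w) \<and> 0 < D"
    by (intro exI conjI) (assumption, linarith)
qed

lemma flux_cong: "p w = p2 w \<Longrightarrow> q w = q2 w \<Longrightarrow> flux p q w = flux p2 q2 w"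
  by (simp add: flux_def)

lemma flux_0: "p w = q w \<Longrightarrow> flux p q w = 0"
  by (simp add: flux_def)

lemma boundary_0: "boundary (\<lambda>_. 0) (\<lambda>_. 0) w = g w / (a w)\<^sup>2"
  by (simp add: boundary_def \<Psi>_def)

text \<open>On the outer pieces, where the segments reach down to \<open>v = 0\<close>, the flux through the axis is \<open>g / a^2\<close>. These terms
  reappear with the opposite sign in the reflected system.\<close>

lemma outer_flux_negative:
  assumes arc: "half_arc f g l1 r1 p" and out: "outer_curve f g l2 r2 q" and lr: "l2 < l1" "r1 < r2"
    and pq: "\<And>w. l1 \<le> w \<Longrightarrow> w \<le> r1 \<Longrightarrow> p w < q w"
    and pos1: "\<And>w v. l1 \<le> w \<Longrightarrow> w \<le> r1 \<Longrightarrow> p w \<le> v \<Longrightarrow> \<Psi> w v > 0"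
    and pos2: "\<And>w v. l2 \<le> w \<Longrightarrow> w \<le> l1 \<Longrightarrow> 0 \<le> v \<Longrightarrow> \<Psi> w v > 0"
    and pos3: "\<And>w v. r1 \<le> w \<Longrightarrow> w \<le> r2 \<Longrightarrow> 0 \<le> v \<Longrightarrow> \<Psi> w v > 0"
    and h: "\<And>w. l2 < w \<Longrightarrow> w < r2 \<Longrightarrow> h w > 0"
    and N1: "continuous_on {l2..l1} N1" "\<And>w. l2 < w \<Longrightarrow> w < l1 \<Longrightarrow> (N1 has_real_derivative g w / (a w)\<^sup>2) (at w)"
    and N2: "continuous_on {r1..r2} N2" "\<And>w. r1 < w \<Longrightarrow> w < r2 \<Longrightarrow> (N2 has_real_derivative g w / (a w)\<^sup>2) (at w)"
  shows "N1 l1 - N1 l2 + (N2 r2 - N2 r1) < 0"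
proof -
  note d = half_arcD[OF arc]
  from out obtain q' where q: "continuous_on {l2..r2} q" "q l2 = 0" "q r2 = 0" "\<And>w. l2 < w \<Longrightarrow> w < r2 \<Longrightarrow> q w > 0"
    and q': "continuous_on {l2<..<r2} q'" "\<And>w. l2 < w \<Longrightarrow> w < r2 \<Longrightarrow> (q has_real_derivative q' w) (at w)"
      "\<And>w. l2 < w \<Longrightarrow> w < r2 \<Longrightarrow> q w * q' w + g w + f w * q w \<le> 0"
    unfolding outer_curve_def by auto
  have lr1: "l1 < r1" using d(1,2) by simp
  have q0: "q w \<ge> 0" if "l2 \<le> w" "w \<le> r2" for w
    using q(2,3) q(4)[of w] that by (cases "w = l2"; cases "w = r2") auto
  have sub: "continuous_on {x..y} q" "continuous_on {x<..<y} q'" if "l2 \<le> x" "y \<le> r2" for x y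
    using that by (auto intro: continuous_on_subset[OF q(1)] continuous_on_subset[OF q'(1)])
  have 1: "flux (\<lambda>_. 0) q l1 + N1 l1 < flux (\<lambda>_. 0) q l2 + N1 l2"
    by (rule flux_decreasing[where p = "\<lambda>_. 0" and p' = "\<lambda>_. 0" and q' = q', OF lr(1)])
       (use lr lr1 q q' q0 h pos2 N1 in \<open>auto simp: boundary_0 intro: sub\<close>)
  have 3: "flux (\<lambda>_. 0) q r2 + N2 r2 < flux (\<lambda>_. 0) q r1 + N2 r1"
    by (rule flux_decreasing[where p = "\<lambda>_. 0" and p' = "\<lambda>_. 0" and q' = q', OF lr(2)])
       (use lr lr1 q q' q0 h pos3 N2 in \<open>auto simp: boundary_0 intro: sub\<close>)
  have cp': "continuous_on {l1<..<r1} (\<lambda>w. - g w / p w - f w)"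
    using d(8) by (intro continuous_intros continuous_on_subset[OF cf] continuous_on_subset[OF cg] continuous_on_subset[OF d(5)]) fastforce+
  have b0: "boundary p (\<lambda>w. - g w / p w - f w) w = 0" if "l1 < w" "w < r1" for w
    using d(8)[OF that] by (simp add: boundary_def field_simps)
  have 2: "flux p q r1 + 0 < flux p q l1 + 0"
    by (rule flux_decreasing[where p' = "\<lambda>w. - g w / p w - f w" and q' = q' and N = "\<lambda>_. 0", OF lr1 d(5)])
       (use lr lr1 q q' h pos1 d(9) pq b0 in \<open>auto simp: less_imp_le intro: sub cp'[simplified]\<close>)
  \<comment> \<open>The three pieces telescope: at \<open>l1\<close> and \<open>r1\<close> the inner
    arc meets the axis, and at \<open>l2\<close> and \<open>r2\<close> the segments shrink to
    points.\<close>
  have "flux p q l1 = flux (\<lambda>_. 0) q l1" "flux p q r1 = flux (\<lambda>_. 0) q r1"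
    using d(6,7) by (auto intro: flux_cong)
  moreover have "flux (\<lambda>_. 0) q l2 = 0" "flux (\<lambda>_. 0) q r2 = 0" using q by (auto intro: flux_0)
  ultimately show ?thesis using 1 2 3 by linarith
qed

lemma inner_flux_positive:
  assumes arc: "half_arc f g l r p"
    and neg: "\<And>w v. l \<le> w \<Longrightarrow> w \<le> r \<Longrightarrow> 0 \<le> v \<Longrightarrow> v \<le> p w \<Longrightarrow> \<Psi> w v < 0"
    and h: "\<And>w. l < w \<Longrightarrow> w < r \<Longrightarrow> h w > 0"
    and N: "continuous_on {l..r} N" "\<And>w. l < w \<Longrightarrow> w < r \<Longrightarrow> (N has_real_derivative g w / (a w)\<^sup>2) (at w)"
  shows "N r - N l > 0"
proof -
  note d = half_arcD[OF arc]
  have lr: "l < r" using d(1,2) by simp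
  have cp': "continuous_on {l<..<r} (\<lambda>w. - g w / p w - f w)"
    using d(8) by (intro continuous_intros continuous_on_subset[OF cf] continuous_on_subset[OF cg] continuous_on_subset[OF d(5)]) fastforce+
  have b0: "p w * (- g w / p w - f w) + g w + f w * p w = 0" if "l < w" "w < r" for w
    using d(8)[OF that] by (simp add: field_simps)
  have "flux (\<lambda>_. 0) p l + N l < flux (\<lambda>_. 0) p r + N r"
    by (rule flux_increasing[where p = "\<lambda>_. 0" and p' = "\<lambda>_. 0" and q' = "\<lambda>w. - g w / p w - f w", OF lr])
       (use lr cp' b0 h neg N d in \<open>auto simp: boundary_0\<close>)
  moreover have "flux (\<lambda>_. 0) p l = 0" "flux (\<lambda>_. 0) p r = 0" using d by (auto intro: flux_0)
  ultimately show ?thesis by linarith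
qed

text \<open>\<open>b\<close> changes sign because the product of \<open>b\<close> and
  \<open>v\<close> must be invariant under the reflection. Results for the upper half-plane thereby
  apply to the lower arcs.\<close>

lemma reflect: "dulac (\<lambda>w. f (- w)) (\<lambda>w. - g (- w)) (\<lambda>w. a (- w)) (\<lambda>w. - b (- w)) (\<lambda>w. h (- w))"
proof
  show "continuous_on UNIV (\<lambda>w. f (- w))" "continuous_on UNIV (\<lambda>w. - g (- w))"
    by (intro continuous_intros cont_fg_comp)+
  fix w
  have m: "((\<lambda>w. - w) has_real_derivative - 1) (at w)" by (auto intro!: derivative_eq_intros)
  show "((\<lambda>w. a (- w)) has_real_derivative 2 * (- g (- w)) + f (- w) * (- b (- w)) / 2) (at w)"
    using DERIV_chain2[where f = a and g = uminus, OF da m] by simp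
  show "((\<lambda>w. - b (- w)) has_real_derivative 3 / 2 * f (- w)) (at w)"
    using DERIV_minus[OF DERIV_chain2[where f = b and g = uminus, OF db m]] by simp
  show "h (- w) = f (- w) * a (- w) / 2 - (- g (- w)) * (- b (- w))" by (simp add: h_eq)
qed

lemma primitive:
  assumes "\<And>w. x \<le> w \<Longrightarrow> w \<le> y \<Longrightarrow> a w \<noteq> 0"
  obtains N where "continuous_on {x..y} N" "\<And>w. x < w \<Longrightarrow> w < y \<Longrightarrow> (N has_real_derivative g w / (a w)\<^sup>2) (at w)"
proof -
  let ?k = "\<lambda>w. g w / (a w)\<^sup>2"
  have ck: "continuous_on {x..y} ?k"
    by (intro continuous_on_divide continuous_on_power cont_ab continuous_on_subset[OF cg]) (use assms in auto)
  show ?thesis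
  proof (rule that[of "\<lambda>w. integral {x..w} ?k"])
    show "continuous_on {x..y} (\<lambda>w. integral {x..w} ?k)"
      by (rule indefinite_integral_continuous_1[OF integrable_continuous_real[OF ck]])
    fix w assume w: "x < w" "w < y"
    have "((\<lambda>w. integral {x..w} ?k) has_real_derivative ?k w) (at w within {x..y})"
      by (rule integral_has_real_derivative[OF ck]) (use w in auto)
    then show "((\<lambda>w. integral {x..w} ?k) has_real_derivative ?k w) (at w)"
      using w at_within_Icc_at[of x w y] by simp
  qed
qed

text \<open>The discriminant condition says that the values of \<open>w\<close> over which \<open>\<Psi>\<close> has real roots form an interval around \<open>0\<close>.
  A curve in \<open>\<Psi> > 0\<close> that passes above the roots at \<open>w = 0\<close> then stays above them.\<close>

lemma branch:
  assumes c: "continuous_on {l..r} p" and lr: "l \<le> 0" "0 \<le> r"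
    and pos: "\<And>w. l \<le> w \<Longrightarrow> w \<le> r \<Longrightarrow> \<Psi> w (p w) > 0" and p0: "p 0 > 0" and a0: "a 0 < 0"
    and D: "\<And>w x. l \<le> w \<Longrightarrow> w \<le> r \<Longrightarrow> 4 * a w - (b w)\<^sup>2 \<le> 0 \<Longrightarrow> w \<le> x \<and> x \<le> 0 \<or> 0 \<le> x \<and> x \<le> w \<Longrightarrow> 4 * a x - (b x)\<^sup>2 \<le> 0"
    and w: "l \<le> w" "w \<le> r" "4 * a w - (b w)\<^sup>2 \<le> 0"
  shows "2 * p w + b w > 0"
proof (rule ccontr)
  let ?k = "\<lambda>w. 2 * p w + b w"
  assume n: "\<not> ?k w > 0"
  \<comment> \<open>Consequently \<open>2 * p + b\<close> cannot vanish where the discriminant term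
    is nonpositive, and by \<open>D\<close> this includes every point between \<open>w\<close> and
    0; a change of sign would contradict the intermediate value theorem.\<close>
  have sq: "(?k x)\<^sup>2 = 4 * \<Psi> x (p x) - (4 * a x - (b x)\<^sup>2)" for x
    by (simp add: \<Psi>_def power2_eq_square algebra_simps)
  have "p 0 * (p 0 + b 0) > 0" using pos[of 0] lr a0 by (simp add: \<Psi>_def power2_eq_square algebra_simps)
  then have "p 0 + b 0 > 0" using p0 by (simp add: zero_less_mult_iff)
  then have k0: "?k 0 > 0" using p0 by linarith
  have nz: "?k x \<noteq> 0" if "w \<le> x \<and> x \<le> 0 \<or> 0 \<le> x \<and> x \<le> w" for x
  proof -
    have "4 * a x - (b x)\<^sup>2 \<le> 0" using D[OF w that] .
    moreover have "\<Psi> x (p x) > 0" using pos[of x] that w lr by auto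
    ultimately have "(?k x)\<^sup>2 > 0" unfolding sq by linarith
    then show ?thesis by auto
  qed
  have ck: "continuous_on {x..y} ?k" if "l \<le> x" "y \<le> r" for x y
    by (intro continuous_intros cont_ab continuous_on_subset[OF c]) (use that in auto)
  show False
  proof (cases "w \<le> 0")
    case True
    obtain x where "w \<le> x" "x \<le> 0" "?k x = 0"
      using IVT'[of ?k w 0 0] n k0 True ck[of w 0] w lr by auto
    then show False using nz by blast
  next
    case False
    obtain x where "0 \<le> x" "x \<le> w" "?k x = 0"
      using IVT2'[of ?k w 0 0] n k0 False ck[of 0 w] w lr by auto
    then show False using nz by blast
  qed
qed

text \<open>If \<Psi> has real roots over \<open>w\<close>, then \<open>p\<close> lies to the right
  of the vertex and hence beyond the larger root, after which \<Psi> increases. Otherwise the monic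
  quadratic is positive everywhere.\<close>

lemma above_branch:
  assumes "\<Psi> w p > 0" "4 * a w - (b w)\<^sup>2 \<le> 0 \<Longrightarrow> 2 * p + b w > 0" "p \<le> v"
  shows "\<Psi> w v > 0"
proof (cases "4 * a w - (b w)\<^sup>2 \<le> 0")
  case True
  have "\<Psi> w v - \<Psi> w p = (v - p) * (v + p + b w)" by (simp add: \<Psi>_def power2_eq_square algebra_simps)
  moreover have "(v - p) * (v + p + b w) \<ge> 0" using assms(2)[OF True] assms(3) by (intro mult_nonneg_nonneg) auto
  ultimately show ?thesis using assms(1) by linarith
next
  case False
  have "4 * \<Psi> w v = (2 * v + b w)\<^sup>2 + (4 * a w - (b w)\<^sup>2)" by (simp add: \<Psi>_def power2_eq_square algebra_simps)
  moreover have "(2 * v + b w)\<^sup>2 \<ge> 0" by simp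
  ultimately show ?thesis using False by linarith
qed

abbreviation "f' \<equiv> \<lambda>w. f (- w)"
abbreviation "g' \<equiv> \<lambda>w. - g (- w)"

text \<open>The ring between the two closed curves lies in \<Psi> > 0. Each half of it yields a
  strictly negative sum of axis terms, but the axis terms of the lower half are those of the upper
  half with opposite sign.\<close>

theorem no_nested_orbit:
  assumes up: "half_arc f g (- A1) B1 p" and lo: "half_arc f' g' (- B1) A1 p'"
    and up2: "outer_curve f g (- A2) B2 q" and lo2: "outer_curve f' g' (- B2) A2 q'"
    and AB: "A1 < A2" "B1 < B2"
    and pq: "\<And>w. - A1 \<le> w \<Longrightarrow> w \<le> B1 \<Longrightarrow> p w < q w" and pq': "\<And>w. - B1 \<le> w \<Longrightarrow> w \<le> A1 \<Longrightarrow> p' w < q' w"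
    and pos: "\<And>w. - A1 \<le> w \<Longrightarrow> w \<le> B1 \<Longrightarrow> \<Psi> w (p w) > 0"
    and pos': "\<And>w. - A1 \<le> w \<Longrightarrow> w \<le> B1 \<Longrightarrow> \<Psi> w (- p' (- w)) > 0"
    and h: "\<And>w. - A2 < w \<Longrightarrow> w < B2 \<Longrightarrow> h w > 0" and a0: "a 0 < 0"
    and D: "\<And>w x. - A2 \<le> w \<Longrightarrow> w \<le> B2 \<Longrightarrow> 4 * a w - (b w)\<^sup>2 \<le> 0 \<Longrightarrow> w \<le> x \<and> x \<le> 0 \<or> 0 \<le> x \<and> x \<le> w \<Longrightarrow> 4 * a x - (b x)\<^sup>2 \<le> 0"
  shows False
proof -
  interpret R: dulac f' g' "\<lambda>w. a (- w)" "\<lambda>w. - b (- w)" "\<lambda>w. h (- w)" by (rule reflect)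
  have R\<Psi>: "R.\<Psi> w v = \<Psi> (- w) (- v)" for w v by (simp add: R.\<Psi>_def \<Psi>_def)
  note d = half_arcD[OF up] and d' = half_arcD[OF lo]
  have k: "2 * p w + b w > 0" if "- A1 \<le> w" "w \<le> B1" "4 * a w - (b w)\<^sup>2 \<le> 0" for w
    by (rule branch[OF d(5) _ _ pos _ a0 D that]) (use d AB in \<open>auto intro: d(8)\<close>)
  have k': "2 * p' w - b (- w) > 0" if H: "- B1 \<le> w" "w \<le> A1" "4 * a (- w) - (b (- w))\<^sup>2 \<le> 0" for w
  proof -
    have "2 * p' w + - b (- w) > 0"
    proof (rule R.branch[OF d'(5)])
      show "0 < R.\<Psi> w (p' w)" if "- B1 \<le> w" "w \<le> A1" for w using pos'[of "- w"] that by (simp add: R\<Psi>)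
      show "4 * a (- x) - (- b (- x))\<^sup>2 \<le> 0" if "- B1 \<le> w" "w \<le> A1" "4 * a (- w) - (- b (- w))\<^sup>2 \<le> 0"
          "w \<le> x \<and> x \<le> 0 \<or> 0 \<le> x \<and> x \<le> w" for w x
        using D[of "- w" "- x"] that AB by auto
    qed (use d d' a0 H in \<open>auto intro: d'(8)\<close>)
    then show ?thesis by simp
  qed
  have up_pos: "\<Psi> w v > 0" if "- A1 \<le> w" "w \<le> B1" "p w \<le> v" for w v
    using above_branch[OF pos k] that by auto
  have lo_pos: "R.\<Psi> w v > 0" if "- B1 \<le> w" "w \<le> A1" "p' w \<le> v" for w v
    using R.above_branch[of w "p' w" v] pos'[of "- w"] k'[of w] that by (auto simp: R\<Psi>)
  \<comment> \<open>At a turning point both arcs have height 0. If \<Psi> had real roots over it,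
    the upper arc would give \<open>b > 0\<close> and the lower arc \<open>b < 0\<close>.\<close>
  have DA: "4 * a (- A1) - (b (- A1))\<^sup>2 > 0"
    using k[of "- A1"] k'[of A1] d(1,2,6) d'(7) by (force simp: not_less[symmetric])
  have DB: "4 * a B1 - (b B1)\<^sup>2 > 0"
    using k[of B1] k'[of "- B1"] d(1,2,7) d'(6) by (force simp: not_less[symmetric])
  \<comment> \<open>By contraposition of \<open>D\<close>, absence of real roots at the inner
    turning points persists outwards, so the outer pieces may reach down to the axis without meeting
    \<Psi> = 0.\<close>
  have Dout: "4 * a w - (b w)\<^sup>2 > 0" if "- A2 \<le> w \<and> w \<le> - A1 \<or> B1 \<le> w \<and> w \<le> B2" for w
    using D[of w "- A1"] D[of w B1] DA DB that d(1,2) AB by force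
  have out: "\<Psi> w v > 0" "R.\<Psi> (- w) v > 0" "a w > 0" if "- A2 \<le> w \<and> w \<le> - A1 \<or> B1 \<le> w \<and> w \<le> B2" for w v
  proof -
    have e: "\<Psi> w v > 0" for v
    proof -
      have "4 * \<Psi> w v = (2 * v + b w)\<^sup>2 + (4 * a w - (b w)\<^sup>2)" by (simp add: \<Psi>_def power2_eq_square algebra_simps)
      moreover have "(2 * v + b w)\<^sup>2 \<ge> 0" by simp
      ultimately show ?thesis using Dout[OF that] by linarith
    qed
    then show "\<Psi> w v > 0" "R.\<Psi> (- w) v > 0" by (auto simp: R\<Psi>)
    show "a w > 0" using e[of 0] by (simp add: \<Psi>_def)
  qed
  obtain N1 where N1: "continuous_on {- A2..- A1} N1" "\<And>w. - A2 < w \<Longrightarrow> w < - A1 \<Longrightarrow> (N1 has_real_derivative g w / (a w)\<^sup>2) (at w)"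
    using primitive[of "- A2" "- A1"] out(3) by (metis less_irrefl)
  obtain N2 where N2: "continuous_on {B1..B2} N2" "\<And>w. B1 < w \<Longrightarrow> w < B2 \<Longrightarrow> (N2 has_real_derivative g w / (a w)\<^sup>2) (at w)"
    using primitive[of B1 B2] out(3) by (metis less_irrefl)
  have m: "((\<lambda>w. - w) has_real_derivative - 1) (at w)" for w :: real by (auto intro!: derivative_eq_intros)
  have "N1 (- A1) - N1 (- A2) + (N2 B2 - N2 B1) < 0"
    by (rule outer_flux_negative[OF up up2 _ _ pq up_pos _ _ h N1 N2]) (use AB out in auto)
  \<comment> \<open>Reflection interchanges the left and right pieces and negates \<open>g\<close>,
    so the reflected primitives of the upper half serve here unchanged.\<close>
  moreover have "N2 (- (- B1)) - N2 (- (- B2)) + (N1 (- A2) - N1 (- A1)) < 0"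
  proof (rule R.outer_flux_negative[OF lo lo2 _ _ pq' lo_pos, where ?N1.0 = "\<lambda>w. N2 (- w)" and ?N2.0 = "\<lambda>w. N1 (- w)"])
    show "continuous_on {- B2..- B1} (\<lambda>w. N2 (- w))" "continuous_on {A1..A2} (\<lambda>w. N1 (- w))"
      by (auto intro!: continuous_on_compose2[OF N2(1)] continuous_on_compose2[OF N1(1)] continuous_intros)
    show "((\<lambda>w. N2 (- w)) has_real_derivative - g (- w) / (a (- w))\<^sup>2) (at w)" if "- B2 < w" "w < - B1" for w
      using DERIV_chain2[where f = N2 and g = uminus, OF N2(2) m, of w] that by simp
    show "((\<lambda>w. N1 (- w)) has_real_derivative - g (- w) / (a (- w))\<^sup>2) (at w)" if "A1 < w" "w < A2" for w
      using DERIV_chain2[where f = N1 and g = uminus, OF N1(2) m, of w] that by simp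
    show "R.\<Psi> w v > 0" if "- B2 \<le> w" "w \<le> - B1" for w v using out(2)[of "- w" v] that by simp
    show "R.\<Psi> w v > 0" if "A1 \<le> w" "w \<le> A2" for w v using out(2)[of "- w" v] that by simp
  qed (use AB h in auto)
  ultimately show False by simp
qed

text \<open>The interior of the orbit lies in \<Psi> < 0, and the whole segment of the axis is used
  as lower edge. Its contribution would have to be positive for both halves, yet reflection reverses
  its sign.\<close>

theorem no_inner_orbit:
  assumes up: "half_arc f g (- A1) B1 p" and lo: "half_arc f' g' (- B1) A1 p'"
    and neg: "\<And>w. - A1 \<le> w \<Longrightarrow> w \<le> B1 \<Longrightarrow> \<Psi> w (p w) < 0"
    and neg': "\<And>w. - A1 \<le> w \<Longrightarrow> w \<le> B1 \<Longrightarrow> \<Psi> w (- p' (- w)) < 0"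
    and h: "\<And>w. - A1 < w \<Longrightarrow> w < B1 \<Longrightarrow> h w > 0"
  shows False
proof -
  interpret R: dulac f' g' "\<lambda>w. a (- w)" "\<lambda>w. - b (- w)" "\<lambda>w. h (- w)" by (rule reflect)
  have R\<Psi>: "R.\<Psi> w v = \<Psi> (- w) (- v)" for w v by (simp add: R.\<Psi>_def \<Psi>_def)
  note d = half_arcD[OF up] and d' = half_arcD[OF lo]
  have inn: "\<Psi> w v < 0" if H: "- A1 \<le> w" "w \<le> B1" "- p' (- w) \<le> v" "v \<le> p w" for w v
  proof (rule ccontr)
    assume n: "\<not> \<Psi> w v < 0"
    let ?x = "- p' (- w)" and ?y = "p w"
    have "?x \<noteq> v" "v \<noteq> ?y" using n neg neg' H by auto
    then have lt: "?x < v" "v < ?y" using H by auto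
    \<comment> \<open>Convexity of a monic quadratic in exact form: at an intermediate point \<Psi>
      lies below the chord between the two arcs.\<close>
    have "(?y - ?x) * \<Psi> w v = (?y - v) * \<Psi> w ?x + (v - ?x) * \<Psi> w ?y - (?y - v) * (v - ?x) * (?y - ?x)"
      by (simp add: \<Psi>_def power2_eq_square algebra_simps)
    moreover have "(?y - v) * \<Psi> w ?x < 0" "(v - ?x) * \<Psi> w ?y < 0" 
      using lt neg[OF H(1,2)] neg'[OF H(1,2)] by (auto intro: mult_pos_neg)
    moreover have "(?y - v) * (v - ?x) * (?y - ?x) > 0" using lt by simp
    moreover have "(?y - ?x) * \<Psi> w v \<ge> 0" using lt n by simp
    ultimately show False by linarith
  qed
  have a: "a w < 0" if "- A1 \<le> w" "w \<le> B1" for w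
    using inn[of w 0] that d(10)[of w] d'(10)[of "- w"] by (simp add: \<Psi>_def)
  obtain N where N: "continuous_on {- A1..B1} N" "\<And>w. - A1 < w \<Longrightarrow> w < B1 \<Longrightarrow> (N has_real_derivative g w / (a w)\<^sup>2) (at w)"
    using primitive[of "- A1" B1] a by (metis less_irrefl)
  have m: "((\<lambda>w. - w) has_real_derivative - 1) (at w)" for w :: real by (auto intro!: derivative_eq_intros)
  have "N B1 - N (- A1) > 0"
  proof (rule inner_flux_positive[OF up _ h N])
    fix w v assume H: "- A1 \<le> w" "w \<le> B1" "0 \<le> v" "v \<le> p w"
    then show "\<Psi> w v < 0" using d'(10)[of "- w"] by (intro inn) auto
  qed auto
  moreover have "N (- A1) - N (- (- B1)) > 0"
  proof (rule R.inner_flux_positive[OF lo, where N = "\<lambda>w. N (- w)"])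
    show "continuous_on {- B1..A1} (\<lambda>w. N (- w))"
      by (auto intro!: continuous_on_compose2[OF N(1)] continuous_intros)
    show "((\<lambda>w. N (- w)) has_real_derivative - g (- w) / (a (- w))\<^sup>2) (at w)" if "- B1 < w" "w < A1" for w
      using DERIV_chain2[where f = N and g = uminus, OF N(2) m, of w] that by simp
    fix w v assume H: "- B1 \<le> w" "w \<le> A1" "0 \<le> v" "v \<le> p' w"
    then show "R.\<Psi> w v < 0" unfolding R\<Psi> using d(10)[of "- w"] by (intro inn) auto
  qed (use h in auto)
  ultimately show False by simp
qed

end

section \<open>Periodic solutions and their half-orbits\<close>

definition solution :: "(real \<Rightarrow> real) \<Rightarrow> (real \<Rightarrow> real) \<Rightarrow> (real \<Rightarrow> real) \<Rightarrow> (real \<Rightarrow> real) \<Rightarrow> bool" where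
  "solution f g w v \<longleftrightarrow> (\<forall>t. (w has_real_derivative v t) (at t) \<and> (v has_real_derivative - g (w t) - f (w t) * v t) (at t))"

lemma solutionD:
  assumes "solution f g w v"
  shows "(w has_real_derivative v t) (at t)" "(v has_real_derivative - g (w t) - f (w t) * v t) (at t)"
    "continuous_on S w" "continuous_on S v"
proof -
  show w: "(w has_real_derivative v t) (at t)" and v: "(v has_real_derivative - g (w t) - f (w t) * v t) (at t)" for t
    using assms by (auto simp: solution_def)
  show "continuous_on S w" "continuous_on S v"
    by (rule DERIV_continuous_on, rule has_field_derivative_at_within, rule w)
       (rule DERIV_continuous_on, rule has_field_derivative_at_within, rule v)
qed

lemma solution_reflect:
  assumes "solution f g w v"
  shows "solution (\<lambda>x. f (- x)) (\<lambda>x. - g (- x)) (\<lambda>t. - w t) (\<lambda>t. - v t)"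
  unfolding solution_def using DERIV_minus[OF solutionD(1)[OF assms]] DERIV_minus[OF solutionD(2)[OF assms]] by (simp add: add.commute)

text \<open>The arc is the maximal time interval around \<open>t0\<close> on which
  \<open>v > 0\<close>. At its ends \<open>v' = - g\<close>, so positivity just inside forces
  \<open>g < 0\<close> at the start and \<open>g > 0\<close> at the end; the arc therefore passes
  over the focus.\<close>

lemma arc_through:
  assumes sol: "solution f g w v" and g0: "g 0 = 0"
    and sgn: "\<And>x. lo \<le> x \<Longrightarrow> x \<le> hi \<Longrightarrow> (x < 0 \<longrightarrow> g x < 0) \<and> (0 < x \<longrightarrow> 0 < g x)"
    and rng: "\<And>t. lo \<le> w t \<and> w t \<le> hi" and neq: "\<And>t. v t = 0 \<Longrightarrow> g (w t) \<noteq> 0"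
    and t0: "v t0 > 0" and s: "s < t0" "t0 < s'" "v s \<le> 0" "v s' \<le> 0"
  obtains s1 s2 \<phi> where "s \<le> s1" "s1 < t0" "t0 < s2" "s2 \<le> s'" "v s1 = 0" "v s2 = 0" "\<And>t. s1 < t \<Longrightarrow> t < s2 \<Longrightarrow> v t > 0"
    "half_arc f g (w s1) (w s2) \<phi>" "\<And>t. s1 \<le> t \<Longrightarrow> t \<le> s2 \<Longrightarrow> \<phi> (w t) = v t"
    "\<And>x. w s1 \<le> x \<Longrightarrow> x \<le> w s2 \<Longrightarrow> \<exists>t\<in>{s1..s2}. w t = x"
proof -
  note S = solutionD[OF sol]
  define Z1 where "Z1 = {s..t0} \<inter> v -` {..0}"
  define Z2 where "Z2 = {t0..s'} \<inter> v -` {..0}"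
  have cl: "closed Z1" "closed Z2" unfolding Z1_def Z2_def
    by (rule continuous_closed_preimage[OF S(4)]; simp)+
  have b: "bdd_above Z1" "bdd_below Z2" by (auto simp: Z1_def Z2_def bdd_above_def bdd_below_def)
  define s1 where "s1 = Sup Z1"
  define s2 where "s2 = Inf Z2"
  have "s \<in> Z1" "s' \<in> Z2" using s by (auto simp: Z1_def Z2_def)
  have "s1 \<in> Z1" unfolding s1_def by (rule closed_contains_Sup[OF _ b(1) cl(1)]) (use \<open>s \<in> Z1\<close> in auto)
  then have s1: "s \<le> s1" "s1 \<le> t0" "v s1 \<le> 0" by (auto simp: Z1_def)
  have "s2 \<in> Z2" unfolding s2_def by (rule closed_contains_Inf[OF _ b(2) cl(2)]) (use \<open>s' \<in> Z2\<close> in auto)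
  then have s2: "t0 \<le> s2" "s2 \<le> s'" "v s2 \<le> 0" by (auto simp: Z2_def)
  have s1t: "s1 < t0" using s1 t0 by (cases "s1 = t0") auto
  have s2t: "t0 < s2" using s2 t0 by (cases "s2 = t0") auto
  have pos: "v t > 0" if H: "s1 < t" "t < s2" for t
  proof (rule ccontr)
    assume n: "\<not> v t > 0"
    show False
    proof (cases "t \<le> t0")
      case True
      then have "t \<in> Z1" using n H s1 by (auto simp: Z1_def)
      then have "t \<le> s1" unfolding s1_def by (rule cSup_upper[OF _ b(1)])
      then show False using H by simp
    next
      case False
      then have "t \<in> Z2" using n H s2 by (auto simp: Z2_def)
      then have "s2 \<le> t" unfolding s2_def by (rule cInf_lower[OF _ b(2)])
      then show False using H by simp
    qed
  qed
  have lt: "s1 < s2" using s1t s2t by simp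
  have nn: "v x \<ge> 0" if "x \<in> {s1..s2}" for x
    by (rule continuous_ge_on_Ioo[OF S(4) _ lt that]) (use pos in \<open>auto intro: less_imp_le\<close>)
  have v1: "v s1 = 0" and v2: "v s2 = 0"
    using nn[of s1] nn[of s2] lt s1(3) s2(3) by auto
  have g1: "g (w s1) < 0"
  proof (rule ccontr)
    assume "\<not> g (w s1) < 0"
    then have "- g (w s1) < 0" using neq[OF v1] by simp
    moreover have "(v has_real_derivative - g (w s1)) (at s1)" using S(2)[of s1] v1 by simp
    ultimately obtain e where e: "e > 0" "\<And>h. 0 < h \<Longrightarrow> h < e \<Longrightarrow> v (s1 + h) < v s1"
      using has_real_derivative_neg_dec_right[of v "- g (w s1)" s1 UNIV] by auto
    define h where "h = min (e / 2) ((s2 - s1) / 2)"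
    have "0 < h" "h < e" "h < s2 - s1" using e lt by (auto simp: h_def min_def)
    then show False using e(2)[of h] pos[of "s1 + h"] v1 by auto
  qed
  have g2: "g (w s2) > 0"
  proof (rule ccontr)
    assume "\<not> g (w s2) > 0"
    then have "- g (w s2) > 0" using neq[OF v2] by simp
    moreover have "(v has_real_derivative - g (w s2)) (at s2)" using S(2)[of s2] v2 by simp
    ultimately obtain e where e: "e > 0" "\<And>h. 0 < h \<Longrightarrow> h < e \<Longrightarrow> v (s2 - h) < v s2"
      using has_real_derivative_pos_inc_left[of v "- g (w s2)" s2 UNIV] by auto
    define h where "h = min (e / 2) ((s2 - s1) / 2)"
    have "0 < h" "h < e" "h < s2 - s1" using e lt by (auto simp: h_def min_def)
    then show False using e(2)[of h] pos[of "s2 - h"] v2 by auto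
  qed
  have w1: "w s1 < 0" using sgn[of "w s1"] rng[of s1] g1 g0 by (cases "w s1 = 0") auto
  have w2: "w s2 > 0" using sgn[of "w s2"] rng[of s2] g2 g0 by (cases "w s2 = 0") auto
  obtain \<phi> where "half_arc f g (w s1) (w s2) \<phi>" "\<And>t. s1 \<le> t \<Longrightarrow> t \<le> s2 \<Longrightarrow> \<phi> (w t) = v t"
    "\<And>x. w s1 \<le> x \<Longrightarrow> x \<le> w s2 \<Longrightarrow> \<exists>t\<in>{s1..s2}. w t = x"
  proof (rule half_arc_of_trajectory[OF lt, of w v g f])
    show "g x < 0" if "w s1 \<le> x" "x < 0" for x using sgn[of x] that rng[of s1] rng[of s2] w2 by auto
    show "g x > 0" if "0 < x" "x \<le> w s2" for x using sgn[of x] that rng[of s1] rng[of s2] w1 by auto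
  qed (use S(1,2) v1 v2 pos w1 w2 in \<open>auto intro: has_field_derivative_at_within\<close>)
  then show ?thesis using s1 s1t s2 s2t v1 v2 pos by (intro that)
qed

text \<open>A second derivative test: where \<open>v = 0\<close>, the second derivative of
  \<open>w\<close> is \<open>- g\<close>, and \<open>neq\<close> excludes the degenerate value
  0.\<close>

lemma max_restoring:
  assumes sol: "solution f g w v" and mx: "\<And>t. w t \<le> w tM" and neq: "\<And>t. v t = 0 \<Longrightarrow> g (w t) \<noteq> 0"
  shows "v tM = 0" "g (w tM) > 0"
proof -
  note S = solutionD[OF sol]
  show v: "v tM = 0" by (rule DERIV_local_max[OF S(1), of 1]) (use mx in auto)
  show "g (w tM) > 0"
  proof (rule ccontr)
    assume "\<not> g (w tM) > 0"
    then have "- g (w tM) > 0" using neq[OF v] by simp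
    moreover have "(v has_real_derivative - g (w tM)) (at tM)" using S(2)[of tM] v by simp
    ultimately obtain e where e: "e > 0" "\<And>h. 0 < h \<Longrightarrow> h < e \<Longrightarrow> v tM < v (tM + h)"
      using has_real_derivative_pos_inc_right[of v "- g (w tM)" tM UNIV] by auto
    have "w tM < w (tM + e / 2)"
    proof (rule DERIV_pos_imp_increasing_open[where f = w])
      fix x assume "tM < x" "x < tM + e / 2"
      then show "\<exists>y. (w has_real_derivative y) (at x) \<and> 0 < y"
        using e(2)[of "x - tM"] v S(1)[of x] by auto
    qed (use e S in auto)
    then show False using mx[of "tM + e / 2"] by simp
  qed
qed

lemma min_restoring:
  assumes sol: "solution f g w v" and mn: "\<And>t. w tm \<le> w t" and neq: "\<And>t. v t = 0 \<Longrightarrow> g (w t) \<noteq> 0"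
  shows "v tm = 0" "g (w tm) < 0"
  using max_restoring[OF solution_reflect[OF sol], of tm] mn neq by auto

text \<open>The arc ending at the maximum of \<open>w\<close> and the arc starting at its minimum coincide, since longer arcs end further right.\<close>

lemma periodic_half_arc:
  assumes sol: "solution f g w v" and cg: "continuous_on UNIV g" and g0: "g 0 = 0"
    and sgn: "\<And>x. w tm \<le> x \<Longrightarrow> x \<le> w tM \<Longrightarrow> (x < 0 \<longrightarrow> g x < 0) \<and> (0 < x \<longrightarrow> 0 < g x)"
    and mn: "\<And>t. w tm \<le> w t" and mx: "\<And>t. w t \<le> w tM" and neq: "\<And>t. v t = 0 \<Longrightarrow> g (w t) \<noteq> 0"
    and per: "T > 0" "\<And>t. v (t + T) = v t"
  obtains \<phi> where "half_arc f g (w tm) (w tM) \<phi>" "\<forall>x\<in>{w tm..w tM}. \<exists>t. w t = x \<and> v t = \<phi> x"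
proof -
  note S = solutionD[OF sol]
  note vM = max_restoring[OF sol mx neq] and vm = min_restoring[OF sol mn neq]
  have rng: "w tm \<le> w t \<and> w t \<le> w tM" for t using mn mx by simp
  have "(v has_real_derivative - g (w tM)) (at tM)" using S(2)[of tM] vM by simp
  then obtain e where e: "e > 0" "\<And>h. 0 < h \<Longrightarrow> h < e \<Longrightarrow> v tM < v (tM - h)"
    using has_real_derivative_neg_dec_left[of v "- g (w tM)" tM UNIV] vM by auto
  define h where "h = min (e / 2) (T / 2)"
  have h: "0 < h" "h < e" "h < T" using e per by (auto simp: h_def min_def)
  \<comment> \<open>One period before the maximum \<open>v\<close> vanishes too, so the arc through
    \<open>tM - h\<close> cannot start before \<open>tM - T\<close>.\<close>
  obtain s1 s2 \<phi> where a: "tM - T \<le> s1" "s1 < tM - h" "tM - h < s2" "s2 \<le> tM" "v s2 = 0"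
    "half_arc f g (w s1) (w s2) \<phi>" "\<And>t. s1 \<le> t \<Longrightarrow> t \<le> s2 \<Longrightarrow> \<phi> (w t) = v t"
    "\<And>x. w s1 \<le> x \<Longrightarrow> x \<le> w s2 \<Longrightarrow> \<exists>t\<in>{s1..s2}. w t = x"
    by (rule arc_through[OF sol g0 sgn rng neq, of "tM - h" "tM - T" tM]) (use e h vM per(2)[of "tM - T"] in auto)
  have s2: "s2 = tM"
  proof (rule ccontr)
    assume "s2 \<noteq> tM"
    then show False using e(2)[of "tM - s2"] a(3,4,5) h vM by auto
  qed
  have "(v has_real_derivative - g (w tm)) (at tm)" using S(2)[of tm] vm by simp
  then obtain e' where e': "e' > 0" "\<And>h. 0 < h \<Longrightarrow> h < e' \<Longrightarrow> v tm < v (tm + h)"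
    using has_real_derivative_pos_inc_right[of v "- g (w tm)" tm UNIV] vm by auto
  define h' where "h' = min (e' / 2) (T / 2)"
  have h': "0 < h'" "h' < e'" "h' < T" using e' per by (auto simp: h'_def min_def)
  obtain r1 r2 \<psi> where b: "tm \<le> r1" "r1 < tm + h'" "tm + h' < r2" "r2 \<le> tm + T" "v r1 = 0"
    "half_arc f g (w r1) (w r2) \<psi>"
    by (rule arc_through[OF sol g0 sgn rng neq, of "tm + h'" tm "tm + T"]) (use e' h' vm per(2)[of tm] in auto)
  have r1: "r1 = tm"
  proof (rule ccontr)
    assume "r1 \<noteq> tm"
    then show False using e'(2)[of "r1 - tm"] b(1,2,5) h' vm by auto
  qed
  have "w s1 = w tm"
  proof (rule ccontr)
    assume "w s1 \<noteq> w tm"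
    then have "w tm < w s1" using mn[of s1] by simp
    then have "w tM < w r2" using half_arc_less(1)[OF cg a(6) b(6)] r1 s2 by simp
    then show False using mx[of r2] by simp
  qed
  then have arc: "half_arc f g (w tm) (w tM) \<phi>" using a(6) s2 by simp
  show ?thesis
  proof (rule that[OF arc], rule ballI)
    fix x assume "x \<in> {w tm..w tM}"
    then obtain t where "t \<in> {s1..s2}" "w t = x" using a(8)[of x] \<open>w s1 = w tm\<close> s2 by auto
    then show "\<exists>t. w t = x \<and> v t = \<phi> x" using a(7)[of t] by auto
  qed
qed

section \<open>Positivity certificates for integer polynomials\<close>

fun ev :: "int list \<Rightarrow> real \<Rightarrow> real" where
  "ev [] t = 0"
| "ev (a # as) t = real_of_int a + t * ev as t"

fun ladd :: "int list \<Rightarrow> int list \<Rightarrow> int list" where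
  "ladd [] bs = bs"
| "ladd (a # as) [] = a # as"
| "ladd (a # as) (b # bs) = (a + b) # ladd as bs"

definition lscale :: "int \<Rightarrow> int list \<Rightarrow> int list" where
  "lscale k as = map (\<lambda>a. k * a) as"

fun lmul :: "int list \<Rightarrow> int list \<Rightarrow> int list" where
  "lmul [] bs = []"
| "lmul (a # as) bs = ladd (lscale a bs) (0 # lmul as bs)"

fun lderiv :: "int list \<Rightarrow> int list" where
  "lderiv [] = []"
| "lderiv (a # as) = ladd as (0 # lderiv as)"

lemma ev_ladd [simp]: "ev (ladd as bs) t = ev as t + ev bs t"
  by (induction as bs rule: ladd.induct) (auto simp: algebra_simps)

lemma ev_lscale [simp]: "ev (lscale k as) t = real_of_int k * ev as t"
  by (induction as) (auto simp: lscale_def algebra_simps)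

lemma ev_lmul [simp]: "ev (lmul as bs) t = ev as t * ev bs t"
  by (induction as) (auto simp: algebra_simps)

lemma ev_deriv: "(ev as has_real_derivative ev (lderiv as) t) (at t)"
proof (induction as)
  case (Cons a as)
  have "((\<lambda>t. real_of_int a + t * ev as t) has_real_derivative ev (lderiv (a # as)) t) (at t)"
    by (auto intro!: derivative_eq_intros Cons.IH)
  then show ?case by (simp add: fun_eq_iff[symmetric] ev.simps(2)[abs_def])
qed (simp add: ev.simps(1)[abs_def])

text \<open>On [-1, 1] the remaining terms together cannot outweigh the constant
  coefficient.\<close>

fun dominant :: "int list \<Rightarrow> bool" where
  "dominant [] = False"
| "dominant (a # as) = (sum_list (map abs as) < a)"

lemma ev_bound: "\<bar>t\<bar> \<le> 1 \<Longrightarrow> \<bar>ev as t\<bar> \<le> real_of_int (sum_list (map abs as))"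
proof (induction as)
  case (Cons a as)
  have "\<bar>ev (a # as) t\<bar> \<le> \<bar>real_of_int a\<bar> + \<bar>t\<bar> * \<bar>ev as t\<bar>" by (simp flip: abs_mult)
  also have "\<bar>t\<bar> * \<bar>ev as t\<bar> \<le> 1 * real_of_int (sum_list (map abs as))"
    using Cons by (intro mult_mono) auto
  finally show ?case by simp
qed simp

lemma dominant_pos:
  assumes "dominant p" "\<bar>t\<bar> \<le> 1"
  shows "ev p t > 0"
proof (cases p)
  case (Cons a as)
  have "\<bar>t * ev as t\<bar> \<le> 1 * real_of_int (sum_list (map abs as))"
    unfolding abs_mult using ev_bound[OF assms(2), of as] assms(2) by (intro mult_mono) auto
  moreover have "real_of_int (sum_list (map abs as)) < real_of_int a" using assms(1) Cons by simp
  ultimately show ?thesis using Cons by auto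
qed (use assms in simp)

text \<open>Up to a positive factor this is the polynomial on the half of [-1, 1] centred at
  \<open>s / 2\<close>, reparametrized to [-1, 1]. The powers of 2 keep the coefficients
  integral.\<close>

fun halve :: "int \<Rightarrow> int list \<Rightarrow> int list" where
  "halve s [] = []"
| "halve s (a # as) = ladd [a * 2 ^ length as] (lmul [s, 1] (halve s as))"

lemma ev_halve: "2 * ev (halve s p) t = 2 ^ length p * ev p ((t + real_of_int s) / 2)"
proof (induction p)
  case (Cons a as)
  have "2 * ev (halve s (a # as)) t = 2 * (real_of_int a * 2 ^ length as) + (real_of_int s + t) * (2 * ev (halve s as) t)"
    by (simp add: algebra_simps)
  then show ?case unfolding Cons by (simp add: field_simps)
qed simp

text \<open>Bisection of [-1, 1] to depth \<open>n\<close> until the constant coefficient dominates.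
  Only integer arithmetic is involved, so the certificates can be evaluated.\<close>

fun positive_cert :: "nat \<Rightarrow> int list \<Rightarrow> bool" where
  "positive_cert 0 p = dominant p"
| "positive_cert (Suc n) p = (dominant p \<or> positive_cert n (halve (- 1) p) \<and> positive_cert n (halve 1 p))"

lemma positive_cert:
  assumes "positive_cert n p" "\<bar>t\<bar> \<le> 1"
  shows "ev p t > 0"
  using assms
proof (induction n arbitrary: p t)
  case (Suc n)
  have *: "ev p t > 0" if "positive_cert n (halve s p)" "\<bar>2 * t - real_of_int s\<bar> \<le> 1" for s
  proof -
    have "ev (halve s p) (2 * t - real_of_int s) > 0" using Suc.IH that by blast
    then have "2 ^ length p * ev p t > 0" using ev_halve[of s p "2 * t - real_of_int s"] by simp
    then show ?thesis by (simp add: zero_less_mult_iff)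
  qed
  show ?case
  proof (cases "dominant p")
    case False
    then have c: "positive_cert n (halve (- 1) p)" "positive_cert n (halve 1 p)" using Suc.prems by auto
    show ?thesis
    proof (cases "t \<le> 0")
      case True
      then show ?thesis using *[OF c(1)] Suc.prems by auto
    next
      case False
      then show ?thesis using *[OF c(2)] Suc.prems by auto
    qed
  qed (use dominant_pos Suc.prems in blast)
qed (use dominant_pos in auto)

text \<open>Coefficients, in units of \<open>10^(-11)\<close>, of the polynomial \<open>u\<close> for which the loop \<open>w = 1 - \<sigma> (1 - t^2)\<close>,
  \<open>v = (1 - w) * t * u t\<close>, \<open>-1 \<le> t \<le> 1\<close>, approximates the homoclinic orbit; they were found by numerical collocation.
  The value \<open>\<sigma> = 1 + (u 0)^2 / 2\<close> is forced: it makes the defect of the loop divisible by \<open>t\<close>.\<close>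

definition ulist :: "int list" where
  "ulist = [102202636516, 43848246542, 6881981331, -684249987, -137492088, 67525445, -5539000, -4255589,
     1652380, -48787, -155395, 49839, 2381, -5093, 906]"

text \<open>\<open>loop_defect\<close> for \<open>d = 1 - C / 10 ^ 10\<close>, multiplied by
  \<open>2 * 10 ^ 33\<close> to clear denominators. The constant 102202636516 is
  \<open>10 ^ 11 * \<kappa>\<close>, and 30445378910821616618256 is
  \<open>2 * 10 ^ 22 * \<sigma>\<close>.\<close>

definition elist :: "int \<Rightarrow> int list" where
  "elist C = ladd (lscale (10 ^ 11)
      (ladd (lmul [1, 0, -1] (lmul ulist (lderiv ulist)))
      (ladd (lmul (tl ulist) (ladd ulist [102202636516]))
      (ladd (lmul [0, -3] (lmul ulist ulist)) [0, 30445378910821616618256]))))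
    (lmul [2 * 10 ^ 12 * C - 30445378910821616618256, 0, 30445378910821616618256] ulist)"

lemma cert_u: "positive_cert 0 ulist" by code_simp
lemma cert_u2: "positive_cert 0 (ladd [160000000000] (lscale (-1) ulist))" by code_simp
lemma cert_e0: "positive_cert 3 (lscale (-1) (elist 8645452471))" by code_simp
lemma cert_e1: "positive_cert 2 (elist 8645452485)" by code_simp

text \<open>This and the following lists are integer multiples of the damping, its primitive,
  \<open>b\<close>, \<open>g\<close>, \<open>a\<close>, \<open>h\<close>, the discriminant term
  \<open>4 * a - b^2\<close> and its derivative. They are polynomials in \<open>t\<close> after the
  substitution \<open>w = ev W t / 20\<close>, with \<open>d = N / 10 ^ 10\<close>.\<close>

definition flist :: "int \<Rightarrow> int list \<Rightarrow> int list" where "flist N W = ladd (lscale (10 ^ 10) W) [- 20 * N]"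
definition Flist :: "int \<Rightarrow> int list \<Rightarrow> int list" where "Flist N W = lmul W (ladd (lscale (10 ^ 10) W) [- 40 * N])"
definition blist :: "int \<Rightarrow> int list \<Rightarrow> int list" where "blist N W = ladd (lscale 3 (Flist N W)) [- 144 * 10 ^ 10]"
definition glist :: "int list \<Rightarrow> int list" where "glist W = ladd (lscale 20 W) (lscale (-1) (lmul W W))"
definition alist :: "int \<Rightarrow> int list \<Rightarrow> int list" where
  "alist N W = ladd (lscale (128 * 10 ^ 21) (ladd (lscale 30 (lmul W W)) (lscale (-1) (lmul W (lmul W W)))))
     (ladd (lscale 9 (lmul (Flist N W) (Flist N W))) (ladd (lscale (- 864 * 10 ^ 10) (Flist N W)) [- 192 * 10 ^ 24]))"
definition hlist :: "int \<Rightarrow> int list \<Rightarrow> int list" where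
  "hlist N W = ladd (lmul (flist N W) (alist N W)) (lscale (- 96 * 10 ^ 21) (lmul (glist W) (blist N W)))"
definition Dlist :: "int \<Rightarrow> int list \<Rightarrow> int list" where
  "Dlist N W = ladd (lscale 4 (alist N W)) (lscale (-6) (lmul (blist N W) (blist N W)))"
definition D'list :: "int \<Rightarrow> int list \<Rightarrow> int list" where
  "D'list N W = ladd (lscale (64 * 10 ^ 21) (glist W)) (lscale (-1) (lmul (flist N W) (blist N W)))"

text \<open>The lists \<open>W\<close> select ranges of \<open>w\<close>: [-11/20, 21/20] for
  \<open>h\<close>, then [-11/20, -1/20], [1/20, 17/20], [-1/20, 1/20] and [17/20, 21/20] for the
  discriminant term. It decreases on the second range and increases on the third. Its derivative
  changes sign inside the window around 0 and is negative at the saddle, so on the last two ranges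
  the sign of the value itself is certified.\<close>

definition dulac_cert :: "int \<Rightarrow> bool" where
  "dulac_cert N \<longleftrightarrow> positive_cert 4 (hlist N [5, 16]) \<and> positive_cert 1 (lscale (-1) (D'list N [-6, 5])) \<and>
     positive_cert 0 (D'list N [9, 8]) \<and> positive_cert 0 (lscale (-1) (Dlist N [0, 1])) \<and> positive_cert 0 (Dlist N [19, 2])"

text \<open>The arguments of the two certificates are \<open>10 ^ 10 * (1 - c)\<close> for the two
  values of \<open>c\<close>.\<close>

lemma cert_d0: "dulac_cert 1354547529" by code_simp
lemma cert_d1: "dulac_cert 1354547515" by code_simp

section \<open>The approximate homoclinic loop\<close>

definition restoring :: "real \<Rightarrow> real" where "restoring w = w * (1 - w)"
definition damping :: "real \<Rightarrow> real \<Rightarrow> real" where "damping d w = w - d"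
definition damping_primitive :: "real \<Rightarrow> real \<Rightarrow> real" where "damping_primitive d w = w\<^sup>2 / 2 - d * w"

text \<open>The constants \<open>-9/100\<close> and \<open>-1/8\<close> in \<open>dulac_b\<close> and \<open>dulac_a\<close> are the two integration constants left free by the
  requirement that \<open>\<Psi>' + f \<Psi> / 2\<close> does not depend on \<open>v\<close>; they were chosen to make \<open>dulac_h\<close> positive.\<close>

definition dulac_b :: "real \<Rightarrow> real \<Rightarrow> real" where "dulac_b d w = 3 / 2 * damping_primitive d w - 9 / 100"
definition dulac_a :: "real \<Rightarrow> real \<Rightarrow> real" where
  "dulac_a d w = w\<^sup>2 - 2 / 3 * w ^ 3 + 3 / 8 * (damping_primitive d w)\<^sup>2 - 9 / 200 * damping_primitive d w - 1 / 8"
definition dulac_h :: "real \<Rightarrow> real \<Rightarrow> real" where "dulac_h d w = damping d w * dulac_a d w / 2 - restoring w * dulac_b d w"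

lemma damping_primitive_deriv: "(damping_primitive d has_real_derivative damping d w) (at w)"
  unfolding damping_primitive_def[abs_def] damping_def by (auto intro!: derivative_eq_intros)

lemma dulac_b_deriv: "(dulac_b d has_real_derivative 3 / 2 * damping d w) (at w)"
  unfolding dulac_b_def[abs_def] by (auto intro!: derivative_eq_intros damping_primitive_deriv)

lemma dulac_a_deriv: "(dulac_a d has_real_derivative 2 * restoring w + damping d w * dulac_b d w / 2) (at w)"
proof -
  have "(dulac_a d has_real_derivative 2 * w - 2 / 3 * (3 * w\<^sup>2) + 3 / 8 * (2 * damping_primitive d w * damping d w) - 9 / 200 * damping d w) (at w)"
    unfolding dulac_a_def[abs_def] by (auto intro!: derivative_eq_intros damping_primitive_deriv)
  moreover have "2 * w - 2 / 3 * (3 * w\<^sup>2) + 3 / 8 * (2 * damping_primitive d w * damping d w) - 9 / 200 * damping d w = 2 * restoring w + damping d w * dulac_b d w / 2"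
    by (simp add: restoring_def dulac_b_def power2_eq_square field_simps)
  ultimately show ?thesis by (simp only:)
qed

lemma cont_damping: "continuous_on S (damping d)" and cont_restoring: "continuous_on S restoring"
  unfolding damping_def[abs_def] restoring_def[abs_def] by (intro continuous_intros)+

lemma dulac_BT: "dulac (damping d) restoring (dulac_a d) (dulac_b d) (dulac_h d)"
  by unfold_locales (rule cont_damping cont_restoring dulac_a_deriv dulac_b_deriv dulac_h_def)+

lemma discriminant_deriv:
  "((\<lambda>w. 4 * dulac_a d w - (dulac_b d w)\<^sup>2) has_real_derivative 8 * restoring w - damping d w * dulac_b d w) (at w)"
proof -
  have "((\<lambda>w. 4 * dulac_a d w - (dulac_b d w)\<^sup>2) has_real_derivative 4 * (2 * restoring w + damping d w * dulac_b d w / 2) - 2 * dulac_b d w * (3 / 2 * damping d w)) (at w)"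
    by (auto intro!: derivative_eq_intros dulac_a_deriv dulac_b_deriv)
  moreover have "4 * (2 * restoring w + damping d w * dulac_b d w / 2) - 2 * dulac_b d w * (3 / 2 * damping d w) = 8 * restoring w - damping d w * dulac_b d w"
    by (simp add: algebra_simps)
  ultimately show ?thesis by (simp only:)
qed

context
  fixes N :: int and W :: "int list" and d w t :: real
  assumes d: "d = real_of_int N / 10 ^ 10" and w: "w = ev W t / 20"
begin

lemma ev_flist: "ev (flist N W) t = 2 * 10 ^ 11 * damping d w"
  by (simp add: flist_def damping_def d w field_simps)

lemma ev_Flist: "ev (Flist N W) t = 8 * 10 ^ 12 * damping_primitive d w"
  by (simp add: Flist_def damping_primitive_def d w field_simps power2_eq_square)

lemma ev_glist: "ev (glist W) t = 400 * restoring w"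
  by (simp add: glist_def restoring_def w field_simps)

lemma ev_blist: "ev (blist N W) t = 16 * 10 ^ 12 * dulac_b d w"
  by (simp add: blist_def ev_Flist dulac_b_def)

lemma ev_alist: "ev (alist N W) t = 1536 * 10 ^ 24 * dulac_a d w"
proof -
  have W: "ev W t = 20 * w" using w by simp
  show ?thesis
    by (simp add: alist_def ev_Flist dulac_a_def W power2_eq_square power3_eq_cube algebra_simps)
qed

lemma ev_hlist: "ev (hlist N W) t = 6144 * 10 ^ 35 * dulac_h d w"
  by (simp add: hlist_def ev_flist ev_alist ev_glist ev_blist dulac_h_def)

lemma ev_Dlist: "ev (Dlist N W) t = 1536 * 10 ^ 24 * (4 * dulac_a d w - (dulac_b d w)\<^sup>2)"
  by (simp add: Dlist_def ev_alist ev_blist power2_eq_square)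

lemma ev_D'list: "ev (D'list N W) t = 32 * 10 ^ 23 * (8 * restoring w - damping d w * dulac_b d w)"
  by (simp add: D'list_def ev_flist ev_glist ev_blist)

end

lemma affine: "real_of_int r \<noteq> 0 \<Longrightarrow> w = ev [m, r] ((20 * w - real_of_int m) / real_of_int r) / 20"
  by (simp add: field_simps)

text \<open>The discriminant term falls towards the window around 0 from both sides and is negative
  inside it, so on [-11/20, 1] its nonpositive set is an interval containing 0.\<close>

lemma dulac_cert_facts:
  assumes cert: "dulac_cert N" and d: "d = real_of_int N / 10 ^ 10"
  shows "\<And>w. - 11 / 20 \<le> w \<Longrightarrow> w \<le> 1 \<Longrightarrow> dulac_h d w > 0"
    and "\<And>w x. - 11 / 20 \<le> w \<Longrightarrow> w \<le> 1 \<Longrightarrow> 4 * dulac_a d w - (dulac_b d w)\<^sup>2 \<le> 0 \<Longrightarrow>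
           w \<le> x \<and> x \<le> 0 \<or> 0 \<le> x \<and> x \<le> w \<Longrightarrow> 4 * dulac_a d x - (dulac_b d x)\<^sup>2 \<le> 0"
proof -
  let ?D = "\<lambda>w. 4 * dulac_a d w - (dulac_b d w)\<^sup>2"
  have c: "positive_cert 4 (hlist N [5, 16])" "positive_cert 1 (lscale (-1) (D'list N [-6, 5]))"
     "positive_cert 0 (D'list N [9, 8])" "positive_cert 0 (lscale (-1) (Dlist N [0, 1]))" "positive_cert 0 (Dlist N [19, 2])"
    using cert by (auto simp: dulac_cert_def)
  show "dulac_h d w > 0" if "- 11 / 20 \<le> w" "w \<le> 1" for w
    using positive_cert[OF c(1), of "(20 * w - 5) / 16"] that
      ev_hlist[OF d affine[of 16 w "5"]] by (simp add: abs_le_iff)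
  have D1: "8 * restoring w - damping d w * dulac_b d w < 0" if "- 11 / 20 \<le> w" "w \<le> - 1 / 20" for w
    using positive_cert[OF c(2), of "(20 * w + 6) / 5"] that
      ev_D'list[OF d affine[of 5 w "-6"]] by (simp add: abs_le_iff mult.commute)
  have D2: "8 * restoring w - damping d w * dulac_b d w > 0" if "1 / 20 \<le> w" "w \<le> 17 / 20" for w
    using positive_cert[OF c(3), of "(20 * w - 9) / 8"] that
      ev_D'list[OF d affine[of 8 w "9"]] by (simp add: abs_le_iff mult.commute)
  have D3: "?D w < 0" if "- 1 / 20 \<le> w" "w \<le> 1 / 20" for w
    using positive_cert[OF c(4), of "20 * w"] that
      ev_Dlist[OF d affine[of 1 w 0]] by (simp add: abs_le_iff)
  have D4: "?D w > 0" if "17 / 20 \<le> w" "w \<le> 1" for w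
    using positive_cert[OF c(5), of "(20 * w - 19) / 2"] that
      ev_Dlist[OF d affine[of 2 w "19"]] by (simp add: abs_le_iff)
  fix w x assume w: "- 11 / 20 \<le> w" "w \<le> 1" "?D w \<le> 0" and x: "w \<le> x \<and> x \<le> 0 \<or> 0 \<le> x \<and> x \<le> w"
  show "?D x \<le> 0"
  proof (cases "- 1 / 20 \<le> x \<and> x \<le> 1 / 20")
    case True
    then show ?thesis using D3[of x] by simp
  next
    case False
    show ?thesis
    proof (cases "x < 0")
      case True
      have "?D x \<le> ?D w"
      proof (rule DERIV_nonpos_imp_nonincreasing[where f = ?D])
        fix y assume "w \<le> y" "y \<le> x"
        then show "\<exists>z. (?D has_real_derivative z) (at y) \<and> z \<le> 0"
          using D1[of y] w True False by (intro exI[of _ "8 * restoring y - damping d y * dulac_b d y"] conjI discriminant_deriv) auto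
      qed (use x True in auto)
      then show ?thesis using w by simp
    next
      case pos: False
      \<comment> \<open>Monotonicity is certified only up to 17/20; beyond that the discriminant
        term is positive, which the hypothesis on \<open>w\<close> excludes.\<close>
      have "w < 17 / 20" using D4[of w] w by force
      have "?D x \<le> ?D w"
      proof (rule DERIV_nonneg_imp_nondecreasing[where f = ?D])
        fix y assume "x \<le> y" "y \<le> w"
        then show "\<exists>z. (?D has_real_derivative z) (at y) \<and> 0 \<le> z"
          using D2[of y] \<open>w < 17 / 20\<close> pos False by (intro exI[of _ "8 * restoring y - damping d y * dulac_b d y"] conjI discriminant_deriv) auto
      qed (use x pos False in auto)
      then show ?thesis using w by simp
    qed
  qed
qed

section \<open>Parametrization and defect of the loop\<close>

definition loop_u :: "real \<Rightarrow> real" where "loop_u t = ev ulist t / 10 ^ 11"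
definition loop_u' :: "real \<Rightarrow> real" where "loop_u' t = ev (lderiv ulist) t / 10 ^ 11"
text \<open>Dropping the constant coefficient divides \<open>loop_u t - \<kappa>\<close> by
  \<open>t\<close>; this splits the factor \<open>t\<close> off the defect.\<close>

definition loop_u1 :: "real \<Rightarrow> real" where "loop_u1 t = ev (tl ulist) t / 10 ^ 11"
definition \<kappa> :: real where "\<kappa> = 102202636516 / 10 ^ 11"
definition \<sigma> :: real where "\<sigma> = 1 + \<kappa>\<^sup>2 / 2"

lemma loop_u_split: "loop_u t = \<kappa> + t * loop_u1 t"
  by (simp add: loop_u_def loop_u1_def \<kappa>_def ulist_def add_divide_distrib)

lemma loop_u_deriv: "(loop_u has_real_derivative loop_u' t) (at t)"
  unfolding loop_u_def[abs_def] loop_u'_def using DERIV_cdivide[OF ev_deriv] .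

lemma loop_u_bounds: "\<bar>t\<bar> \<le> 1 \<Longrightarrow> 0 < loop_u t \<and> loop_u t < 8 / 5"
  using positive_cert[OF cert_u, of t] positive_cert[OF cert_u2, of t] by (simp add: loop_u_def)

lemma \<sigma>_bounds: "1 < \<sigma>" "\<sigma> < 31 / 20"
  by (simp_all add: \<sigma>_def \<kappa>_def power2_eq_square)

text \<open>The defect of the loop after division by \<open>(1 - w) * t\<close>, which vanishes at
  the saddle and at the leftmost point. It is affine in \<open>d\<close> with coefficient
  \<open>- loop_u t < 0\<close>, so a small change of \<open>d\<close> can reverse its sign on all
  of [-1, 1].\<close>

definition loop_defect :: "real \<Rightarrow> real \<Rightarrow> real" where
  "loop_defect d t = (1 - t\<^sup>2) * loop_u t * loop_u' t / 2 + loop_u1 t * (loop_u t + \<kappa>) / 2 - 3 / 2 * t * (loop_u t)\<^sup>2 + \<sigma> * t + (1 - d - \<sigma> * (1 - t\<^sup>2)) * loop_u t"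

lemma ev_elist:
  assumes "d = 1 - real_of_int C / 10 ^ 10"
  shows "ev (elist C) t = 2 * 10 ^ 33 * loop_defect d t"
proof -
  have \<sigma>: "\<sigma> = 30445378910821616618256 / (2 * 10 ^ 22)" by (simp add: \<sigma>_def \<kappa>_def power2_eq_square)
  have 1: "ev ulist t = 10 ^ 11 * loop_u t" "ev (lderiv ulist) t = 10 ^ 11 * loop_u' t" "ev (tl ulist) t = 10 ^ 11 * loop_u1 t"
    by (simp_all add: loop_u_def loop_u'_def loop_u1_def)
  show ?thesis unfolding elist_def ev_ladd ev_lscale ev_lmul 1 loop_defect_def assms \<sigma>
    by (simp add: \<kappa>_def power2_eq_square field_simps)
qed

lemma loop_defect_neg: "\<bar>t\<bar> \<le> 1 \<Longrightarrow> loop_defect (1354547529 / 10 ^ 10) t < 0"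
  using positive_cert[OF cert_e0, of t] ev_elist[of "1354547529 / 10 ^ 10" 8645452471 t] by simp

lemma loop_defect_pos: "\<bar>t\<bar> \<le> 1 \<Longrightarrow> loop_defect (1354547515 / 10 ^ 10) t > 0"
  using positive_cert[OF cert_e1, of t] ev_elist[of "1354547515 / 10 ^ 10" 8645452485 t] by simp

definition loop_v :: "real \<Rightarrow> real" where "loop_v t = \<sigma> * (1 - t\<^sup>2) * t * loop_u t"
definition loop_v' :: "real \<Rightarrow> real" where "loop_v' t = \<sigma> * ((1 - 3 * t\<^sup>2) * loop_u t + (1 - t\<^sup>2) * t * loop_u' t)"

lemma loop_v_deriv: "(loop_v has_real_derivative loop_v' t) (at t)"
  unfolding loop_v_def[abs_def] loop_v'_def
  by (auto intro!: derivative_eq_intros loop_u_deriv simp: power2_eq_square algebra_simps)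

text \<open>Since \<open>w\<close> has \<open>t\<close>-derivative \<open>2 * \<sigma> * t\<close>,
  the quotient is the slope of the loop over \<open>w\<close>. Negative \<open>t\<close> belongs to
  the lower branch.\<close>

lemma curve_defect:
  assumes "t \<noteq> 0" and w: "w = 1 - \<sigma> * (1 - t\<^sup>2)"
  shows "loop_v t * (loop_v' t / (2 * \<sigma> * t)) + restoring w + damping d w * loop_v t = (1 - w) * t * loop_defect d t"
proof -
  have s0: "\<sigma> > 0" using \<sigma>_bounds by simp
  \<comment> \<open>This is the choice of \<sigma> under which \<open>(loop_u t)^2 / 2 + w\<close>
    has no constant term at \<open>t = 0\<close>, hence the factor \<open>t\<close> in
    \<open>key\<close>.\<close>
  have \<kappa>2: "\<kappa>\<^sup>2 = 2 * \<sigma> - 2" by (simp add: \<sigma>_def)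
  have key: "(1 - 3 * t\<^sup>2) * (loop_u t)\<^sup>2 / 2 + w = t * (loop_u1 t * (loop_u t + \<kappa>) / 2 - 3 / 2 * t * (loop_u t)\<^sup>2 + \<sigma> * t)"
  proof -
    have "(loop_u t)\<^sup>2 = \<kappa>\<^sup>2 + t * loop_u1 t * (loop_u t + \<kappa>)" by (simp add: loop_u_split power2_eq_square algebra_simps)
    then have "(loop_u t)\<^sup>2 / 2 = \<sigma> - 1 + t * loop_u1 t * (loop_u t + \<kappa>) / 2" unfolding \<kappa>2 by simp
    moreover have "(1 - 3 * t\<^sup>2) * (loop_u t)\<^sup>2 / 2 = (loop_u t)\<^sup>2 / 2 - 3 / 2 * (t\<^sup>2 * (loop_u t)\<^sup>2)" by (simp add: field_simps)
    moreover have "t * (loop_u1 t * (loop_u t + \<kappa>) / 2 - 3 / 2 * t * (loop_u t)\<^sup>2 + \<sigma> * t)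
       = t * loop_u1 t * (loop_u t + \<kappa>) / 2 - 3 / 2 * (t\<^sup>2 * (loop_u t)\<^sup>2) + \<sigma> * t\<^sup>2" by (simp add: power2_eq_square algebra_simps)
    moreover have "w = 1 - \<sigma> + \<sigma> * t\<^sup>2" by (simp add: w algebra_simps)
    ultimately show ?thesis by linarith
  qed
  have "loop_v t * (loop_v' t / (2 * \<sigma> * t)) = (1 - w) * ((1 - 3 * t\<^sup>2) * (loop_u t)\<^sup>2 / 2 + (1 - t\<^sup>2) * t * loop_u t * loop_u' t / 2)"
    unfolding loop_v_def loop_v'_def w using assms(1) s0 by (simp add: power2_eq_square field_simps)
  moreover have "damping d w * loop_v t = (1 - w) * (t * ((1 - d - \<sigma> * (1 - t\<^sup>2)) * loop_u t))"
    unfolding loop_v_def damping_def w by (simp add: algebra_simps)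
  moreover have "restoring w = (1 - w) * w" by (simp add: restoring_def)
  ultimately have "loop_v t * (loop_v' t / (2 * \<sigma> * t)) + restoring w + damping d w * loop_v t =
      (1 - w) * (((1 - 3 * t\<^sup>2) * (loop_u t)\<^sup>2 / 2 + w) + (1 - t\<^sup>2) * t * loop_u t * loop_u' t / 2 + t * ((1 - d - \<sigma> * (1 - t\<^sup>2)) * loop_u t))"
    by (simp add: distrib_left)
  also have "\<dots> = (1 - w) * t * loop_defect d t" unfolding key loop_defect_def by (simp add: algebra_simps)
  finally show ?thesis .
qed

definition loop_A :: real where "loop_A = \<sigma> - 1"
text \<open>The nonnegative parameter of the loop point over \<open>w\<close>; the lower branch is
  reached with \<open>- \<tau> w\<close>.\<close>

definition \<tau> :: "real \<Rightarrow> real" where "\<tau> w = sqrt ((w + loop_A) / \<sigma>)"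

lemma loop_A_bounds: "0 < loop_A" "loop_A < 11 / 20"
  using \<sigma>_bounds by (simp_all add: loop_A_def)

lemma \<tau>:
  assumes "- loop_A \<le> w" "w \<le> 1"
  shows "0 \<le> \<tau> w" "\<tau> w \<le> 1" "w = 1 - \<sigma> * (1 - (\<tau> w)\<^sup>2)" "- loop_A < w \<Longrightarrow> 0 < \<tau> w" "w < 1 \<Longrightarrow> \<tau> w < 1"
  using assms \<sigma>_bounds by (auto simp: \<tau>_def loop_A_def divide_simps real_sqrt_lt_1_iff)

lemma \<tau>_deriv:
  assumes "- loop_A < w"
  shows "(\<tau> has_real_derivative 1 / (2 * \<sigma> * \<tau> w)) (at w)"
proof -
  have "(w + loop_A) / \<sigma> > 0" using assms \<sigma>_bounds by simp
  then have "(\<tau> has_real_derivative (inverse (sqrt ((w + loop_A) / \<sigma>)) / 2) * (1 / \<sigma>)) (at w)"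
    unfolding \<tau>_def[abs_def] by (auto intro!: derivative_eq_intros)
  then show ?thesis by (simp add: \<tau>_def field_simps)
qed

definition \<Lambda>_up :: "real \<Rightarrow> real" where "\<Lambda>_up w = loop_v (\<tau> w)"
text \<open>The lower branch in reflected coordinates, the form in which lower half arcs
  appear.\<close>

definition \<Lambda>_lo :: "real \<Rightarrow> real" where "\<Lambda>_lo x = - loop_v (- \<tau> (- x))"

lemma cont_loop_u: "continuous_on S loop_u"
  by (rule DERIV_continuous_on, rule has_field_derivative_at_within, rule loop_u_deriv)
lemma cont_loop_u': "continuous_on S loop_u'"
proof -
  have "continuous_on S (ev as)" for as
    by (rule DERIV_continuous_on, rule has_field_derivative_at_within, rule ev_deriv)
  then show ?thesis unfolding loop_u'_def[abs_def] by (intro continuous_intros) auto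
qed
lemma cont_loop_v: "continuous_on S loop_v"
  by (rule DERIV_continuous_on, rule has_field_derivative_at_within, rule loop_v_deriv)
lemma cont_loop_v': "continuous_on S loop_v'"
  unfolding loop_v'_def[abs_def] by (intro continuous_intros cont_loop_u cont_loop_u')
lemma cont_\<tau>: "continuous_on S \<tau>"
  unfolding \<tau>_def[abs_def] using \<sigma>_bounds by (intro continuous_intros) auto

lemma \<Lambda>_up_cont: "continuous_on S \<Lambda>_up"
  unfolding \<Lambda>_up_def[abs_def] by (rule continuous_on_compose2[OF cont_loop_v cont_\<tau>]) auto
lemma \<Lambda>_lo_cont: "continuous_on S \<Lambda>_lo"
  unfolding \<Lambda>_lo_def[abs_def]
  by (intro continuous_intros continuous_on_compose2[OF cont_loop_v[of UNIV]] continuous_on_compose2[OF cont_\<tau>[of UNIV]]) auto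

lemma \<Lambda>_ends: "\<Lambda>_up (- loop_A) = 0" "\<Lambda>_up 1 = 0" "\<Lambda>_lo (- 1) = 0" "\<Lambda>_lo loop_A = 0"
  using \<sigma>_bounds by (auto simp: \<Lambda>_up_def \<Lambda>_lo_def loop_v_def \<tau>_def loop_A_def)

text \<open>The height is below \<open>31 / 20 * 8 / 5 = 2.48\<close>; the rounded bound 3 is the
  size of the box in which the field is later truncated.\<close>

lemma loop_v_bounds:
  assumes "0 \<le> t" "t \<le> 1"
  shows "loop_v t < 3" "- loop_v (- t) < 3" "0 < t \<Longrightarrow> t < 1 \<Longrightarrow> 0 < loop_v t" "0 < t \<Longrightarrow> t < 1 \<Longrightarrow> 0 < - loop_v (- t)"
proof -
  have loop_u: "0 < loop_u t" "loop_u t < 8 / 5" "0 < loop_u (- t)" "loop_u (- t) < 8 / 5" using loop_u_bounds[of t] loop_u_bounds[of "- t"] assms by auto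
  have s: "0 < \<sigma>" "\<sigma> < 31 / 20" using \<sigma>_bounds by auto
  have t2: "t\<^sup>2 \<le> 1" "0 \<le> t\<^sup>2" using assms by (auto simp: power_le_one)
  have k: "(1 - t\<^sup>2) * t \<le> 1 * 1" by (rule mult_mono) (use assms t2 in auto)
  have k0: "0 \<le> (1 - t\<^sup>2) * t" using assms t2 by simp
  have "\<sigma> * ((1 - t\<^sup>2) * t) \<le> 31 / 20 * 1" using k k0 s by (intro mult_mono) auto
  then have l: "\<sigma> * ((1 - t\<^sup>2) * t) * x < 3" if "0 < x" "x < 8 / 5" for x
    using mult_mono[of "\<sigma> * ((1 - t\<^sup>2) * t)" "31 / 20" x "8 / 5"] that k k0 s by auto
  show "loop_v t < 3" "- loop_v (- t) < 3" using l[OF loop_u(1,2)] l[OF loop_u(3,4)] by (simp_all add: loop_v_def mult.assoc)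
  assume "0 < t" "t < 1"
  then have "t\<^sup>2 < 1" by (simp add: power_less_one_iff abs_square_less_1)
  then have "\<sigma> * ((1 - t\<^sup>2) * t) > 0" using s \<open>0 < t\<close> by simp
  then have "\<sigma> * ((1 - t\<^sup>2) * t) * loop_u t > 0" "\<sigma> * ((1 - t\<^sup>2) * t) * loop_u (- t) > 0" using loop_u by simp_all
  then show "0 < loop_v t" "0 < - loop_v (- t)" by (simp_all add: loop_v_def mult.assoc)
qed

lemma \<Lambda>_up_bounds:
  assumes "- loop_A \<le> w" "w \<le> 1"
  shows "\<Lambda>_up w < 3" "- loop_A < w \<Longrightarrow> w < 1 \<Longrightarrow> 0 < \<Lambda>_up w"
  unfolding \<Lambda>_up_def using loop_v_bounds[OF \<tau>(1,2)[OF assms]] \<tau>(4,5)[OF assms] by auto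

lemma \<Lambda>_lo_bounds:
  assumes "- 1 \<le> x" "x \<le> loop_A"
  shows "\<Lambda>_lo x < 3" "- 1 < x \<Longrightarrow> x < loop_A \<Longrightarrow> 0 < \<Lambda>_lo x"
  unfolding \<Lambda>_lo_def using loop_v_bounds[OF \<tau>(1,2)[of "- x"]] \<tau>(4,5)[of "- x"] assms by auto

definition \<Lambda>_up' :: "real \<Rightarrow> real" where "\<Lambda>_up' w = loop_v' (\<tau> w) / (2 * \<sigma> * \<tau> w)"
definition \<Lambda>_lo' :: "real \<Rightarrow> real" where "\<Lambda>_lo' x = loop_v' (- \<tau> (- x)) / (2 * \<sigma> * (- \<tau> (- x)))"

lemma \<Lambda>_up_deriv:
  assumes "- loop_A < w" "w < 1"
  shows "(\<Lambda>_up has_real_derivative \<Lambda>_up' w) (at w)"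
    "\<Lambda>_up w * \<Lambda>_up' w + restoring w + damping d w * \<Lambda>_up w = (1 - w) * \<tau> w * loop_defect d (\<tau> w)"
proof -
  have "((\<lambda>w. loop_v (\<tau> w)) has_real_derivative loop_v' (\<tau> w) * (1 / (2 * \<sigma> * \<tau> w))) (at w)"
    by (rule DERIV_chain2[where f = loop_v and g = \<tau>, OF loop_v_deriv \<tau>_deriv[OF assms(1)]])
  then show "(\<Lambda>_up has_real_derivative \<Lambda>_up' w) (at w)" by (simp add: \<Lambda>_up_def[abs_def] \<Lambda>_up'_def)
  show "\<Lambda>_up w * \<Lambda>_up' w + restoring w + damping d w * \<Lambda>_up w = (1 - w) * \<tau> w * loop_defect d (\<tau> w)"
    unfolding \<Lambda>_up_def \<Lambda>_up'_def using \<tau>[of w] assms by (intro curve_defect) auto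
qed

lemma \<Lambda>_lo_deriv:
  assumes "- 1 < x" "x < loop_A"
  shows "(\<Lambda>_lo has_real_derivative \<Lambda>_lo' x) (at x)"
    "\<Lambda>_lo x * \<Lambda>_lo' x + (- restoring (- x)) + damping d (- x) * \<Lambda>_lo x = (1 + x) * \<tau> (- x) * loop_defect d (- \<tau> (- x))"
proof -
  have neg: "- p * k + - q + r * - p = (1 + y) * t * z" if "p * k + q + r * p = (1 - - y) * - t * z" for p k q r y t z :: real
    using that by (simp add: algebra_simps)
  have t: "\<tau> (- x) > 0" "- x = 1 - \<sigma> * (1 - (\<tau> (- x))\<^sup>2)" using \<tau>[of "- x"] assms by auto
  have "((\<lambda>x. - \<tau> (- x)) has_real_derivative 1 / (2 * \<sigma> * \<tau> (- x))) (at x)"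
    using DERIV_minus[OF DERIV_chain2[where f = \<tau> and g = uminus, OF \<tau>_deriv[of "- x"] DERIV_minus[OF DERIV_ident]]] assms by simp
  from DERIV_minus[OF DERIV_chain2[where f = loop_v and g = "\<lambda>x. - \<tau> (- x)", OF loop_v_deriv this]]
  show "(\<Lambda>_lo has_real_derivative \<Lambda>_lo' x) (at x)"
    using t by (simp add: \<Lambda>_lo_def[abs_def] \<Lambda>_lo'_def)
  have "loop_v (- \<tau> (- x)) * (loop_v' (- \<tau> (- x)) / (2 * \<sigma> * - \<tau> (- x))) + restoring (- x) + damping d (- x) * loop_v (- \<tau> (- x))
    = (1 - - x) * - \<tau> (- x) * loop_defect d (- \<tau> (- x))"
    by (rule curve_defect) (use t in auto)
  then show "\<Lambda>_lo x * \<Lambda>_lo' x + (- restoring (- x)) + damping d (- x) * \<Lambda>_lo x = (1 + x) * \<tau> (- x) * loop_defect d (- \<tau> (- x))"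
    unfolding \<Lambda>_lo_def \<Lambda>_lo'_def by (rule neg)
qed

section \<open>Periodic solutions of the Bogdanov--Takens system\<close>

lemma solution_shift:
  fixes f g w v :: "real \<Rightarrow> real"
  shows "solution f g w v \<Longrightarrow> solution f g (\<lambda>t. w (t + s)) (\<lambda>t. v (t + s))"
  unfolding solution_def using DERIV_shift by blast

lemma vector_field_lipschitz:
  assumes d: "0 < d" "d < 1" and M: "\<bar>w1\<bar> \<le> M" "\<bar>w2\<bar> \<le> M" "\<bar>v1\<bar> \<le> M" "\<bar>v2\<bar> \<le> M"
  shows "norm ((v1, - restoring w1 - damping d w1 * v1) - (v2, - restoring w2 - damping d w2 * v2)) \<le> (3 + 4 * M) * norm ((w1, v1) - (w2, v2))"
proof -
  let ?n = "norm ((w1, v1) - (w2, v2))"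
  have n: "\<bar>w1 - w2\<bar> \<le> ?n" "\<bar>v1 - v2\<bar> \<le> ?n"
    using norm_fst_le[of "w1 - w2" "v1 - v2"] norm_snd_le[of "v1 - v2" "w1 - w2"] by simp_all
  have "(- restoring w1 - damping d w1 * v1) - (- restoring w2 - damping d w2 * v2)
     = (w1 - w2) * (w1 + w2 - 1) - (w1 - d) * (v1 - v2) - (w1 - w2) * v2"
    by (simp add: restoring_def damping_def algebra_simps)
  also have "\<bar>\<dots>\<bar> \<le> \<bar>w1 - w2\<bar> * \<bar>w1 + w2 - 1\<bar> + \<bar>w1 - d\<bar> * \<bar>v1 - v2\<bar> + \<bar>w1 - w2\<bar> * \<bar>v2\<bar>"
    by (simp flip: abs_mult)
  also have "\<dots> \<le> ?n * (2 * M + 1) + (M + 1) * ?n + ?n * M"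
    using n M d by (intro add_mono mult_mono) auto
  finally have "\<bar>(- restoring w1 - damping d w1 * v1) - (- restoring w2 - damping d w2 * v2)\<bar> \<le> ?n * (2 * M + 1) + (M + 1) * ?n + ?n * M" .
  moreover have "norm ((v1, - restoring w1 - damping d w1 * v1) - (v2, - restoring w2 - damping d w2 * v2))
     \<le> \<bar>v1 - v2\<bar> + \<bar>(- restoring w1 - damping d w1 * v1) - (- restoring w2 - damping d w2 * v2)\<bar>"
    using norm_Pair_le[of "v1 - v2" "(- restoring w1 - damping d w1 * v1) - (- restoring w2 - damping d w2 * v2)"] by simp
  ultimately show ?thesis using n by (simp add: algebra_simps)
qed

lemma has_vector_derivative_pair:
  assumes "(w has_real_derivative w') (at t within S)" "(v has_real_derivative v') (at t within S)"
  shows "((\<lambda>t. (w t, v t)) has_vector_derivative (w', v')) (at t within S)"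
  using has_derivative_Pair[OF assms[unfolded has_field_derivative_def]]
  unfolding has_vector_derivative_def by (simp add: mult.commute)

text \<open>The field is quadratic and only locally Lipschitz; the common bound \<open>M\<close>
  supplies the Lipschitz constant, and periodic solutions always have such a bound.\<close>

lemma solution_unique:
  assumes d: "0 < d" "d < 1" and s1: "solution (damping d) restoring w1 v1" and s2: "solution (damping d) restoring w2 v2"
    and M: "\<And>t. \<bar>w1 t\<bar> \<le> M \<and> \<bar>v1 t\<bar> \<le> M \<and> \<bar>w2 t\<bar> \<le> M \<and> \<bar>v2 t\<bar> \<le> M"
    and eq: "w1 t0 = w2 t0" "v1 t0 = v2 t0"
  shows "w1 t = w2 t \<and> v1 t = v2 t"
proof -
  have "(w1 t, v1 t) = (w2 t, v2 t)"
    by (rule ode_unique[OF has_vector_derivative_pair[OF solutionD(1,2)[OF s1]] has_vector_derivative_pair[OF solutionD(1,2)[OF s2]]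
        vector_field_lipschitz[OF d, of _ M], of t0]) (use M eq in auto)
  then show ?thesis by simp
qed

lemma periodic_int:
  fixes w :: "real \<Rightarrow> 'a"
  assumes "\<And>t. w (t + T) = w t"
  shows "w (t + real_of_int n * T) = w t"
proof -
  have nat: "w (t + real m * T) = w t" for m t
  proof (induction m)
    case (Suc m)
    have "w (t + real (Suc m) * T) = w ((t + real m * T) + T)" by (simp add: algebra_simps)
    then show ?case using assms Suc by simp
  qed simp
  show ?thesis
  proof (cases "n \<ge> 0")
    case True
    then show ?thesis using nat[of t "nat n"] by simp
  next
    case False
    have "w ((t + real_of_int n * T) + real (nat (- n)) * T) = w (t + real_of_int n * T)" by (rule nat)
    then show ?thesis using False by simp
  qed
qed

lemma periodic_reduce:
  fixes w :: "real \<Rightarrow> 'a"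
  assumes T: "T > 0" and per: "\<And>t. w (t + T) = w t"
  obtains s where "0 \<le> s" "s \<le> T" "w t = w s"
proof (rule that)
  let ?n = "\<lfloor>t / T\<rfloor>"
  have "real_of_int ?n \<le> t / T" "t / T \<le> real_of_int ?n + 1" by linarith+
  then have "real_of_int ?n * T \<le> t" "t \<le> (real_of_int ?n + 1) * T"
    using T by (simp_all only: pos_le_divide_eq pos_divide_le_eq)
  then show "0 \<le> t + real_of_int (- ?n) * T" "t + real_of_int (- ?n) * T \<le> T" by (auto simp: algebra_simps)
  show "w t = w (t + real_of_int (- ?n) * T)" by (rule periodic_int[where w = w and T = T, OF per, symmetric])
qed

lemma periodic_attains_max:
  fixes w :: "real \<Rightarrow> real"
  assumes T: "T > 0" and per: "\<And>t. w (t + T) = w t" and c: "continuous_on UNIV w"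
  obtains tM where "\<forall>t. w t \<le> w tM"
proof -
  have "\<exists>x\<in>{0..T}. \<forall>y\<in>{0..T}. w y \<le> w x"
    by (rule continuous_attains_sup) (use T in \<open>auto intro: continuous_on_subset[OF c]\<close>)
  then obtain tM where tM: "\<And>t. t \<in> {0..T} \<Longrightarrow> w t \<le> w tM" by blast
  show ?thesis
  proof (rule that[of tM], rule allI)
    fix t
    obtain s where "0 \<le> s" "s \<le> T" "w t = w s" by (rule periodic_reduce[where w = w and T = T, OF T per])
    then show "w t \<le> w tM" using tM[of s] by simp
  qed
qed

lemma periodic_bounded:
  fixes w :: "real \<Rightarrow> real"
  assumes T: "T > 0" and per: "\<And>t. w (t + T) = w t" and c: "continuous_on UNIV w"
  obtains M where "\<forall>t. \<bar>w t\<bar> \<le> M"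
proof -
  obtain tM where tM: "\<forall>t. \<bar>w t\<bar> \<le> \<bar>w tM\<bar>"
  proof (rule periodic_attains_max[OF T, of "\<lambda>t. \<bar>w t\<bar>"])
    show "continuous_on UNIV (\<lambda>t. \<bar>w t\<bar>)" by (rule continuous_on_rabs[OF c])
  qed (simp_all add: per)
  show ?thesis by (rule that[OF tM])
qed

definition periodic_solution :: "real \<Rightarrow> (real \<Rightarrow> real) \<Rightarrow> (real \<Rightarrow> real) \<Rightarrow> bool" where
  "periodic_solution d w v \<longleftrightarrow> solution (damping d) restoring w v \<and>
     (\<exists>T>0. (\<forall>t. w (t + T) = w t) \<and> (\<forall>t. v (t + T) = v t)) \<and> (\<exists>t t'. (w t, v t) \<noteq> (w t', v t'))"

lemma periodic_solution_bounded:
  assumes "periodic_solution d w v"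
  obtains M where "\<forall>t. \<bar>w t\<bar> \<le> M \<and> \<bar>v t\<bar> \<le> M"
proof -
  from assms obtain T where sol: "solution (damping d) restoring w v" and T: "T > 0" "\<And>t. w (t + T) = w t" "\<And>t. v (t + T) = v t"
    by (auto simp: periodic_solution_def)
  obtain M1 where M1: "\<forall>t. \<bar>w t\<bar> \<le> M1" by (rule periodic_bounded[OF T(1,2) solutionD(3)[OF sol]])
  obtain M2 where M2: "\<forall>t. \<bar>v t\<bar> \<le> M2" by (rule periodic_bounded[OF T(1,3) solutionD(4)[OF sol]])
  show ?thesis by (rule that[of "max M1 M2"]) (use M1 M2 in \<open>auto simp: le_max_iff_disj\<close>)
qed

lemma periodic_solution_eq:
  assumes d: "0 < d" "d < 1" and p1: "periodic_solution d w1 v1" and p2: "periodic_solution d w2 v2"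
    and eq: "w1 t1 = w2 t2" "v1 t1 = v2 t2"
  shows "range (\<lambda>t. (w1 t, v1 t)) = range (\<lambda>t. (w2 t, v2 t))"
proof -
  obtain M1 where M1: "\<forall>t. \<bar>w1 t\<bar> \<le> M1 \<and> \<bar>v1 t\<bar> \<le> M1" by (rule periodic_solution_bounded[OF p1])
  obtain M2 where M2: "\<forall>t. \<bar>w2 t\<bar> \<le> M2 \<and> \<bar>v2 t\<bar> \<le> M2" by (rule periodic_solution_bounded[OF p2])
  have s: "solution (damping d) restoring w1 v1" "solution (damping d) restoring w2 v2" using p1 p2 by (auto simp: periodic_solution_def)
  have shift: "w1 (t + (t1 - t2)) = w2 t \<and> v1 (t + (t1 - t2)) = v2 t" for t
    by (rule solution_unique[OF d solution_shift[OF s(1)] s(2), of _ "max M1 M2" t2])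
       (use M1 M2 eq in \<open>auto simp: le_max_iff_disj\<close>)
  have "(w2 t, v2 t) \<in> range (\<lambda>t. (w1 t, v1 t))" for t
    by (rule range_eqI[of _ _ "t + (t1 - t2)"]) (use shift[of t] in simp)
  moreover have "(w1 t, v1 t) \<in> range (\<lambda>t. (w2 t, v2 t))" for t
    by (rule range_eqI[of _ _ "t - (t1 - t2)"]) (use shift[of "t - (t1 - t2)"] in simp)
  ultimately show ?thesis by blast
qed

lemma periodic_solution_no_equilibrium:
  assumes d: "0 < d" "d < 1" and p: "periodic_solution d w v" and v0: "v t0 = 0"
  shows "restoring (w t0) \<noteq> 0"
proof
  assume g0: "restoring (w t0) = 0"
  obtain M where M: "\<forall>t. \<bar>w t\<bar> \<le> M \<and> \<bar>v t\<bar> \<le> M" by (rule periodic_solution_bounded[OF p])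
  have s: "solution (damping d) restoring w v" using p by (auto simp: periodic_solution_def)
  have c: "solution (damping d) restoring (\<lambda>_. w t0) (\<lambda>_. 0)" using g0 by (simp add: solution_def)
  have const: "w t = w t0 \<and> v t = 0" for t
    by (rule solution_unique[OF d s c, of M t0]) (use M[rule_format, of t0] M v0 in auto)
  obtain t t' where "(w t, v t) \<noteq> (w t', v t')" using p unfolding periodic_solution_def by blast
  then show False using const[of t] const[of t'] by simp
qed

lemma g_sign: "x < 1 \<Longrightarrow> (x < 0 \<longrightarrow> restoring x < 0) \<and> (0 < x \<longrightarrow> 0 < restoring x)"
  by (auto simp: restoring_def mult_neg_pos)

text \<open>At the maximum of \<open>w\<close> the force \<open>restoring\<close> is positive, and
  it is positive only on (0, 1). Hence every periodic orbit stays to the left of the saddle, and its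
  minimum of \<open>w\<close> lies left of the focus.\<close>

lemma periodic_solution_arcs:
  assumes d: "0 < d" "d < 1" and p: "periodic_solution d w v"
  obtains A1 B1 p p' where "half_arc (damping d) restoring (- A1) B1 p" "half_arc (\<lambda>x. damping d (- x)) (\<lambda>x. - restoring (- x)) (- B1) A1 p'"
    "B1 < 1" "\<forall>t. - A1 \<le> w t \<and> w t \<le> B1"
    "\<forall>x\<in>{- A1..B1}. \<exists>t. w t = x \<and> v t = p x"
    "\<forall>x\<in>{- A1..B1}. \<exists>t. w t = x \<and> v t = - p' (- x)"
    "\<exists>t. w t = - A1 \<and> v t = 0"
proof -
  from p obtain T where sol: "solution (damping d) restoring w v" and T: "T > 0" "\<And>t. w (t + T) = w t" "\<And>t. v (t + T) = v t"
    by (auto simp: periodic_solution_def)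
  note neq = periodic_solution_no_equilibrium[OF d p]
  obtain tM where "\<forall>t. w t \<le> w tM" by (rule periodic_attains_max[OF T(1,2) solutionD(3)[OF sol]])
  then have mx: "w t \<le> w tM" for t by blast
  have per': "- w (t + T) = - w t" for t using T(2) by simp
  obtain tm where "\<forall>t. - w t \<le> - w tm"
    by (rule periodic_attains_max[where w = "\<lambda>t. - w t", OF T(1) per' continuous_on_minus[OF solutionD(3)[OF sol]]])
  then have mn': "- w t \<le> - w tm" for t by blast
  have mn: "w tm \<le> w t" for t using mn'[of t] by simp
  have "restoring (w tM) > 0" by (rule max_restoring[OF sol mx neq])
  then have M: "0 < w tM" "w tM < 1"
    by (auto simp: restoring_def zero_less_mult_iff)
  have m: "v tm = 0" "restoring (w tm) < 0" using min_restoring[OF sol mn neq] by auto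
  then have "w tm < 0" using mx[of tm] M by (auto simp: restoring_def mult_less_0_iff)
  have sgn: "(x < 0 \<longrightarrow> restoring x < 0) \<and> (0 < x \<longrightarrow> 0 < restoring x)" if "x \<le> w tM" for x using g_sign[of x] that M by simp
  have g0: "restoring 0 = 0" by (simp add: restoring_def)
  obtain \<phi> where up: "half_arc (damping d) restoring (w tm) (w tM) \<phi>" "\<forall>x\<in>{w tm..w tM}. \<exists>t. w t = x \<and> v t = \<phi> x"
    by (rule periodic_half_arc[OF sol cont_restoring g0 sgn mn mx neq T(1,3)])
  have cg': "continuous_on UNIV (\<lambda>x. - restoring (- x))" unfolding restoring_def by (intro continuous_intros)
  have g0': "- restoring (- 0) = 0" using g0 by simp
  have sgn': "(x < 0 \<longrightarrow> - restoring (- x) < 0) \<and> (0 < x \<longrightarrow> 0 < - restoring (- x))" if "- w tM \<le> x" for x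
    using sgn[of "- x"] that by auto
  have neq': "- restoring (- (- w t)) \<noteq> 0" if "- v t = 0" for t using neq[of t] that by simp
  have per'': "- v (t + T) = - v t" for t using T(3) by simp
  obtain \<psi> where lo: "half_arc (\<lambda>x. damping d (- x)) (\<lambda>x. - restoring (- x)) (- w tM) (- w tm) \<psi>"
    "\<forall>x\<in>{- w tM..- w tm}. \<exists>t. - w t = x \<and> - v t = \<psi> x"
    by (rule periodic_half_arc[OF solution_reflect[OF sol] cg' g0' sgn' le_imp_neg_le[OF mx] mn' neq' T(1) per''])
  show ?thesis
  proof (rule that[of "- w tm" "w tM" \<phi> \<psi>])
    show "\<forall>x\<in>{- (- w tm)..w tM}. \<exists>t. w t = x \<and> v t = \<phi> x" using up(2) by simp
    show "\<forall>x\<in>{- (- w tm)..w tM}. \<exists>t. w t = x \<and> v t = - \<psi> (- x)"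
    proof
      fix x assume "x \<in> {- (- w tm)..w tM}"
      then have "- x \<in> {- w tM..- w tm}" by simp
      then obtain t where "- w t = - x" "- v t = \<psi> (- x)" using lo(2) by blast
      then show "\<exists>t. w t = x \<and> v t = - \<psi> (- x)" by (intro exI[of _ t]) auto
    qed
  qed (use up lo M mx mn m in auto)
qed

text \<open>Every zero of \<psi> is crossed upwards, so nonnegative values cannot be lost. A zero at
  \<open>t1\<close> would need negative values just before it.\<close>

lemma crossing_up:
  fixes \<psi> :: "real \<Rightarrow> real"
  assumes t: "t0 < t1" and d: "\<And>t. t0 \<le> t \<Longrightarrow> t \<le> t1 \<Longrightarrow> (\<psi> has_real_derivative \<psi>' t) (at t within {t0..t1})"
    and up: "\<And>t. t0 \<le> t \<Longrightarrow> t \<le> t1 \<Longrightarrow> \<psi> t = 0 \<Longrightarrow> \<psi>' t > 0" and start: "\<psi> t0 \<ge> 0"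
  shows "\<psi> t1 > 0"
proof -
  have c: "continuous_on {t0..t1} \<psi>" by (rule DERIV_continuous_on) (use d in auto)
  have nonneg: "\<psi> s \<ge> 0" if s: "t0 \<le> s" "s \<le> t1" for s
  proof (rule ccontr)
    assume n: "\<not> \<psi> s \<ge> 0"
    define S where "S = {t0..s} \<inter> \<psi> -` {0..}"
    have cs: "continuous_on {x..s} \<psi>" if "t0 \<le> x" for x by (rule continuous_on_subset[OF c]) (use s that in auto)
    have "closed S" unfolding S_def by (rule continuous_closed_preimage[OF cs]) auto
    moreover have "t0 \<in> S" using start s by (auto simp: S_def)
    moreover have bS: "bdd_above S" by (auto simp: S_def bdd_above_def)
    ultimately have "Sup S \<in> S" by (intro closed_contains_Sup) auto
    define r where "r = Sup S"
    have r: "t0 \<le> r" "r \<le> s" "\<psi> r \<ge> 0" using \<open>Sup S \<in> S\<close> by (auto simp: S_def r_def)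
    have "r < s" using r n by (cases "r = s") auto
    have above: "\<psi> x < 0" if "r < x" "x \<le> s" for x
    proof (rule ccontr)
      assume "\<not> \<psi> x < 0"
      then have "x \<in> S" using that r by (auto simp: S_def)
      then have "x \<le> r" unfolding r_def by (rule cSup_upper[OF _ bS])
      then show False using that by simp
    qed
    have "\<psi> r = 0"
    proof (rule ccontr)
      assume nz: "\<psi> r \<noteq> 0"
      then obtain x where "r \<le> x" "x \<le> s" "\<psi> x = 0"
        using IVT2'[of \<psi> s 0 r] r n \<open>r < s\<close> cs[of r] by auto
      then show False using above[of x] nz by (cases "x = r") auto
    qed
    then have "\<psi>' r > 0" using up[of r] r s by auto
    from has_real_derivative_pos_inc_right[OF d this] r s
    obtain e where e: "e > 0" "\<And>h. 0 < h \<Longrightarrow> r + h \<in> {t0..t1} \<Longrightarrow> h < e \<Longrightarrow> \<psi> r < \<psi> (r + h)" by auto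
    define h where "h = min (e / 2) (s - r)"
    have "0 < h" "h < e" "r + h \<le> s" using e \<open>r < s\<close> by (auto simp: h_def min_def)
    then show False using e(2)[of h] above[of "r + h"] \<open>\<psi> r = 0\<close> r s by auto
  qed
  show ?thesis
  proof (rule ccontr)
    assume "\<not> \<psi> t1 > 0"
    then have z: "\<psi> t1 = 0" using nonneg[of t1] t by simp
    then have "\<psi>' t1 > 0" using up[of t1] t by simp
    from has_real_derivative_pos_inc_left[OF d this] t
    obtain e where e: "e > 0" "\<And>h. 0 < h \<Longrightarrow> t1 - h \<in> {t0..t1} \<Longrightarrow> h < e \<Longrightarrow> \<psi> (t1 - h) < \<psi> t1" by auto
    define h where "h = min (e / 2) (t1 - t0)"
    have "0 < h" "h < e" "t0 \<le> t1 - h" using e t by (auto simp: h_def min_def)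
    then show False using e(2)[of h] nonneg[of "t1 - h"] z by auto
  qed
qed

section \<open>Sign of the Dulac function along solutions\<close>

context dulac
begin

lemma \<Psi>_along:
  assumes "(w has_real_derivative v t) (at t within S)" "(v has_real_derivative - g (w t) - f (w t) * v t) (at t within S)"
  shows "((\<lambda>t. \<Psi> (w t) (v t)) has_real_derivative h (w t) - f (w t) * \<Psi> (w t) (v t) / 2) (at t within S)"
proof -
  have "(2 * v t + b (w t)) * (- g (w t) - f (w t) * v t) + (3 / 2 * f (w t) * v t + 2 * g (w t) + f (w t) * b (w t) / 2) * v t
     = h (w t) - f (w t) * \<Psi> (w t) (v t) / 2"
    by (simp add: \<Psi>_def h_eq power2_eq_square field_simps)
  with \<Psi>_deriv[OF assms] show ?thesis by (simp only:)
qed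

text \<open>On the curve \<Psi> = 0 the derivative along the flow is \<open>h > 0\<close>, so the
  region \<Psi> \<ge> 0 is forward invariant.\<close>

lemma \<Psi>_forward:
  assumes t: "t0 < t1"
    and dw: "\<And>t. t0 \<le> t \<Longrightarrow> t \<le> t1 \<Longrightarrow> (w has_real_derivative v t) (at t within {t0..t1})"
    and dv: "\<And>t. t0 \<le> t \<Longrightarrow> t \<le> t1 \<Longrightarrow> (v has_real_derivative - g (w t) - f (w t) * v t) (at t within {t0..t1})"
    and h: "\<And>t. t0 \<le> t \<Longrightarrow> t \<le> t1 \<Longrightarrow> h (w t) > 0" and start: "\<Psi> (w t0) (v t0) \<ge> 0"
  shows "\<Psi> (w t1) (v t1) > 0"
proof (rule crossing_up[OF t, where \<psi> = "\<lambda>t. \<Psi> (w t) (v t)"])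
  fix t assume t: "t0 \<le> t" "t \<le> t1"
  show "((\<lambda>t. \<Psi> (w t) (v t)) has_real_derivative h (w t) - f (w t) * \<Psi> (w t) (v t) / 2) (at t within {t0..t1})"
    by (rule \<Psi>_along[OF dw[OF t] dv[OF t]])
  show "h (w t) - f (w t) * \<Psi> (w t) (v t) / 2 > 0" if "\<Psi> (w t) (v t) = 0" using h[OF t] that by simp
qed (rule start)

text \<open>Any time can be shifted past \<open>s\<close> by whole periods, so forward invariance
  becomes a dichotomy: a periodic orbit lies entirely in \<Psi> > 0 or entirely in \<Psi> <
  0.\<close>

lemma \<Psi>_periodic_sign:
  assumes sol: "solution f g w v" and T: "T > 0" "\<And>t. w (t + T) = w t" "\<And>t. v (t + T) = v t"
    and h: "\<And>t. h (w t) > 0" and s: "\<Psi> (w s) (v s) \<ge> 0"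
  shows "\<Psi> (w t) (v t) > 0"
proof -
  obtain n :: nat where n: "real n > (s - t) / T" using reals_Archimedean2 by blast
  then have lt: "s < t + real_of_int (int n) * T" using T(1) by (simp add: field_simps)
  have "\<Psi> (w (t + real_of_int (int n) * T)) (v (t + real_of_int (int n) * T)) > 0"
    by (rule \<Psi>_forward[OF lt]) (use solutionD[OF sol] h s in \<open>auto intro: has_field_derivative_at_within\<close>)
  then show ?thesis using periodic_int[of w T t "int n"] periodic_int[of v T t "int n"] T by simp
qed

end

text \<open>An arc that once touches the barrier stays on or above it while \<open>w\<close>
  increases; yet it ends at \<open>r < R\<close> with height 0, below \<Lambda>. So an arc ending
  inside the loop never touches it.\<close>

lemma arc_below_outward_barrier:
  fixes f g \<Lambda> :: "real \<Rightarrow> real"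
  assumes arc: "half_arc f g l r p" and LR: "L < 0" "r < R"
    and gneg: "\<And>w. L < w \<Longrightarrow> w < 0 \<Longrightarrow> g w < 0"
    and c\<Lambda>: "continuous_on {L..R} \<Lambda>" and \<Lambda>L: "\<Lambda> L = 0" and \<Lambda>pos: "\<And>w. L < w \<Longrightarrow> w < R \<Longrightarrow> \<Lambda> w > 0"
    and d\<Lambda>: "\<And>w. L < w \<Longrightarrow> w < R \<Longrightarrow> (\<Lambda> has_real_derivative \<Lambda>' w) (at w)"
    and out: "\<And>w. L < w \<Longrightarrow> w < R \<Longrightarrow> \<Lambda> w * \<Lambda>' w + g w + f w * \<Lambda> w < 0"
  shows "L < l" "\<And>w. l \<le> w \<Longrightarrow> w \<le> r \<Longrightarrow> p w < \<Lambda> w"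
proof -
  note d = half_arcD[OF arc]
  let ?\<delta> = "\<lambda>w. p w - \<Lambda> w"
  let ?\<delta>' = "\<lambda>w. - g w / p w - f w - \<Lambda>' w"
  have d\<delta>: "(?\<delta> has_real_derivative ?\<delta>' w) (at w)" "?\<delta>' w > g w * ?\<delta> w / (p w * \<Lambda> w)" if H: "L < w" "l < w" "w < r" for w
  proof -
    show "(?\<delta> has_real_derivative ?\<delta>' w) (at w)"
      using H LR by (intro derivative_intros d(9) d\<Lambda>) auto
    have q: "p w > 0" "\<Lambda> w > 0" using d(8)[of w] \<Lambda>pos[of w] H LR by auto
    have "?\<delta>' w - g w * ?\<delta> w / (p w * \<Lambda> w) = - (\<Lambda> w * \<Lambda>' w + g w + f w * \<Lambda> w) / \<Lambda> w"
      using q by (simp add: field_simps)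
    moreover have "- (\<Lambda> w * \<Lambda>' w + g w + f w * \<Lambda> w) / \<Lambda> w > 0" using out[of w] q H LR by (intro divide_pos_pos) auto
    ultimately show "?\<delta>' w > g w * ?\<delta> w / (p w * \<Lambda> w)" by linarith
  qed
  have c\<delta>: "continuous_on {x..y} ?\<delta>" if "l \<le> x" "L \<le> x" "y \<le> r" for x y
    by (intro continuous_intros continuous_on_subset[OF d(5)] continuous_on_subset[OF c\<Lambda>]) (use that LR in auto)
  have \<Lambda>r: "\<Lambda> r > 0" using \<Lambda>pos[of r] LR d(2) by auto
  have inner: "?\<delta> w < 0" if H: "L < w" "l < w" "w < r" for w
  proof (rule ccontr)
    assume n: "\<not> ?\<delta> w < 0"
    have "?\<delta> x > 0" if x: "w < x" "x < r" for x
    proof (rule crossing_up[where \<psi> = ?\<delta> and \<psi>' = ?\<delta>', OF x(1)])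
      fix t assume t: "w \<le> t" "t \<le> x"
      show "(?\<delta> has_real_derivative ?\<delta>' t) (at t within {w..x})"
        by (rule has_field_derivative_at_within, rule d\<delta>) (use t H x in auto)
      show "?\<delta>' t > 0" if "?\<delta> t = 0" using d\<delta>(2)[of t] that t H x by auto
    next
      show "?\<delta> w \<ge> 0" using n by simp
    qed
    then have pos: "?\<delta> x \<ge> 0" if "x \<in> {w<..<r}" for x using that by (simp add: less_imp_le)
    have "continuous_on {w..r} ?\<delta>" by (rule c\<delta>) (use H in auto)
    from continuous_ge_on_Ioo[OF this pos H(3), of r] have "?\<delta> r \<ge> 0" using H by simp
    then show False using \<Lambda>r d(7) by simp
  qed
  show Ll: "L < l"
  proof (rule ccontr)
    assume n: "\<not> L < l"
    \<comment> \<open>An arc reaching back to \<open>L\<close> would start with a nonnegative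
      difference to \<Lambda>. The difference is negative further on, but for \<open>w < 0\<close> a
      negative difference increases.\<close>
    have "?\<delta> L < ?\<delta> (L / 2)"
    proof (rule DERIV_pos_imp_increasing_open[where f = ?\<delta>])
      fix x assume x: "L < x" "x < L / 2"
      then have H: "L < x" "l < x" "x < r" using n LR d(2) by linarith+
      have "g x * ?\<delta> x / (p x * \<Lambda> x) > 0"
        using gneg[of x] inner[OF H] d(8)[of x] \<Lambda>pos[of x] H x LR by (intro divide_pos_pos mult_neg_neg mult_pos_pos) auto
      then have "?\<delta>' x > 0" using d\<delta>(2)[OF H] by linarith
      then show "\<exists>y. (?\<delta> has_real_derivative y) (at x) \<and> 0 < y" using d\<delta>(1)[OF H] by blast
    next
      show "L < L / 2" using LR by simp
      show "continuous_on {L..L / 2} ?\<delta>" by (rule c\<delta>) (use n LR d(2) in linarith)+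
    qed
    moreover have "?\<delta> (L / 2) < 0" by (rule inner) (use n LR d(2) in linarith)+
    moreover have "p L \<ge> 0" by (rule d(10)) (use n LR d(2) in linarith)+
    moreover have "?\<delta> L = p L" using \<Lambda>L by simp
    ultimately show False by linarith
  qed
  fix w assume w: "l \<le> w" "w \<le> r"
  show "p w < \<Lambda> w"
  proof (cases "w = l")
    case True
    have "\<Lambda> l > 0" by (rule \<Lambda>pos) (use Ll d(1,2) LR in linarith)+
    then show ?thesis using True d(6) by simp
  next
    case l: False
    show ?thesis
    proof (cases "w = r")
      case True
      then show ?thesis using d(7) \<Lambda>r by simp
    next
      case False
      then have "?\<delta> w < 0" by (intro inner) (use w l Ll in linarith)+
      then show ?thesis by simp
    qed
  qed
qed

text \<open>The orbit turns before the saddle, so the outward loop surrounds it. Then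
  \<open>h > 0\<close> along the orbit fixes the sign of \<Psi>, and each sign is excluded by its
  own flux argument.\<close>

theorem no_periodic_solution:
  fixes d :: real
  defines "d \<equiv> 1354547529 / 10 ^ 10"
  shows "\<not> periodic_solution d w v"
proof
  assume p: "periodic_solution d w v"
  have d: "0 < d" "d < 1" by (simp_all add: d_def)
  interpret dulac "damping d" restoring "dulac_a d" "dulac_b d" "dulac_h d" by (rule dulac_BT)
  have dN: "d = real_of_int 1354547529 / 10 ^ 10" by (simp add: d_def)
  note cert = dulac_cert_facts[OF cert_d0 dN]
  have defect: "loop_defect d t < 0" if "\<bar>t\<bar> \<le> 1" for t using loop_defect_neg[OF that] by (simp add: d_def)
  obtain A1 B1 p p' where arcs: "half_arc (damping d) restoring (- A1) B1 p" "half_arc (\<lambda>x. damping d (- x)) (\<lambda>x. - restoring (- x)) (- B1) A1 p'"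
    "B1 < 1" "\<forall>t. - A1 \<le> w t \<and> w t \<le> B1"
    "\<forall>x\<in>{- A1..B1}. \<exists>t. w t = x \<and> v t = p x"
    "\<forall>x\<in>{- A1..B1}. \<exists>t. w t = x \<and> v t = - p' (- x)" "\<exists>t. w t = - A1 \<and> v t = 0"
    by (rule periodic_solution_arcs[OF d p])
  have up': "\<Lambda>_up w * \<Lambda>_up' w + restoring w + damping d w * \<Lambda>_up w < 0" if H: "- loop_A < w" "w < 1" for w
    unfolding \<Lambda>_up_deriv(2)[OF H] using defect[of "\<tau> w"] \<tau>[of w] H by (intro mult_pos_neg) auto
  have lo': "\<Lambda>_lo w * \<Lambda>_lo' w + (- restoring (- w)) + damping d (- w) * \<Lambda>_lo w < 0" if H: "- 1 < w" "w < loop_A" for w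
    unfolding \<Lambda>_lo_deriv(2)[OF H] using defect[of "- \<tau> (- w)"] \<tau>[of "- w"] H by (intro mult_pos_neg) auto
  have gs: "restoring w < 0" if "w < 0" for w using g_sign[of w] that by simp
  have A1: "- loop_A < - A1" and pup: "\<And>x. - A1 \<le> x \<Longrightarrow> x \<le> B1 \<Longrightarrow> p x < \<Lambda>_up x"
    by (rule arc_below_outward_barrier[where \<Lambda> = \<Lambda>_up and \<Lambda>' = \<Lambda>_up' and R = 1, OF arcs(1) _ arcs(3) _ \<Lambda>_up_cont \<Lambda>_ends(1) _ \<Lambda>_up_deriv(1) up'];
        (use loop_A_bounds in \<open>simp add: gs \<Lambda>_up_bounds(2)\<close>)?)+
  have gs': "- restoring (- w) < 0" if "- 1 < w" "w < 0" for w using g_sign[of "- w"] that by simp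
  \<comment> \<open>The lower arc ends at \<open>A1\<close>, which the upper barrier has just shown
    to be smaller than \<open>loop_A\<close>; the two branches must be treated in this
    order.\<close>
  have plo: "\<And>x. - B1 \<le> x \<Longrightarrow> x \<le> A1 \<Longrightarrow> p' x < \<Lambda>_lo x"
    by (rule arc_below_outward_barrier(2)[where \<Lambda> = \<Lambda>_lo and \<Lambda>' = \<Lambda>_lo' and L = "- 1" and R = loop_A, OF arcs(2) _ _ gs' \<Lambda>_lo_cont \<Lambda>_ends(3) _ \<Lambda>_lo_deriv(1) lo'])
       (use A1 \<Lambda>_lo_bounds(2) in simp_all)
  have nz: "2 * \<sigma> * \<tau> x \<noteq> 0" if "- loop_A < x" "x < 1" for x using \<tau>(4)[of x] \<sigma>_bounds that by simp
  have c\<Lambda>1: "continuous_on {- loop_A<..<1} \<Lambda>_up'"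
  proof -
    have "continuous_on {- loop_A<..<1} (\<lambda>w. loop_v' (\<tau> w))" by (rule continuous_on_compose2[OF cont_loop_v' cont_\<tau>]) auto
    moreover have "continuous_on {- loop_A<..<1} (\<lambda>w. 2 * \<sigma> * \<tau> w)" by (intro continuous_intros cont_\<tau>)
    ultimately have "continuous_on {- loop_A<..<1} (\<lambda>w. loop_v' (\<tau> w) / (2 * \<sigma> * \<tau> w))"
      by (rule continuous_on_divide) (use nz in auto)
    then show ?thesis by (simp only: \<Lambda>_up'_def[abs_def])
  qed
  have c\<Lambda>2: "continuous_on {- 1<..<loop_A} \<Lambda>_lo'"
  proof -
    have t: "continuous_on {- 1<..<loop_A} (\<lambda>x. - \<tau> (- x))"
      by (intro continuous_on_minus continuous_on_compose2[OF cont_\<tau>] continuous_on_id) auto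
    have "continuous_on {- 1<..<loop_A} (\<lambda>x. loop_v' (- \<tau> (- x)))" by (rule continuous_on_compose2[OF cont_loop_v' t]) auto
    moreover have "continuous_on {- 1<..<loop_A} (\<lambda>x. 2 * \<sigma> * (- \<tau> (- x)))" by (rule continuous_on_mult[OF continuous_on_const t])
    ultimately have "continuous_on {- 1<..<loop_A} (\<lambda>x. loop_v' (- \<tau> (- x)) / (2 * \<sigma> * (- \<tau> (- x))))"
      by (rule continuous_on_divide) (use nz[of "- x" for x] in auto)
    then show ?thesis by (simp only: \<Lambda>_lo'_def[abs_def])
  qed
  have out_up: "outer_curve (damping d) restoring (- loop_A) 1 \<Lambda>_up"
    unfolding outer_curve_def
  proof (intro conjI exI[of _ \<Lambda>_up'] ballI)
    show "continuous_on {- loop_A<..<1} \<Lambda>_up'" by (rule c\<Lambda>1)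
  qed (use \<Lambda>_up_cont \<Lambda>_ends \<Lambda>_up_bounds(2) \<Lambda>_up_deriv(1) up' in \<open>auto intro: less_imp_le\<close>)
  have out_lo: "outer_curve (\<lambda>x. damping d (- x)) (\<lambda>x. - restoring (- x)) (- 1) loop_A \<Lambda>_lo"
    unfolding outer_curve_def
  proof (intro conjI exI[of _ \<Lambda>_lo'] ballI)
    show "continuous_on {- 1<..<loop_A} \<Lambda>_lo'" by (rule c\<Lambda>2)
  qed (use \<Lambda>_lo_cont \<Lambda>_ends \<Lambda>_lo_bounds(2) \<Lambda>_lo_deriv(1) lo' in \<open>auto intro: less_imp_le\<close>)
  have hw: "dulac_h d x > 0" if "- loop_A \<le> x" "x \<le> 1" for x using cert(1)[of x] that loop_A_bounds by auto
  from p obtain T where sol: "solution (damping d) restoring w v" and T: "T > 0" "\<And>t. w (t + T) = w t" "\<And>t. v (t + T) = v t"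
    by (auto simp: periodic_solution_def)
  have hwt: "dulac_h d (w t) > 0" for t using arcs(3) arcs(4)[rule_format, of t] A1 by (intro hw) auto
  show False
  proof (cases "\<exists>s. \<Psi> (w s) (v s) \<ge> 0")
    case True
    then have pos: "\<Psi> (w t) (v t) > 0" for t using \<Psi>_periodic_sign[OF sol T hwt] by blast
    show False
    proof (rule no_nested_orbit[OF arcs(1,2) out_up out_lo])
      show "A1 < loop_A" "B1 < 1" using A1 arcs(3) by simp_all
      show "dulac_a d 0 < 0" by (simp add: dulac_a_def damping_primitive_def)
      fix x assume "- A1 \<le> x" "x \<le> B1"
      then have x: "x \<in> {- A1..B1}" by simp
      obtain t where "w t = x" "v t = p x" using arcs(5) x by blast
      then show "\<Psi> x (p x) > 0" using pos[of t] by simp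
      obtain t where "w t = x" "v t = - p' (- x)" using arcs(6) x by blast
      then show "\<Psi> x (- p' (- x)) > 0" using pos[of t] by simp
    next
      fix x assume "- loop_A < x" "x < 1"
      then show "dulac_h d x > 0" by (intro hw) auto
    next
      fix w x assume "- loop_A \<le> w" "w \<le> 1" "4 * dulac_a d w - (dulac_b d w)\<^sup>2 \<le> 0" "w \<le> x \<and> x \<le> 0 \<or> 0 \<le> x \<and> x \<le> w"
      then show "4 * dulac_a d x - (dulac_b d x)\<^sup>2 \<le> 0" using loop_A_bounds by (intro cert(2)[of w x]) linarith+
    qed (fact pup plo)+
  next
    case False
    then have neg: "\<Psi> (w t) (v t) < 0" for t by (meson not_le)
    show False
    proof (rule no_inner_orbit[OF arcs(1,2)])
      fix x assume "- A1 \<le> x" "x \<le> B1"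
      then have x: "x \<in> {- A1..B1}" by simp
      obtain t where "w t = x" "v t = p x" using arcs(5) x by blast
      then show "\<Psi> x (p x) < 0" using neg[of t] by simp
      obtain t where "w t = x" "v t = - p' (- x)" using arcs(6) x by blast
      then show "\<Psi> x (- p' (- x)) < 0" using neg[of t] by simp
    next
      fix x assume "- A1 < x" "x < B1"
      then show "dulac_h d x > 0" using A1 arcs(3) by (intro hw) auto
    qed
  qed
qed

section \<open>Existence of a periodic orbit\<close>

lemma half_arc_exists:
  assumes "s1 < s2"
    and "\<And>t. s1 \<le> t \<Longrightarrow> t \<le> s2 \<Longrightarrow> (w has_real_derivative v t) (at t within {s1..s2})"
    and "\<And>t. s1 \<le> t \<Longrightarrow> t \<le> s2 \<Longrightarrow> (v has_real_derivative - g (w t) - f (w t) * v t) (at t within {s1..s2})"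
    and "v s1 = 0" "v s2 = 0" and "\<And>t. s1 < t \<Longrightarrow> t < s2 \<Longrightarrow> v t > 0"
    and "w s1 < 0" "0 < w s2"
    and "\<And>x. w s1 \<le> x \<Longrightarrow> x < 0 \<Longrightarrow> g x < 0" and "\<And>x. 0 < x \<Longrightarrow> x \<le> w s2 \<Longrightarrow> g x > 0"
  shows "\<exists>\<phi>. half_arc f g (w s1) (w s2) \<phi>"
proof -
  obtain \<phi> where "half_arc f g (w s1) (w s2) \<phi>"
    by (rule half_arc_of_trajectory[of s1 s2 w v g f]) (use assms in auto)
  then show ?thesis by blast
qed

text \<open>Truncation to a box containing the loop makes the field bounded and globally Lipschitz
  without changing it near the loop. It preserves the sign of \<open>v\<close>, so \<open>w\<close>
  still increases in the upper half-plane, and it is odd, hence compatible with the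
  reflection.\<close>

definition clamp3 :: "real \<Rightarrow> real" where "clamp3 x = max (- 3) (min 3 x)"

lemma clamp3: "\<bar>clamp3 x\<bar> \<le> 3" "\<bar>clamp3 x - clamp3 y\<bar> \<le> \<bar>x - y\<bar>" "\<bar>x\<bar> \<le> 3 \<Longrightarrow> clamp3 x = x"
  "0 < x \<Longrightarrow> 0 < clamp3 x" "clamp3 0 = 0" "clamp3 (- x) = - clamp3 x"
  by (auto simp: clamp3_def max_def min_def abs_if split: if_splits)

definition clamped_field :: "real \<Rightarrow> real \<times> real \<Rightarrow> real \<times> real" where
  "clamped_field d z = (clamp3 (snd z), - restoring (clamp3 (fst z)) - damping d (clamp3 (fst z)) * clamp3 (snd z))"

lemma clamped_field_lipschitz:
  assumes d: "0 < d" "d < 1"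
  shows "norm (clamped_field d x - clamped_field d y) \<le> 30 * norm (x - y)"
proof -
  let ?k = "\<lambda>z. (clamp3 (fst z), clamp3 (snd z))"
  have "norm (clamped_field d x - clamped_field d y) \<le> (3 + 4 * 3) * norm (?k x - ?k y)"
    unfolding clamped_field_def by (rule vector_field_lipschitz[OF d]) (rule clamp3)+
  also have "norm (?k x - ?k y) \<le> \<bar>clamp3 (fst x) - clamp3 (fst y)\<bar> + \<bar>clamp3 (snd x) - clamp3 (snd y)\<bar>"
    using norm_Pair_le[of "clamp3 (fst x) - clamp3 (fst y)" "clamp3 (snd x) - clamp3 (snd y)"] by simp
  also have "\<dots> \<le> \<bar>fst x - fst y\<bar> + \<bar>snd x - snd y\<bar>" by (intro add_mono clamp3)
  also have "\<bar>fst x - fst y\<bar> \<le> norm (x - y)"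
    using norm_fst_le[of "fst (x - y)" "snd (x - y)"] unfolding prod.collapse by simp
  also have "\<bar>snd x - snd y\<bar> \<le> norm (x - y)"
    using norm_snd_le[of "snd (x - y)" "fst (x - y)"] unfolding prod.collapse by simp
  finally show ?thesis by simp
qed

lemma clamped_field_bounded:
  assumes d: "0 < d" "d < 1"
  shows "norm (clamped_field d z) \<le> 27"
proof -
  let ?w = "clamp3 (fst z)" and ?v = "clamp3 (snd z)"
  have "norm (clamped_field d z) \<le> \<bar>?v\<bar> + \<bar>- restoring ?w - damping d ?w * ?v\<bar>"
    unfolding clamped_field_def using norm_Pair_le[of ?v "- restoring ?w - damping d ?w * ?v"] by simp
  also have "\<bar>- restoring ?w - damping d ?w * ?v\<bar> \<le> \<bar>?w\<bar> * \<bar>1 - ?w\<bar> + \<bar>?w - d\<bar> * \<bar>?v\<bar>"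
    by (simp add: restoring_def damping_def flip: abs_mult)
  also have "\<dots> \<le> 3 * 4 + 4 * 3"
    using clamp3(1)[of "fst z"] clamp3(1)[of "snd z"] d by (intro add_mono mult_mono) auto
  finally show ?thesis using clamp3(1)[of "snd z"] by simp
qed

lemma at_within_atLeast_0: "0 < t \<Longrightarrow> at t within {0..} = at (t::real)"
proof -
  assume "0 < t"
  moreover have "{0..} \<inter> {0<..} - {t} = UNIV \<inter> {0<..} - {t}" by auto
  ultimately show ?thesis using at_within_nhd[of t "{0<..}" "{0..}" UNIV] by simp
qed

lemma barrier_up:
  assumes d: "0 < d" "d < 1" and e: "\<And>t. \<bar>t\<bar> \<le> 1 \<Longrightarrow> loop_defect d t > 0"
  shows "barrier_in (damping d) restoring (damping_primitive d) \<Lambda>_up (- loop_A) 1 d 3"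
proof
  fix w assume w: "- loop_A < w" "w < 1"
  have "\<Lambda>_up w * \<Lambda>_up' w + restoring w + damping d w * \<Lambda>_up w > 0"
    unfolding \<Lambda>_up_deriv(2)[OF w] using e[of "\<tau> w"] \<tau>[of w] w by (intro mult_pos_pos) auto
  then show "\<exists>\<Lambda>'. (\<Lambda>_up has_real_derivative \<Lambda>') (at w) \<and> 0 < \<Lambda>_up w * \<Lambda>' + restoring w + damping d w * \<Lambda>_up w"
    using \<Lambda>_up_deriv(1)[OF w] by blast
  show "0 < \<Lambda>_up w" using \<Lambda>_up_bounds(2)[of w] w by simp
next
  show "(damping_primitive d has_real_derivative damping d w) (at w)" for w by (rule damping_primitive_deriv)
  show "restoring w < 0" if "w < 0" for w using g_sign[of w] that by simp
  show "0 < restoring w" if "0 < w" "w < 1" for w using g_sign[of w] that by simp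
  show "\<Lambda>_up w < 3" if "- loop_A \<le> w" "w \<le> 1" for w using \<Lambda>_up_bounds(1) that by blast
qed (use d loop_A_bounds in \<open>simp_all add: cont_restoring restoring_def[of 0] damping_def \<Lambda>_up_cont \<Lambda>_ends\<close>)

lemma barrier_lo:
  assumes d: "0 < d" "d < 1" and e: "\<And>t. \<bar>t\<bar> \<le> 1 \<Longrightarrow> loop_defect d t > 0"
  shows "barrier_in (\<lambda>x. damping d (- x)) (\<lambda>x. - restoring (- x)) (\<lambda>x. - damping_primitive d (- x)) \<Lambda>_lo (- 1) loop_A d 3"
proof
  fix w assume w: "- 1 < w" "w < loop_A"
  have "\<Lambda>_lo w * \<Lambda>_lo' w + (- restoring (- w)) + damping d (- w) * \<Lambda>_lo w > 0"
    unfolding \<Lambda>_lo_deriv(2)[OF w] using e[of "- \<tau> (- w)"] \<tau>[of "- w"] w by (intro mult_pos_pos) auto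
  then show "\<exists>\<Lambda>'. (\<Lambda>_lo has_real_derivative \<Lambda>') (at w) \<and> 0 < \<Lambda>_lo w * \<Lambda>' + - restoring (- w) + damping d (- w) * \<Lambda>_lo w"
    using \<Lambda>_lo_deriv(1)[OF w] by blast
  show "0 < \<Lambda>_lo w" using \<Lambda>_lo_bounds(2)[of w] w by simp
next
  have m: "((\<lambda>w. - w) has_real_derivative - 1) (at w)" for w :: real by (auto intro!: derivative_eq_intros)
  show "((\<lambda>x. - damping_primitive d (- x)) has_real_derivative damping d (- w)) (at w)" for w
    using DERIV_minus[OF DERIV_chain2[where f = "damping_primitive d" and g = uminus, OF damping_primitive_deriv m]] by simp
  show "continuous_on UNIV (\<lambda>x. - restoring (- x))" unfolding restoring_def by (intro continuous_intros)
  show "- restoring (- w) < 0" if "- 1 < w" "w < 0" for w using g_sign[of "- w"] that by simp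
  show "0 < - restoring (- w)" if "0 < w" for w using g_sign[of "- w"] that by simp
  show "\<Lambda>_lo w < 3" if "- 1 \<le> w" "w \<le> loop_A" for w using \<Lambda>_lo_bounds(1) that by blast
qed (use d loop_A_bounds in \<open>simp_all add: restoring_def[of 0] damping_def \<Lambda>_lo_cont \<Lambda>_ends\<close>)

text \<open>One half return below each branch of the inward loop. The branches have height less than
  3, so between the barriers the truncation is never felt and both pieces are arcs of the original
  system.\<close>

lemma round_trip:
  assumes d: "0 < d" "d < 1" and e: "\<And>t. \<bar>t\<bar> \<le> 1 \<Longrightarrow> loop_defect d t > 0"
    and x: "0 < x" "x \<le> loop_A"
  shows "\<exists>z T1 T2 y x' p p'. z 0 = (- x, 0) \<and> (\<forall>t\<ge>0. (z has_vector_derivative clamped_field d (z t)) (at t within {0..})) \<and>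
     0 < T1 \<and> 0 < T2 \<and> z T1 = (y, 0) \<and> z (T1 + T2) = (- x', 0) \<and> 0 < y \<and> y < 1 \<and> 0 < x' \<and> x' < loop_A \<and>
     (\<forall>t\<in>{0..T1 + T2}. - max x x' \<le> fst (z t) \<and> fst (z t) \<le> 1 \<and> \<bar>snd (z t)\<bar> \<le> 3) \<and>
     half_arc (damping d) restoring (- x) y p \<and>
     half_arc (\<lambda>x. damping d (- x)) (\<lambda>x. - restoring (- x)) (- y) x' p'"
proof -
  interpret U: barrier_in "damping d" restoring "damping_primitive d" \<Lambda>_up "- loop_A" 1 d 3
    by (rule barrier_up[OF d e])
  interpret L: barrier_in "\<lambda>x. damping d (- x)" "\<lambda>x. - restoring (- x)" "\<lambda>x. - damping_primitive d (- x)" \<Lambda>_lo "- 1" loop_A d 3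
    by (rule barrier_lo[OF d e])
  have A1: "loop_A < 1" "0 < loop_A" using loop_A_bounds by auto
  have "\<exists>z. z 0 = (- x, 0) \<and> (\<forall>t\<ge>0. (z has_vector_derivative clamped_field d (z t)) (at t within {0..}))"
    by (rule ode_exists[of 30 "clamped_field d" 27 "(- x, 0)", OF _ clamped_field_lipschitz[OF d] clamped_field_bounded[OF d]]) auto
  then obtain z where z0: "z 0 = (- x, 0)" and dz: "\<And>t. t \<ge> 0 \<Longrightarrow> (z has_vector_derivative clamped_field d (z t)) (at t within {0..})"
    by blast
  define w where "w t = fst (z t)" for t
  define v where "v t = snd (z t)" for t
  let ?F = "\<lambda>w v. - restoring (clamp3 w) - damping d (clamp3 w) * clamp3 v"
  have dw: "(w has_real_derivative clamp3 (v t)) (at t within {0..})"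
    and dv: "(v has_real_derivative ?F (w t) (v t)) (at t within {0..})" if "t \<ge> 0" for t
    using bounded_linear.has_vector_derivative[OF bounded_linear_fst dz[OF that]]
      bounded_linear.has_vector_derivative[OF bounded_linear_snd dz[OF that]]
    by (simp_all add: w_def[abs_def] v_def[abs_def] clamped_field_def has_real_derivative_iff_has_vector_derivative)
  have cw: "continuous_on {0..} w" by (rule DERIV_continuous_on) (use dw in auto)
  have cv: "continuous_on {0..} v" by (rule DERIV_continuous_on) (use dv in auto)
  have dw': "(w has_real_derivative clamp3 (v t)) (at t)" and dv': "(v has_real_derivative ?F (w t) (v t)) (at t)" if "t > 0" for t
    using dw[of t] dv[of t] at_within_atLeast_0[OF that] that by auto
  have w0: "w 0 = - x" "v 0 = 0" by (simp_all add: w_def v_def z0)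
  have gneg: "restoring s < 0" if "s < 0" for s using g_sign[of s] that by simp
  have gpos: "0 < restoring s" if "0 < s" "s < 1" for s using g_sign[of s] that by simp
  obtain T1 where T1: "T1 > 0" "v T1 = 0" "0 < w T1" "w T1 < 1" "\<forall>t. 0 < t \<and> t < T1 \<longrightarrow> v t > 0"
    "\<forall>t. 0 \<le> t \<and> t \<le> T1 \<longrightarrow> w 0 \<le> w t \<and> w t \<le> w T1 \<and> v t \<le> \<Lambda>_up (w t)"
  proof (rule U.half_return[OF cw cv])
    fix t :: real assume t: "t > 0"
    show "\<exists>w'. (w has_real_derivative w') (at t) \<and> 0 < w'" if "0 < v t" using dw'[OF t] clamp3(4)[OF that] by blast
    assume "\<bar>w t\<bar> \<le> 3" "\<bar>v t\<bar> \<le> 3"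
    then show "(w has_real_derivative v t) (at t)" "(v has_real_derivative - restoring (w t) - damping d (w t) * v t) (at t)"
      using dw'[OF t] dv'[OF t] by (simp_all add: clamp3(3))
  next
    show "(v has_real_derivative - restoring (w 0)) (at 0 within {0..})"
      using dv[of 0] x A1 by (simp add: w0 clamp3(3) clamp3(5))
  qed (use w0 x gneg in simp_all)
  define y where "y = w T1"
  \<comment> \<open>The continuation after \<open>T1\<close>, reflected: the lower half becomes a
    second motion in the upper half-plane, starting on the axis at \<open>- y\<close>.\<close>
  define w2 where "w2 t = - w (t + T1)" for t
  define v2 where "v2 t = - v (t + T1)" for t
  have m: "((\<lambda>t. t + T1) has_real_derivative 1) (at t within S)" for t S by (auto intro!: derivative_eq_intros)
  have im: "(\<lambda>t. t + T1) ` {0..} \<subseteq> {0..}" using T1(1) by auto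
  have dw2: "(w2 has_real_derivative clamp3 (v2 t)) (at t within {0..})" if "t \<ge> 0" for t
    unfolding w2_def[abs_def] v2_def
    using DERIV_minus[OF DERIV_image_chain[where f = w and g = "\<lambda>t. t + T1", OF DERIV_subset[OF dw[of "t + T1"] im] m]] that T1(1)
    by (simp add: o_def clamp3(6))
  have dv2: "(v2 has_real_derivative - (- restoring (- clamp3 (w2 t))) - damping d (- clamp3 (w2 t)) * clamp3 (v2 t)) (at t within {0..})" if "t \<ge> 0" for t
    unfolding w2_def v2_def[abs_def]
    using DERIV_minus[OF DERIV_image_chain[where f = v and g = "\<lambda>t. t + T1", OF DERIV_subset[OF dv[of "t + T1"] im] m]] that T1(1)
    by (simp add: o_def clamp3(6) algebra_simps)
  have cw2: "continuous_on {0..} w2" by (rule DERIV_continuous_on) (use dw2 in auto)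
  have cv2: "continuous_on {0..} v2" by (rule DERIV_continuous_on) (use dv2 in auto)
  have dw2': "(w2 has_real_derivative clamp3 (v2 t)) (at t)"
    and dv2': "(v2 has_real_derivative - (- restoring (- clamp3 (w2 t))) - damping d (- clamp3 (w2 t)) * clamp3 (v2 t)) (at t)" if "t > 0" for t
    using dw2[of t] dv2[of t] at_within_atLeast_0[OF that] that by auto
  have w20: "w2 0 = - y" "v2 0 = 0" using T1 by (simp_all add: w2_def v2_def y_def)
  have y: "0 < y" "y < 1" using T1 by (simp_all add: y_def)
  obtain T2 where T2: "T2 > 0" "v2 T2 = 0" "0 < w2 T2" "w2 T2 < loop_A" "\<forall>t. 0 < t \<and> t < T2 \<longrightarrow> v2 t > 0"
    "\<forall>t. 0 \<le> t \<and> t \<le> T2 \<longrightarrow> w2 0 \<le> w2 t \<and> w2 t \<le> w2 T2 \<and> v2 t \<le> \<Lambda>_lo (w2 t)"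
  proof (rule L.half_return[OF cw2 cv2])
    fix t :: real assume t: "t > 0"
    show "\<exists>w'. (w2 has_real_derivative w') (at t) \<and> 0 < w'" if "0 < v2 t" using dw2'[OF t] clamp3(4)[OF that] by blast
    assume "\<bar>w2 t\<bar> \<le> 3" "\<bar>v2 t\<bar> \<le> 3"
    then show "(w2 has_real_derivative v2 t) (at t)" "(v2 has_real_derivative - (- restoring (- w2 t)) - damping d (- w2 t) * v2 t) (at t)"
      using dw2'[OF t] dv2'[OF t] by (simp_all add: clamp3(3))
  next
    show "(v2 has_real_derivative - (- restoring (- w2 0))) (at 0 within {0..})"
      using dv2[of 0] y by (simp add: w20 clamp3(3) clamp3(5))
  qed (use w20 y gpos in simp_all)
  define x' where "x' = w2 T2"
  have v_nonneg: "0 \<le> v t" if "0 \<le> t" "t \<le> T1" for t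
    using T1(2,5) w0(2) that by (cases "t = 0"; cases "t = T1") (auto intro: less_imp_le)
  have v2_nonneg: "0 \<le> v2 t" if "0 \<le> t" "t \<le> T2" for t
    using T2(2,5) w20(2) that by (cases "t = 0"; cases "t = T2") (auto intro: less_imp_le)
  have box1: "- x \<le> w t \<and> w t \<le> 1 \<and> \<bar>v t\<bar> \<le> 3" if t: "0 \<le> t" "t \<le> T1" for t
  proof -
    have "- x \<le> w t" "w t \<le> y" "v t \<le> \<Lambda>_up (w t)" using T1(6) t w0 by (auto simp: y_def)
    moreover have "\<Lambda>_up (w t) < 3" by (rule \<Lambda>_up_bounds(1)) (use calculation y x in linarith)+
    ultimately show ?thesis using v_nonneg[OF t] y by auto
  qed
  have box2: "- y \<le> w2 t \<and> w2 t \<le> x' \<and> \<bar>v2 t\<bar> \<le> 3" if t: "0 \<le> t" "t \<le> T2" for t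
  proof -
    have "- y \<le> w2 t" "w2 t \<le> x'" "v2 t \<le> \<Lambda>_lo (w2 t)" using T2(6) t w20 by (auto simp: x'_def)
    moreover have "\<Lambda>_lo (w2 t) < 3" by (rule \<Lambda>_lo_bounds(1)) (use calculation y T2(4) in \<open>auto simp: x'_def\<close>)
    ultimately show ?thesis using v2_nonneg[OF t] by auto
  qed
  have box: "- max x x' \<le> w t \<and> w t \<le> 1 \<and> \<bar>v t\<bar> \<le> 3" if t: "0 \<le> t" "t \<le> T1 + T2" for t
  proof (cases "t \<le> T1")
    case True
    then show ?thesis using box1[of t] t by auto
  next
    case False
    then show ?thesis using box2[of "t - T1"] t y by (auto simp: w2_def v2_def)
  qed
  have "\<exists>p. half_arc (damping d) restoring (w 0) (w T1) p"
  proof (rule half_arc_exists[OF T1(1)])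
    fix t assume t: "0 \<le> t" "t \<le> T1"
    have "\<bar>w t\<bar> \<le> 3" "\<bar>v t\<bar> \<le> 3" using box1[OF t] x A1 by auto
    then show "(w has_real_derivative v t) (at t within {0..T1})"
      "(v has_real_derivative - restoring (w t) - damping d (w t) * v t) (at t within {0..T1})"
      using DERIV_subset[OF dw[OF t(1)], of "{0..T1}"] DERIV_subset[OF dv[OF t(1)], of "{0..T1}"] by (simp_all add: clamp3(3))
  next
    fix s assume "0 < s" "s \<le> w T1"
    then show "0 < restoring s" using T1(4) by (intro gpos) auto
  qed (use T1 w0 x gneg in auto)
  then obtain p where p: "half_arc (damping d) restoring (- x) y p" using w0 by (auto simp: y_def)
  have "\<exists>p. half_arc (\<lambda>x. damping d (- x)) (\<lambda>x. - restoring (- x)) (w2 0) (w2 T2) p"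
  proof (rule half_arc_exists[OF T2(1)])
    fix t assume t: "0 \<le> t" "t \<le> T2"
    have "\<bar>w2 t\<bar> \<le> 3" "\<bar>v2 t\<bar> \<le> 3" using box2[OF t] y T2(4) A1 by (auto simp: x'_def)
    then show "(w2 has_real_derivative v2 t) (at t within {0..T2})"
      "(v2 has_real_derivative - (- restoring (- w2 t)) - damping d (- w2 t) * v2 t) (at t within {0..T2})"
      using DERIV_subset[OF dw2[OF t(1)], of "{0..T2}"] DERIV_subset[OF dv2[OF t(1)], of "{0..T2}"] by (simp_all add: clamp3(3))
  next
    fix s assume "w2 0 \<le> s" "s < 0"
    then show "- restoring (- s) < 0" using gpos[of "- s"] w20 y by auto
  next
    fix s assume "0 < s" "s \<le> w2 T2"
    then show "0 < - restoring (- s)" using gneg[of "- s"] by auto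
  qed (use T2 w20 y in auto)
  then obtain p' where p': "half_arc (\<lambda>x. damping d (- x)) (\<lambda>x. - restoring (- x)) (- y) x' p'" using w20 by (auto simp: x'_def)
  have "z T1 = (y, 0)" using T1(2) by (simp add: y_def w_def v_def prod_eq_iff)
  moreover have "z (T1 + T2) = (- x', 0)" using T2(2) by (simp add: x'_def w2_def v2_def w_def v_def prod_eq_iff add.commute)
  moreover have "\<forall>t\<in>{0..T1 + T2}. - max x x' \<le> fst (z t) \<and> fst (z t) \<le> 1 \<and> \<bar>snd (z t)\<bar> \<le> 3"
    using box by (auto simp: w_def v_def)
  moreover have "0 < x'" "x' < loop_A" using T2 by (simp_all add: x'_def)
  ultimately show ?thesis using z0 dz T1(1) T2(1) y p p' by blast
qed

text \<open>The Knaster-Tarski argument on a closed bounded set: the supremum of the points with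
  \<open>x \<le> P x\<close> is fixed. Monotonicity is what the comparison of half arcs
  provides.\<close>

lemma monotone_fixed_point:
  fixes D :: "real set" and P :: "real \<Rightarrow> real"
  assumes D: "closed D" "D \<noteq> {}" "bdd_above D" "bdd_below D"
    and P: "\<And>x. x \<in> D \<Longrightarrow> P x \<in> D" and mono: "\<And>x y. x \<in> D \<Longrightarrow> y \<in> D \<Longrightarrow> x \<le> y \<Longrightarrow> P x \<le> P y"
  shows "\<exists>x\<in>D. P x = x"
proof -
  define S where "S = {x \<in> D. x \<le> P x}"
  have "Inf D \<in> D" by (rule closed_contains_Inf[OF D(2,4,1)])
  then have "Inf D \<in> S" using P[of "Inf D"] cInf_lower[OF _ D(4)] by (auto simp: S_def)
  have bS: "bdd_above S" by (rule bdd_above_mono[OF D(3)]) (auto simp: S_def)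
  define s where "s = Sup S"
  have "s \<in> D" unfolding s_def
    by (rule closed_subset_contains_Sup[OF D(1)]) (use bS \<open>Inf D \<in> S\<close> in \<open>auto simp: S_def\<close>)
  have "s \<le> P s" unfolding s_def
  proof (rule cSup_least)
    fix x assume x: "x \<in> S"
    then have "x \<le> s" unfolding s_def by (rule cSup_upper[OF _ bS])
    then have "P x \<le> P s" using mono[of x s] x \<open>s \<in> D\<close> by (auto simp: S_def)
    then show "x \<le> P (Sup S)" using x by (auto simp: S_def s_def)
  qed (use \<open>Inf D \<in> S\<close> in auto)
  then have "P s \<in> S" using mono[of s "P s"] P \<open>s \<in> D\<close> by (auto simp: S_def)
  then have "P s \<le> s" unfolding s_def by (rule cSup_upper[OF _ bS])
  with \<open>s \<le> P s\<close> have "P s = s" by simp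
  then show ?thesis using \<open>s \<in> D\<close> by blast
qed

text \<open>Forward uniqueness turns the single coincidence \<open>z T = z 0\<close> into
  periodicity on the half-line, which then defines the solution at negative times.\<close>

lemma periodic_extension:
  fixes H :: "'a::real_inner \<Rightarrow> 'a"
  assumes T: "T > 0" and lip: "\<And>x y. norm (H x - H y) \<le> L * norm (x - y)"
    and dz: "\<And>t. t \<ge> 0 \<Longrightarrow> (z has_vector_derivative H (z t)) (at t within {0..})" and per: "z T = z 0"
  shows "\<exists>Z. (\<forall>t. (Z has_vector_derivative H (Z t)) (at t)) \<and> (\<forall>t. Z (t + T) = Z t) \<and> (\<forall>t\<ge>0. Z t = z t)"
proof -
  have dz': "(z has_vector_derivative H (z t)) (at t)" if "t > 0" for t
    using dz[of t] at_within_atLeast_0[OF that] that by simp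
  have cz: "continuous_on {0..} z"
    by (rule continuous_on_vector_derivative) (use dz in auto)
  have per1: "z (t + T) = z t" if t: "t \<ge> 0" for t
  proof (rule ode_unique_forward[OF t, where x = "\<lambda>t. z (t + T)" and y = z and L = L and x' = "\<lambda>t. H (z (t + T))" and y' = "\<lambda>t. H (z t)"])
    show "continuous_on {0..t} (\<lambda>t. z (t + T))"
      by (rule continuous_on_compose2[OF cz]) (use T in \<open>auto intro!: continuous_intros\<close>)
    show "continuous_on {0..t} z" by (rule continuous_on_subset[OF cz]) auto
    fix s :: real assume s: "0 < s"
    have "((\<lambda>s. s + T) has_vector_derivative 1) (at s)" by (auto intro!: derivative_eq_intros)
    from vector_diff_chain_at[OF this dz'[of "s + T"]] show "((\<lambda>t. z (t + T)) has_vector_derivative H (z (s + T))) (at s)"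
      using s T by (simp add: o_def)
    show "(z has_vector_derivative H (z s)) (at s)" by (rule dz'[OF s])
    show "norm (H (z (s + T)) - H (z s)) \<le> L * norm (z (s + T) - z s)" by (rule lip)
  qed (use per in simp)
  have pern: "z (t + real n * T) = z t" if t: "t \<ge> 0" for t n
  proof (induction n)
    case (Suc n)
    have "z (t + real (Suc n) * T) = z ((t + real n * T) + T)" by (simp add: algebra_simps)
    also have "\<dots> = z (t + real n * T)" using t T by (intro per1) simp
    finally show ?case using Suc by simp
  qed simp
  \<comment> \<open>Enough periods to move \<open>t\<close> to a nonnegative time; fact
    \<open>Z\<close> below shows that the choice does not matter, so near each \<open>t\<close> one
    fixed shift can be differentiated.\<close>
  define N where "N t = nat \<lceil>\<bar>t\<bar> / T\<rceil>" for t
  have N: "t + real (N t) * T \<ge> 0" for t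
  proof -
    have "\<bar>t\<bar> / T \<le> real (N t)" unfolding N_def by (rule real_nat_ceiling_ge)
    then have "\<bar>t\<bar> \<le> real (N t) * T" using T by (simp add: pos_divide_le_eq)
    then show ?thesis by linarith
  qed
  define Z where "Z t = z (t + real (N t) * T)" for t
  have Z: "Z t = z (t + real n * T)" if n: "t + real n * T \<ge> 0" for t n
  proof (cases "N t \<le> n")
    case True
    have "z (t + real n * T) = z ((t + real (N t) * T) + real (n - N t) * T)"
      using True by (simp add: of_nat_diff algebra_simps)
    then show ?thesis using pern[OF N] by (simp add: Z_def)
  next
    case False
    have "z (t + real (N t) * T) = z ((t + real n * T) + real (N t - n) * T)"
      using False by (simp add: of_nat_diff algebra_simps)
    then show ?thesis using pern[OF n] by (simp add: Z_def)
  qed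
  show ?thesis
  proof (intro exI[of _ Z] conjI allI impI)
    fix t
    let ?n = "Suc (N t)"
    have p: "t + real ?n * T > 0" using N[of t] T by (simp add: algebra_simps)
    have "((\<lambda>s. s + real ?n * T) has_vector_derivative 1) (at t)" by (auto intro!: derivative_eq_intros)
    from vector_diff_chain_at[OF this dz'[OF p]]
    have "((\<lambda>s. z (s + real ?n * T)) has_vector_derivative H (Z t)) (at t)"
      using Z[of t ?n] p by (simp add: o_def)
    then show "(Z has_vector_derivative H (Z t)) (at t)"
    proof (rule has_vector_derivative_transform_within_open[of _ _ _ "{- (real ?n * T)<..}"])
      show "t \<in> {- (real ?n * T)<..}" unfolding greaterThan_iff using p by linarith
      fix s assume "s \<in> {- (real ?n * T)<..}"
      then have "s + real ?n * T \<ge> 0" unfolding greaterThan_iff by linarith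
      then show "z (s + real ?n * T) = Z s" by (rule Z[symmetric])
    qed (rule open_greaterThan)
    have "Z (t + T) = z ((t + T) + real (N t) * T)" by (rule Z) (use N[of t] T in linarith)
    also have "(t + T) + real (N t) * T = t + real ?n * T" by (simp add: algebra_simps)
    also have "z (t + real ?n * T) = Z t" by (rule Z[symmetric]) (use p in linarith)
    finally show "Z (t + T) = Z t" .
    show "Z t = z t" if "0 \<le> t" using Z[of t 0] that by simp
  qed
qed

text \<open>The inward loop keeps the return map inside \<open>loop_A\<close>, and forward
  invariance of \<Psi> \<ge> 0 keeps it away from the focus. A fixed point closes up the
  orbit.\<close>

theorem periodic_solution_exists:
  assumes d: "0 < d" "d < 1" and e: "\<And>t. \<bar>t\<bar> \<le> 1 \<Longrightarrow> loop_defect d t > 0"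
    and h: "\<And>x. - loop_A \<le> x \<Longrightarrow> x \<le> 1 \<Longrightarrow> dulac_h d x > 0"
    and aA: "dulac_a d (- loop_A) \<ge> 0"
  shows "\<exists>w v. periodic_solution d w v \<and> (\<forall>t. - loop_A < w t \<and> w t \<le> 1 \<and> (v t)\<^sup>2 + dulac_b d (w t) * v t + dulac_a d (w t) > 0)"
proof -
  interpret dulac "damping d" restoring "dulac_a d" "dulac_b d" "dulac_h d" by (rule dulac_BT)
  have A: "0 < loop_A" "loop_A < 1" using loop_A_bounds by auto
  \<comment> \<open>The starting points \<open>(- x, 0)\<close> between the focus and the loop with
    \<Psi> \<ge> 0, since \<Psi> equals \<open>a\<close> on the axis. The set is closed, contains
    \<open>loop_A\<close> by \<open>aA\<close>, and omits 0 because \<open>a\<close> is negative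
    there.\<close>
  define D where "D = {0..loop_A} \<inter> (\<lambda>x. dulac_a d (- x)) -` {0..}"
  have D0: "0 < x" if "x \<in> D" for x
  proof -
    have "dulac_a d 0 < 0" by (simp add: dulac_a_def damping_primitive_def)
    then have "x \<noteq> 0" using that by (auto simp: D_def)
    then show ?thesis using that by (auto simp: D_def)
  qed
  define R where "R x z T1 T2 y x' p p' \<longleftrightarrow> z 0 = (- x, 0) \<and> (\<forall>t\<ge>0. (z has_vector_derivative clamped_field d (z t)) (at t within {0..})) \<and>
     0 < T1 \<and> 0 < T2 \<and> z T1 = (y, 0) \<and> z (T1 + T2) = (- x', 0) \<and> 0 < y \<and> y < 1 \<and> 0 < x' \<and> x' < loop_A \<and>
     (\<forall>t\<in>{0..T1 + T2}. - max x x' \<le> fst (z t) \<and> fst (z t) \<le> 1 \<and> \<bar>snd (z t)\<bar> \<le> 3) \<and>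
     half_arc (damping d) restoring (- x) y p \<and>
     half_arc (\<lambda>x. damping d (- x)) (\<lambda>x. - restoring (- x)) (- y) x' p'"
    for x z T1 T2 y x' p p'
  have "\<forall>x\<in>D. \<exists>x'. \<exists>z T1 T2 y p p'. R x z T1 T2 y x' p p'"
  proof
    fix x assume "x \<in> D"
    then have "0 < x" "x \<le> loop_A" using D0 by (auto simp: D_def)
    from round_trip[OF d e this] show "\<exists>x'. \<exists>z T1 T2 y p p'. R x z T1 T2 y x' p p'" unfolding R_def by blast
  qed
  from bchoice[OF this] obtain P where P: "\<forall>x\<in>D. \<exists>z T1 T2 y p p'. R x z T1 T2 y (P x) p p'" ..
  have along: "\<Psi> (fst (z (T1 + T2))) (snd (z (T1 + T2))) > 0" if H: "x \<in> D" "R x z T1 T2 y x' p p'" for x z T1 T2 y x' p p'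
  proof -
    let ?w = "\<lambda>t. fst (z t)" and ?v = "\<lambda>t. snd (z t)"
    from H(2) have z: "z 0 = (- x, 0)" "\<And>t. t \<ge> 0 \<Longrightarrow> (z has_vector_derivative clamped_field d (z t)) (at t within {0..})"
      "0 < T1" "0 < T2" "x' < loop_A"
      and box: "\<And>t. 0 \<le> t \<Longrightarrow> t \<le> T1 + T2 \<Longrightarrow> - max x x' \<le> fst (z t) \<and> fst (z t) \<le> 1 \<and> \<bar>snd (z t)\<bar> \<le> 3"
      unfolding R_def by auto
    have x: "x \<le> loop_A" "dulac_a d (- x) \<ge> 0" using H(1) by (auto simp: D_def)
    show ?thesis
    proof (rule \<Psi>_forward[where w = ?w and v = ?v and ?t0.0 = 0])
      fix t assume t: "0 \<le> t" "t \<le> T1 + T2"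
      have b: "- loop_A \<le> ?w t" "?w t \<le> 1" "\<bar>?v t\<bar> \<le> 3" using box[OF t] x z(5) by auto
      then have w3: "\<bar>?w t\<bar> \<le> 3" using A by auto
      have "(?w has_real_derivative ?v t) (at t within {0..})"
        "(?v has_real_derivative - restoring (?w t) - damping d (?w t) * ?v t) (at t within {0..})"
        using bounded_linear.has_vector_derivative[OF bounded_linear_fst z(2)[OF t(1)]]
          bounded_linear.has_vector_derivative[OF bounded_linear_snd z(2)[OF t(1)]] b w3
        by (simp_all add: clamped_field_def clamp3(3) has_real_derivative_iff_has_vector_derivative)
      then show "(?w has_real_derivative ?v t) (at t within {0..T1 + T2})"
        "(?v has_real_derivative - restoring (?w t) - damping d (?w t) * ?v t) (at t within {0..T1 + T2})"
        by (auto elim: DERIV_subset)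
      show "dulac_h d (?w t) > 0" using b by (intro h)
    next
      show "0 < T1 + T2" using z by simp
      show "\<Psi> (fst (z 0)) (snd (z 0)) \<ge> 0" using x by (simp add: z(1) \<Psi>_def)
    qed
  qed
  have PD: "P x \<in> D" if x: "x \<in> D" for x
  proof -
    obtain z T1 T2 y p p' where r: "R x z T1 T2 y (P x) p p'" using P x by blast
    have "\<Psi> (- P x) 0 > 0" using along[OF x r] r by (simp add: R_def)
    moreover have "0 < P x" "P x < loop_A" using r by (auto simp: R_def)
    ultimately show ?thesis by (simp add: D_def \<Psi>_def)
  qed
  have cg': "continuous_on UNIV (\<lambda>x. - restoring (- x))" unfolding restoring_def by (intro continuous_intros)
  have mono: "P x1 \<le> P x2" if H: "x1 \<in> D" "x2 \<in> D" "x1 \<le> x2" for x1 x2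
  proof (cases "x1 = x2")
    case False
    obtain z1 T1 T1' y1 p1 p1' where r1: "R x1 z1 T1 T1' y1 (P x1) p1 p1'" using P H(1) by blast
    obtain z2 T2 T2' y2 p2 p2' where r2: "R x2 z2 T2 T2' y2 (P x2) p2 p2'" using P H(2) by blast
    \<comment> \<open>The return map is the composition of two half returns, each preserving the
      nesting of arcs.\<close>
    have "y1 < y2"
      by (rule half_arc_less(1)[OF cont_restoring, of "damping d" "- x1" y1 p1 "- x2" y2 p2]) (use r1 r2 H False in \<open>auto simp: R_def\<close>)
    then have "P x1 < P x2"
      by (intro half_arc_less(1)[OF cg', of "\<lambda>x. damping d (- x)" "- y1" "P x1" p1' "- y2" "P x2" p2']) (use r1 r2 in \<open>auto simp: R_def\<close>)
    then show ?thesis by simp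
  qed simp
  have "\<exists>x\<in>D. P x = x"
  proof (rule monotone_fixed_point)
    show "closed D" unfolding D_def
      by (rule continuous_closed_preimage) (auto intro!: cont_ab_comp continuous_intros)
    have "loop_A \<in> D" using A aA by (simp add: D_def)
    then show "D \<noteq> {}" by blast
    show "bdd_above D" "bdd_below D" by (auto simp: D_def bdd_above_def bdd_below_def)
  qed (use PD mono in auto)
  then obtain x where x: "x \<in> D" and Px: "P x = x" by blast
  from P x obtain z T1 T2 y p p' where "R x z T1 T2 y (P x) p p'" by blast
  then have r: "R x z T1 T2 y x p p'" unfolding Px .
  let ?T = "T1 + T2"
  from r have z: "z 0 = (- x, 0)" "\<And>t. t \<ge> 0 \<Longrightarrow> (z has_vector_derivative clamped_field d (z t)) (at t within {0..})"
      "0 < T1" "0 < T2" "z T1 = (y, 0)" "z ?T = (- x, 0)" "0 < y" "x < loop_A" "0 < x"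
      and box: "\<And>t. 0 \<le> t \<Longrightarrow> t \<le> ?T \<Longrightarrow> - x \<le> fst (z t) \<and> fst (z t) \<le> 1 \<and> \<bar>snd (z t)\<bar> \<le> 3"
    unfolding R_def by auto
  have T: "?T > 0" using z by simp
  have per: "z ?T = z 0" by (simp only: z(1,6))
  from periodic_extension[OF T clamped_field_lipschitz[OF d] z(2) per]
  obtain Z where "\<forall>t. (Z has_vector_derivative clamped_field d (Z t)) (at t)" "\<forall>t. Z (t + ?T) = Z t" "\<forall>t\<ge>0. Z t = z t" by blast
  then have Z: "\<And>t. (Z has_vector_derivative clamped_field d (Z t)) (at t)" "\<And>t. Z (t + ?T) = Z t" "\<And>t. t \<ge> 0 \<Longrightarrow> Z t = z t" by blast+
  let ?w = "\<lambda>t. fst (Z t)" and ?v = "\<lambda>t. snd (Z t)"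
  have box: "- x \<le> ?w t \<and> ?w t \<le> 1 \<and> \<bar>?v t\<bar> \<le> 3" for t
  proof -
    obtain s where "0 \<le> s" "s \<le> ?T" "Z t = Z s" by (rule periodic_reduce[where w = Z and T = ?T, OF T Z(2)])
    then show ?thesis using box[of s] Z(3)[of s] by simp
  qed
  have sol: "solution (damping d) restoring ?w ?v"
    unfolding solution_def
  proof
    fix t
    have "\<bar>?w t\<bar> \<le> 3" "\<bar>?v t\<bar> \<le> 3" using box[of t] z(8) A by auto
    then show "(?w has_real_derivative ?v t) (at t) \<and> (?v has_real_derivative - restoring (?w t) - damping d (?w t) * ?v t) (at t)"
      using bounded_linear.has_vector_derivative[OF bounded_linear_fst Z(1)[of t]]
        bounded_linear.has_vector_derivative[OF bounded_linear_snd Z(1)[of t]]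
      by (simp add: clamped_field_def clamp3(3) has_real_derivative_iff_has_vector_derivative)
  qed
  have Z0: "Z 0 = (- x, 0)" "Z T1 = (y, 0)" using Z(3)[of 0] Z(3)[of T1] z by auto
  then have "(?w 0, ?v 0) \<noteq> (?w T1, ?v T1)" using z by auto
  moreover have "(\<forall>t. ?w (t + ?T) = ?w t) \<and> (\<forall>t. ?v (t + ?T) = ?v t)" by (simp add: Z(2))
  ultimately have per: "periodic_solution d ?w ?v"
    unfolding periodic_solution_def using sol T by (intro conjI exI[of _ ?T] exI[of _ 0] exI[of _ T1]) simp_all
  have h': "dulac_h d (?w t) > 0" for t using box[of t] z(8) by (intro h) auto
  have start: "\<Psi> (?w 0) (?v 0) \<ge> 0" using x by (simp add: Z0 \<Psi>_def D_def)
  have "?w (t + ?T) = ?w t" "?v (t + ?T) = ?v t" for t by (simp_all add: Z(2))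
  from \<Psi>_periodic_sign[OF sol T this h' start]
  have "(?v t)\<^sup>2 + dulac_b d (?w t) * ?v t + dulac_a d (?w t) > 0" for t by (simp only: \<Psi>_def)
  moreover have "- loop_A < ?w t \<and> ?w t \<le> 1" for t using box[of t] z(8) by auto
  ultimately show ?thesis using per by (intro exI[of _ ?w] exI[of _ ?v]) simp
qed

section \<open>Limit cycles\<close>

lemma solves_ode_iff_solution:
  "solves_ode (BT_field (- 1) (- (1 - d))) z \<longleftrightarrow> solution (damping d) restoring (\<lambda>t. fst (z t) + 1) (\<lambda>t. snd (z t))"
proof -
  have F: "BT_field (- 1) (- (1 - d)) p = (snd p, - restoring (fst p + 1) - damping d (fst p + 1) * snd p)" for p
    by (simp add: BT_field_def restoring_def damping_def case_prod_beta power2_eq_square algebra_simps)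
  have eq: "(z has_vector_derivative p) (at t) \<longleftrightarrow>
      ((\<lambda>t. fst (z t) + 1) has_real_derivative fst p) (at t) \<and> ((\<lambda>t. snd (z t)) has_real_derivative snd p) (at t)" for t p
  proof
    assume a: "(z has_vector_derivative p) (at t)"
    show "((\<lambda>t. fst (z t) + 1) has_real_derivative fst p) (at t) \<and> ((\<lambda>t. snd (z t)) has_real_derivative snd p) (at t)"
      using bounded_linear.has_vector_derivative[OF bounded_linear_fst a] bounded_linear.has_vector_derivative[OF bounded_linear_snd a]
      by (auto simp flip: has_real_derivative_iff_has_vector_derivative intro!: derivative_eq_intros)
  next
    assume a: "((\<lambda>t. fst (z t) + 1) has_real_derivative fst p) (at t) \<and> ((\<lambda>t. snd (z t)) has_real_derivative snd p) (at t)"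
    then have "((\<lambda>t. (fst (z t) + 1) - 1) has_real_derivative fst p - 0) (at t)"
      by (intro derivative_intros) auto
    then have "((\<lambda>t. fst (z t)) has_real_derivative fst p) (at t)" by simp
    from has_vector_derivative_pair[OF this conjunct2[OF a]] show "(z has_vector_derivative p) (at t)" by simp
  qed
  show ?thesis unfolding solves_ode_def solution_def eq F by simp
qed

lemma periodic_orbit_iff:
  "periodic_orbit (BT_field (- 1) (- (1 - d))) C \<longleftrightarrow>
     (\<exists>w v. periodic_solution d w v \<and> C = range (\<lambda>t. (w t - 1, v t)))"
proof
  assume "periodic_orbit (BT_field (- 1) (- (1 - d))) C"
  then obtain z T where z: "solves_ode (BT_field (- 1) (- (1 - d))) z" "T > 0" "\<forall>t. z (t + T) = z t" "\<not> z constant_on UNIV" "C = range z"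
    unfolding periodic_orbit_def by blast
  let ?w = "\<lambda>t. fst (z t) + 1" and ?v = "\<lambda>t. snd (z t)"
  obtain t t' where "z t \<noteq> z t'" using z(4) unfolding constant_on_def by blast
  then have "(?w t, ?v t) \<noteq> (?w t', ?v t')" by (auto simp: prod_eq_iff)
  moreover have "\<forall>t. ?w (t + T) = ?w t" "\<forall>t. ?v (t + T) = ?v t" using z(3) by simp_all
  ultimately have "periodic_solution d ?w ?v"
    using z(1,2) unfolding periodic_solution_def solves_ode_iff_solution by blast
  moreover have "C = range (\<lambda>t. (?w t - 1, ?v t))" using z(5) by simp
  ultimately show "\<exists>w v. periodic_solution d w v \<and> C = range (\<lambda>t. (w t - 1, v t))" by blast
next
  assume "\<exists>w v. periodic_solution d w v \<and> C = range (\<lambda>t. (w t - 1, v t))"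
  then obtain w v where p: "periodic_solution d w v" and C: "C = range (\<lambda>t. (w t - 1, v t))" by blast
  let ?z = "\<lambda>t. (w t - 1, v t)"
  from p obtain T where T: "solution (damping d) restoring w v" "T > 0" "\<forall>t. w (t + T) = w t" "\<forall>t. v (t + T) = v t"
    unfolding periodic_solution_def by blast
  from p obtain t t' where "(w t, v t) \<noteq> (w t', v t')" unfolding periodic_solution_def by blast
  then have "?z t \<noteq> ?z t'" by simp
  then have "\<not> ?z constant_on UNIV" unfolding constant_on_def by (metis UNIV_I)
  moreover have "solves_ode (BT_field (- 1) (- (1 - d))) ?z" unfolding solves_ode_iff_solution using T(1) by simp
  moreover have "\<forall>t. ?z (t + T) = ?z t" using T(3,4) by simp
  ultimately show "periodic_orbit (BT_field (- 1) (- (1 - d))) C"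
    unfolding periodic_orbit_def using T(2) C by blast
qed

text \<open>The leftmost points on the axis decide: if they differ, one orbit lies strictly inside
  the other and serves as the inner orbit of the flux argument; if they agree, the orbits share a
  point.\<close>

lemma unique_periodic_orbit:
  assumes d: "0 < d" "d < 1" and cert: "dulac_cert N" "d = real_of_int N / 10 ^ 10"
    and p1: "periodic_solution d w1 v1" and p2: "periodic_solution d w2 v2"
    and lo: "\<And>t. - loop_A < w1 t" "\<And>t. - loop_A < w2 t"
    and pos1: "\<And>t. (v1 t)\<^sup>2 + dulac_b d (w1 t) * v1 t + dulac_a d (w1 t) > 0"
    and pos2: "\<And>t. (v2 t)\<^sup>2 + dulac_b d (w2 t) * v2 t + dulac_a d (w2 t) > 0"
  shows "range (\<lambda>t. (w1 t, v1 t)) = range (\<lambda>t. (w2 t, v2 t))"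
proof -
  interpret dulac "damping d" restoring "dulac_a d" "dulac_b d" "dulac_h d" by (rule dulac_BT)
  interpret R: dulac f' g' "\<lambda>w. dulac_a d (- w)" "\<lambda>w. - dulac_b d (- w)" "\<lambda>w. dulac_h d (- w)" by (rule reflect)
  note facts = dulac_cert_facts[OF cert]
  have nested: False
    if arcs1: "half_arc (damping d) restoring (- A1) B1 p" "half_arc f' g' (- B1) A1 p'"
      "\<forall>x\<in>{- A1..B1}. \<exists>t. w t = x \<and> v t = p x" "\<forall>x\<in>{- A1..B1}. \<exists>t. w t = x \<and> v t = - p' (- x)"
      and arcs2: "half_arc (damping d) restoring (- A2) B2 q" "half_arc f' g' (- B2) A2 q'"
      and pos: "\<And>t. (v t)\<^sup>2 + dulac_b d (w t) * v t + dulac_a d (w t) > 0"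
      and AB: "A1 < A2" "A2 < loop_A" "B2 < 1"
    for A1 B1 p p' A2 B2 q q' w v
  proof -
    have l: "- A2 < - A1" using AB by simp
    have B: "B1 < B2" by (rule half_arc_less(1)[OF cont_restoring arcs1(1) arcs2(1) l])
    then have l': "- B2 < - B1" by simp
    show False
    proof (rule no_nested_orbit[OF arcs1(1,2) half_arc_outer_curve[OF cont_damping cont_restoring arcs2(1)]
          half_arc_outer_curve[OF R.cf R.cg arcs2(2)] AB(1) B])
      show "p x < q x" if "- A1 \<le> x" "x \<le> B1" for x by (rule half_arc_less(2)[OF cont_restoring arcs1(1) arcs2(1) l that])
      show "p' x < q' x" if "- B1 \<le> x" "x \<le> A1" for x by (rule half_arc_less(2)[OF R.cg arcs1(2) arcs2(2) l' that])
      show "dulac_a d 0 < 0" by (simp add: dulac_a_def damping_primitive_def)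
      fix x assume "- A1 \<le> x" "x \<le> B1"
      then have x: "x \<in> {- A1..B1}" by simp
      obtain t where "w t = x" "v t = p x" using arcs1(3) x by blast
      then show "\<Psi> x (p x) > 0" using pos[of t] by (simp add: \<Psi>_def)
      obtain t where "w t = x" "v t = - p' (- x)" using arcs1(4) x by blast
      then show "\<Psi> x (- p' (- x)) > 0" using pos[of t] by (simp add: \<Psi>_def)
    next
      fix x assume "- A2 < x" "x < B2"
      then show "dulac_h d x > 0" using AB loop_A_bounds by (intro facts(1)) linarith+
    next
      fix w x assume "- A2 \<le> w" "w \<le> B2" "4 * dulac_a d w - (dulac_b d w)\<^sup>2 \<le> 0" "w \<le> x \<and> x \<le> 0 \<or> 0 \<le> x \<and> x \<le> w"
      then show "4 * dulac_a d x - (dulac_b d x)\<^sup>2 \<le> 0" using AB loop_A_bounds by (intro facts(2)[of w x]) linarith+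
    qed
  qed
  obtain A1 B1 p p' where 1: "half_arc (damping d) restoring (- A1) B1 p" "half_arc f' g' (- B1) A1 p'"
    "B1 < 1" "\<forall>t. - A1 \<le> w1 t \<and> w1 t \<le> B1"
    "\<forall>x\<in>{- A1..B1}. \<exists>t. w1 t = x \<and> v1 t = p x" "\<forall>x\<in>{- A1..B1}. \<exists>t. w1 t = x \<and> v1 t = - p' (- x)"
    "\<exists>t. w1 t = - A1 \<and> v1 t = 0"
    by (rule periodic_solution_arcs[OF d p1])
  obtain A2 B2 q q' where 2: "half_arc (damping d) restoring (- A2) B2 q" "half_arc f' g' (- B2) A2 q'"
    "B2 < 1" "\<forall>t. - A2 \<le> w2 t \<and> w2 t \<le> B2"
    "\<forall>x\<in>{- A2..B2}. \<exists>t. w2 t = x \<and> v2 t = q x" "\<forall>x\<in>{- A2..B2}. \<exists>t. w2 t = x \<and> v2 t = - q' (- x)"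
    "\<exists>t. w2 t = - A2 \<and> v2 t = 0"
    by (rule periodic_solution_arcs[OF d p2])
  obtain t1 where t1: "w1 t1 = - A1" "v1 t1 = 0" using 1(7) by blast
  obtain t2 where t2: "w2 t2 = - A2" "v2 t2 = 0" using 2(7) by blast
  have A: "A1 < loop_A" "A2 < loop_A" using lo(1)[of t1] lo(2)[of t2] t1 t2 by simp_all
  have "\<not> A1 < A2" using nested[OF 1(1,2,5,6) 2(1,2) pos1 _ A(2) 2(3)] by blast
  moreover have "\<not> A2 < A1" using nested[OF 2(1,2,5,6) 1(1,2) pos2 _ A(1) 1(3)] by blast
  ultimately have "A1 = A2" by simp
  then show ?thesis using periodic_solution_eq[OF d p1 p2, of t1 t2] t1 t2 by simp
qed

theorem limit_cycle_exists:
  "\<exists>C. limit_cycle (BT_field (- 1) (- (8645452485 / 10 ^ 10))) C"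
proof -
  define d :: real where "d = 1354547515 / 10 ^ 10"
  have d: "0 < d" "d < 1" by (simp_all add: d_def)
  have dN: "d = real_of_int 1354547515 / 10 ^ 10" by (simp add: d_def)
  have c: "- (8645452485 / 10 ^ 10) = - (1 - d)" by (simp add: d_def)
  have e: "loop_defect d t > 0" if "\<bar>t\<bar> \<le> 1" for t using loop_defect_pos[OF that] by (simp add: d_def)
  have h: "dulac_h d x > 0" if "- loop_A \<le> x" "x \<le> 1" for x
    using dulac_cert_facts(1)[OF cert_d1 dN, of x] that loop_A_bounds by simp
  \<comment> \<open>A rational evaluation: the leftmost point of the loop lies in \<Psi> \<ge> 0, so
    the set of admissible starting points is not empty.\<close>
  have a: "dulac_a d (- loop_A) \<ge> 0"
    by (simp add: dulac_a_def damping_primitive_def loop_A_def \<sigma>_def \<kappa>_def d_def power2_eq_square power3_eq_cube)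
  from periodic_solution_exists[OF d e h a] obtain w v where p: "periodic_solution d w v"
    and wv: "\<And>t. - loop_A < w t \<and> w t \<le> 1 \<and> (v t)\<^sup>2 + dulac_b d (w t) * v t + dulac_a d (w t) > 0" by blast
  let ?C = "range (\<lambda>t. (w t - 1, v t))"
  let ?k = "\<lambda>z::real \<times> real. (snd z)\<^sup>2 + dulac_b d (fst z + 1) * snd z + dulac_a d (fst z + 1)"
  interpret dulac "damping d" restoring "dulac_a d" "dulac_b d" "dulac_h d" by (rule dulac_BT)
  \<comment> \<open>The neighbourhood is the entire region in which uniqueness has been proved, so
    isolation needs no local analysis of the orbit.\<close>
  define U where "U = {z. ?k z > 0} \<inter> {z. fst z + 1 > - loop_A}"
  have "continuous_on UNIV ?k" by (intro continuous_intros cont_ab_comp)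
  then have "open {z. ?k z > 0}" by (intro open_Collect_less continuous_on_const)
  moreover have "open {z::real \<times> real. fst z + 1 > - loop_A}" by (intro open_Collect_less continuous_intros)
  ultimately have "open U" unfolding U_def by (rule open_Int)
  moreover have "?C \<subseteq> U" using wv by (auto simp: U_def)
  moreover have "C' = ?C" if C': "periodic_orbit (BT_field (- 1) (- (1 - d))) C'" "C' \<subseteq> U" for C'
  proof -
    from C'(1) obtain w' v' where p': "periodic_solution d w' v'" and eq: "C' = range (\<lambda>t. (w' t - 1, v' t))"
      unfolding periodic_orbit_iff by blast
    have wv': "- loop_A < w' t \<and> (v' t)\<^sup>2 + dulac_b d (w' t) * v' t + dulac_a d (w' t) > 0" for t
    proof -
      have "(w' t - 1, v' t) \<in> U" using C'(2) eq by blast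
      then show ?thesis by (simp add: U_def)
    qed
    have "range (\<lambda>t. (w' t, v' t)) = range (\<lambda>t. (w t, v t))"
      by (rule unique_periodic_orbit[OF d cert_d1 dN p' p]) (use wv wv' in blast)+
    then have "(\<lambda>z. (fst z - 1, snd z)) ` range (\<lambda>t. (w' t, v' t)) = (\<lambda>z. (fst z - 1, snd z)) ` range (\<lambda>t. (w t, v t))"
      by (rule arg_cong)
    then show ?thesis unfolding eq image_image by simp
  qed
  moreover have "periodic_orbit (BT_field (- 1) (- (1 - d))) ?C" unfolding periodic_orbit_iff using p by blast
  ultimately show ?thesis unfolding c limit_cycle_def by blast
qed

theorem theorem3p10:
  fixes \<gamma> :: real
  assumes "\<gamma> > 0"
    and "\<And>\<alpha> \<beta> :: real. \<alpha> < 0 \<Longrightarrow>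
           (\<exists>C. limit_cycle (BT_field \<alpha> \<beta>) C) \<longleftrightarrow> \<gamma> < \<beta> / \<alpha> \<and> \<beta> / \<alpha> < 1"
  shows "\<gamma> \<in> {1127949288 / 1304673517 <..< 1223980221 / 1415750330}"
proof -
  have "\<gamma> < 8645452485 / 10 ^ 10"
    using assms(2)[of "- 1" "- (8645452485 / 10 ^ 10)"] limit_cycle_exists by simp
  \<comment> \<open>As this value of \<open>c\<close> is below 1, absence of limit cycles only gives
    \<open>c \<le> \<gamma>\<close>. That is enough, because \<open>c\<close> is strictly greater
    than the rational left endpoint.\<close>
  moreover have "\<not> (\<exists>C. limit_cycle (BT_field (- 1) (- (1 - 1354547529 / 10 ^ 10))) C)"
    unfolding limit_cycle_def periodic_orbit_iff using no_periodic_solution by blast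
  then have "8645452471 / 10 ^ 10 \<le> \<gamma>"
    using assms(2)[of "- 1" "- (1 - 1354547529 / 10 ^ 10)"] by simp
  ultimately show ?thesis by simp
qed

end
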